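(* Let $d\ge1$ be an integer, and let $p_j,q_j\in[1,\infty]$ and $s_j,t_j\in\mathbf R$ for $j=0,1,2$. Assume that at least one of the following statements holds true: (1) the map $(f_1,f_2)\mapsto f_1*f_2$ on $\mathscr S(\mathbf R^d)$ is continuously extendable to a map from $L^{p_1}_{t_1}(\mathbf R^d)\times L^{p_2}_{t_2}(\mathbf R^d)$ to $L^{p_0'}_{-t_0}(\mathbf R^d)$; (2) the map $(f_1,f_2)\mapsto f_1*f_2$ on $\mathscr S(\mathbf R^d)$ is continuously extendable to a map from $M^{p_1,q_1}_{s_1,t_1}(\mathbf R^d)\times M^{p_2,q_2}_{s_2,t_2}(\mathbf R^d)$ to $M^{p_0',q_0'}_{-s_0,-t_0}(\mathbf R^d)$; (3) the map $(f_1,f_2)\mapsto f_1*f_2$ from $\mathscr S(\mathbf R^d)\times\mathscr S(\mathbf R^d)$ to $\mathscr S(\mathbf R^d)$ is continuously extendable to a map from $W^{p_1,q_1}_{s_1,t_1}(\mathbf R^d)\times W^{p_2,q_2}_{s_2,t_2}(\mathbf R^d)$ to $W^{p_0',q_0'}_{-s_0,-t_0}(\mathbf R^d)$. Then $$0\le t_j+t_k\quad\text{for all } j,k\in\{0,1,2\},\ j\neq k,$$ and $$0\le t_0+t_1+t_2-d\cdot\mathsf R(p),\qquad\text{where } \mathsf R(p)=2-\frac1{p_0}-\frac1{p_1}-\frac1{p_2}.$$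
   Context: Write $\langle x\rangle=(1+|x|^2)^{1/2}$, and for $p\in[1,\infty]$ let $p'\in[1,\infty]$ be the conjugate exponent, $1/p+1/p'=1$ (with $1/\infty=0$). For $p\in[1,\infty]$, $t\in\mathbf R$, $L^p_t(\mathbf R^d)$ is the space of all measurable $f$ on $\mathbf R^d$ with $\|f\|_{L^p_t}=\|f\cdot\langle\cdot\rangle^t\|_{L^p}<\infty$. The Fourier transform $\mathscr F$ on $\mathscr S'(\mathbf R^d)$ is given by $(\mathscr Ff)(\xi)=(2\pi)^{-d/2}\int f(x)e^{-i\langle x,\xi\rangle}\,dx$ for $f\in L^1(\mathbf R^d)$. Fix a window $\phi\in\mathscr S(\mathbf R^d)\setminus\{0\}$. The short-time Fourier transform of $f\in\mathscr S'(\mathbf R^d)$ is $(V_\phi f)(x,\xi)=\mathscr F\big(f\cdot\overline{\phi(\cdot-x)}\big)(\xi)$. For $s,t\in\mathbf R$ and $p,q\in[1,\infty]$, the modulation space $M^{p,q}_{s,t}(\mathbf R^d)$ consists of all $f\in\mathscr S'(\mathbf R^d)$ such that $$\|f\|_{M^{p,q}_{s,t}}=\Big(\int_{\mathbf R^d}\Big(\int_{\mathbf R^d}|V_\phi f(x,\xi)\langle x\rangle^t\langle\xi\rangle^s|^p\,dx\Big)^{q/p}d\xi\Big)^{1/q}<\infty,$$ and $W^{p,q}_{s,t}(\mathbf R^d)$ consists of all $f\in\mathscr S'(\mathbf R^d)$ such that $$\|f\|_{W^{p,q}_{s,t}}=\Big(\int_{\mathbf R^d}\Big(\int_{\mathbf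 R^d}|V_\phi f(x,\xi)\langle x\rangle^t\langle\xi\rangle^s|^q\,d\xi\Big)^{p/q}dx\Big)^{1/p}<\infty,$$ with the obvious modifications when $p=\infty$ or $q=\infty$ (different choices of $\phi$ give equivalent norms). *)

theory Defs
  imports "HOL-Analysis.Analysis" "HOL-Probability.Essential_Supremum"
begin

section \<open>Weights, exponents and Lebesgue norms\<close>

definition bracket :: "'a::real_normed_vector \<Rightarrow> real" where
  "bracket x = sqrt (1 + (norm x)\<^sup>2)"

text \<open>Exponents are elements of \<^typ>\<open>ennreal\<close> that are at least 1. There
  \<open>1 / \<infinity> = 0\<close> and \<open>1 / 0 = \<infinity>\<close>, so the formula below is also right at the endpoints.\<close>

definition conj_exponent :: "ennreal \<Rightarrow> ennreal" where
  "conj_exponent p = 1 / (1 - 1 / p)"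

lemma conj_exponent_conjugate:
  assumes "1 \<le> p"
  shows "1 / p + 1 / conj_exponent p = 1"
proof -
  have inv: "inverse (inverse x) = x" for x :: ennreal
  proof (cases "x = 0 \<or> x = \<infinity>")
    case False
    then obtain r where "x = ennreal r" "0 < r"
      by (cases x) (auto simp: infinity_ennreal_def)
    then show ?thesis
      by (simp add: inverse_ennreal)
  qed auto
  have "1 / p \<le> 1"
    using assms by (metis divide_le_posI_ennreal mult.right_neutral order_less_le_trans zero_less_one)
  then have "1 / p + (1 - 1 / p) = 1"
    by simp
  then show ?thesis
    by (simp add: conj_exponent_def divide_ennreal_def inv)
qed

lemma one_le_conj_exponent: "1 \<le> conj_exponent p"
proof -
  have "1 \<le> inverse y" if "y \<le> 1" for y :: ennreal
  proof (cases "y = 0")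
    case False
    with that obtain r where "y = ennreal r" "0 < r" "r \<le> 1"
      by (cases y) (auto simp: top_unique)
    then show ?thesis
      by (simp add: inverse_ennreal one_le_inverse)
  qed simp
  then show ?thesis
    by (simp add: conj_exponent_def divide_ennreal_def)
qed

text \<open>Only used for \<open>r > 0\<close>.\<close>

definition epowr :: "ennreal \<Rightarrow> real \<Rightarrow> ennreal" where
  "epowr x r = (if x = \<infinity> then \<infinity> else ennreal (enn2real x powr r))"

definition Lp_enorm :: "ennreal \<Rightarrow> ('a::euclidean_space \<Rightarrow> ennreal) \<Rightarrow> ennreal" where
  "Lp_enorm p F =
    (if p = \<infinity> then esssup lebesgue F
     else epowr (\<integral>\<^sup>+ x. epowr (F x) (enn2real p) \<partial>lebesgue) (1 / enn2real p))"

text \<open>The elements of the weighted Lebesgue space are functions rather than classes of functions,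
  so that \<^term>\<open>wLp_norm p t\<close> is only a seminorm on it; see the remark on extensions at the end.\<close>

definition wLp_norm :: "ennreal \<Rightarrow> real \<Rightarrow> ('a::euclidean_space \<Rightarrow> complex) \<Rightarrow> ennreal" where
  "wLp_norm p t f = Lp_enorm p (\<lambda>x. ennreal (cmod (f x) * bracket x powr t))"

definition wLp :: "ennreal \<Rightarrow> real \<Rightarrow> ('a::euclidean_space \<Rightarrow> complex) set" where
  "wLp p t = {f \<in> borel_measurable lebesgue. wLp_norm p t f < \<infinity>}"


section \<open>Schwartz functions and tempered distributions\<close>

fun iter_deriv :: "'a::euclidean_space list \<Rightarrow> ('a \<Rightarrow> complex) \<Rightarrow> 'a \<Rightarrow> complex" where
  "iter_deriv [] f = f"
| "iter_deriv (b # bs) f = (\<lambda>x. frechet_derivative (iter_deriv bs f) (at x) b)"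

definition smooth :: "('a::euclidean_space \<Rightarrow> complex) \<Rightarrow> bool" where
  "smooth f \<longleftrightarrow> (\<forall>bs \<in> lists Basis. iter_deriv bs f differentiable_on UNIV)"

definition schwartz_seminorm :: "nat \<Rightarrow> ('a::euclidean_space \<Rightarrow> complex) \<Rightarrow> ennreal" where
  "schwartz_seminorm N f =
    (SUP x. SUP bs \<in> {bs \<in> lists Basis. length bs \<le> N}.
      ennreal (bracket x ^ N * cmod (iter_deriv bs f x)))"

definition schwartz :: "('a::euclidean_space \<Rightarrow> complex) \<Rightarrow> bool" where
  "schwartz f \<longleftrightarrow> smooth f \<and> (\<forall>N. schwartz_seminorm N f < \<infinity>)"

text \<open>A tempered distribution is a linear form on the Schwartz space that is continuous for the
  topology of the above (increasing) family of seminorms. HOL functions being total, it also has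
  values at functions that are not Schwartz; these values are irrelevant, and two functionals stand
  for the same distribution if they agree on all Schwartz functions.\<close>

definition tempered_distribution :: "(('a::euclidean_space \<Rightarrow> complex) \<Rightarrow> complex) \<Rightarrow> bool" where
  "tempered_distribution u \<longleftrightarrow>
    (\<forall>\<psi> \<eta>. schwartz \<psi> \<longrightarrow> schwartz \<eta> \<longrightarrow> u (\<lambda>x. \<psi> x + \<eta> x) = u \<psi> + u \<eta>) \<and>
    (\<forall>c \<psi>. schwartz \<psi> \<longrightarrow> u (\<lambda>x. c * \<psi> x) = c * u \<psi>) \<and>
    (\<forall>\<psi>. schwartz \<psi> \<longrightarrow> (\<forall>\<epsilon>>0. \<exists>N. \<exists>\<delta>>0. \<forall>\<eta>. schwartz \<eta> \<longrightarrow>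
        schwartz_seminorm N (\<lambda>x. \<eta> x - \<psi> x) < ennreal \<delta> \<longrightarrow> cmod (u \<eta> - u \<psi>) < \<epsilon>))"

text \<open>The (bilinear) pairing by which a function is regarded as a distribution.\<close>

definition distr_of :: "('a::euclidean_space \<Rightarrow> complex) \<Rightarrow> ('a \<Rightarrow> complex) \<Rightarrow> complex" where
  "distr_of f \<psi> = (LINT y|lborel. f y * \<psi> y)"

definition represents :: "('a::euclidean_space \<Rightarrow> complex) \<Rightarrow> (('a \<Rightarrow> complex) \<Rightarrow> complex) \<Rightarrow> bool" where
  "represents g u \<longleftrightarrow>
    (\<forall>\<psi>. schwartz \<psi> \<longrightarrow> integrable lborel (\<lambda>y. g y * \<psi> y) \<and> u \<psi> = distr_of g \<psi>)"

definition mult_distr ::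
    "('a::euclidean_space \<Rightarrow> complex) \<Rightarrow> (('a \<Rightarrow> complex) \<Rightarrow> complex) \<Rightarrow> ('a \<Rightarrow> complex) \<Rightarrow> complex" where
  "mult_distr h u \<psi> = u (\<lambda>y. h y * \<psi> y)"

definition fourier :: "('a::euclidean_space \<Rightarrow> complex) \<Rightarrow> 'a \<Rightarrow> complex" where
  "fourier f \<xi> = of_real ((2 * pi) powr (- real DIM('a) / 2)) *
    (LINT x|lborel. f x * exp (- \<i> * of_real (x \<bullet> \<xi>)))"

text \<open>The extension of \<^const>\<open>fourier\<close> to tempered distributions is its transpose.\<close>

definition fourier_distr ::
    "(('a::euclidean_space \<Rightarrow> complex) \<Rightarrow> complex) \<Rightarrow> ('a \<Rightarrow> complex) \<Rightarrow> complex" where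
  "fourier_distr u \<psi> = u (fourier \<psi>)"


section \<open>Short-time Fourier transform and modulation spaces\<close>

text \<open>For fixed \<open>x\<close>, the Fourier transform of the distribution \<open>u \<cdot> cnj (\<phi> (\<cdot> - x))\<close> is a continuous
  function. A distribution is represented by at most one continuous function, so its value at a
  point \<open>\<xi>\<close> is well defined.\<close>

definition point_value :: "(('a::euclidean_space \<Rightarrow> complex) \<Rightarrow> complex) \<Rightarrow> 'a \<Rightarrow> complex" where
  "point_value u = (THE g. continuous_on UNIV g \<and> represents g u)"

definition stft ::
    "('a::euclidean_space \<Rightarrow> complex) \<Rightarrow> (('a \<Rightarrow> complex) \<Rightarrow> complex) \<Rightarrow> 'a \<Rightarrow> 'a \<Rightarrow> complex" where
  "stft \<phi> u x \<xi> = point_value (fourier_distr (mult_distr (\<lambda>y. cnj (\<phi> (y - x))) u)) \<xi>"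

text \<open>In both norms the exponent \<open>p\<close> and the weight \<open>t\<close> belong to \<open>x\<close>, and \<open>q\<close> and \<open>s\<close> belong
  to \<open>\<xi>\<close>. The parameters are in the order \<open>p q s t\<close>.\<close>

definition M_norm :: "('a::euclidean_space \<Rightarrow> complex) \<Rightarrow> ennreal \<Rightarrow> ennreal \<Rightarrow> real \<Rightarrow> real \<Rightarrow>
    (('a \<Rightarrow> complex) \<Rightarrow> complex) \<Rightarrow> ennreal" where
  "M_norm \<phi> p q s t u =
    Lp_enorm q (\<lambda>\<xi>. Lp_enorm p (\<lambda>x.
      ennreal (cmod (stft \<phi> u x \<xi>) * bracket x powr t * bracket \<xi> powr s)))"

definition W_norm :: "('a::euclidean_space \<Rightarrow> complex) \<Rightarrow> ennreal \<Rightarrow> ennreal \<Rightarrow> real \<Rightarrow> real \<Rightarrow>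
    (('a \<Rightarrow> complex) \<Rightarrow> complex) \<Rightarrow> ennreal" where
  "W_norm \<phi> p q s t u =
    Lp_enorm p (\<lambda>x. Lp_enorm q (\<lambda>\<xi>.
      ennreal (cmod (stft \<phi> u x \<xi>) * bracket x powr t * bracket \<xi> powr s)))"

definition M_space :: "('a::euclidean_space \<Rightarrow> complex) \<Rightarrow> ennreal \<Rightarrow> ennreal \<Rightarrow> real \<Rightarrow> real \<Rightarrow>
    (('a \<Rightarrow> complex) \<Rightarrow> complex) set" where
  "M_space \<phi> p q s t = {u. tempered_distribution u \<and> M_norm \<phi> p q s t u < \<infinity>}"

definition W_space :: "('a::euclidean_space \<Rightarrow> complex) \<Rightarrow> ennreal \<Rightarrow> ennreal \<Rightarrow> real \<Rightarrow> real \<Rightarrow>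
    (('a \<Rightarrow> complex) \<Rightarrow> complex) set" where
  "W_space \<phi> p q s t = {u. tempered_distribution u \<and> W_norm \<phi> p q s t u < \<infinity>}"


section \<open>Continuous extensions of the convolution\<close>

definition convolve :: "('a::euclidean_space \<Rightarrow> complex) \<Rightarrow> ('a \<Rightarrow> complex) \<Rightarrow> 'a \<Rightarrow> complex" where
  "convolve f g x = (LINT y|lborel. f (x - y) * g y)"

text \<open>Continuity of \<open>T\<close> from \<open>X\<^sub>1 \<times> X\<^sub>2\<close> to \<open>X\<^sub>0\<close> for the topologies defined by
  seminorms \<open>N\<^sub>1\<close>, \<open>N\<^sub>2\<close>, \<open>N\<^sub>0\<close>.\<close>

definition continuous_map2 ::
    "'u::minus set \<Rightarrow> ('u \<Rightarrow> ennreal) \<Rightarrow> 'v::minus set \<Rightarrow> ('v \<Rightarrow> ennreal) \<Rightarrow>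
     'w::minus set \<Rightarrow> ('w \<Rightarrow> ennreal) \<Rightarrow> ('u \<Rightarrow> 'v \<Rightarrow> 'w) \<Rightarrow> bool" where
  "continuous_map2 X1 N1 X2 N2 X0 N0 T \<longleftrightarrow>
    (\<forall>u\<in>X1. \<forall>v\<in>X2. T u v \<in> X0) \<and>
    (\<forall>u\<in>X1. \<forall>v\<in>X2. \<forall>\<epsilon>>0. \<exists>\<delta>>0. \<forall>u'\<in>X1. \<forall>v'\<in>X2.
        N1 (u' - u) < ennreal \<delta> \<longrightarrow> N2 (v' - v) < ennreal \<delta> \<longrightarrow>
        N0 (T u' v' - T u v) < ennreal \<epsilon>)"

text \<open>The map \<open>\<iota>\<close> is the inclusion of the Schwartz space into the three spaces. Neither uniqueness
  nor bilinearity of the extension \<open>T\<close> is required. A map that is continuous in the above sense takes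
  arguments at distance 0 to values at distance 0, so it descends to the spaces in which elements
  at distance 0 (functions that agree almost everywhere, or functionals that agree on the Schwartz
  space) are identified; conversely a continuous map between the latter lifts to a map \<open>T\<close> for which
  the equation below holds on the nose.\<close>

definition convolution_extends ::
    "(('a::euclidean_space \<Rightarrow> complex) \<Rightarrow> 'u::minus) \<Rightarrow>
     'u set \<Rightarrow> ('u \<Rightarrow> ennreal) \<Rightarrow> 'u set \<Rightarrow> ('u \<Rightarrow> ennreal) \<Rightarrow> 'u set \<Rightarrow> ('u \<Rightarrow> ennreal) \<Rightarrow> bool" where
  "convolution_extends \<iota> X1 N1 X2 N2 X0 N0 \<longleftrightarrow>
    (\<exists>T. continuous_map2 X1 N1 X2 N2 X0 N0 T \<and>
      (\<forall>f g. schwartz f \<longrightarrow> schwartz g \<longrightarrow> T (\<iota> f) (\<iota> g) = \<iota> (convolve f g)))"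

definition convolution_extends_L ::
    "'a::euclidean_space itself \<Rightarrow> ennreal \<Rightarrow> real \<Rightarrow> ennreal \<Rightarrow> real \<Rightarrow> ennreal \<Rightarrow> real \<Rightarrow> bool" where
  "convolution_extends_L TYPE('a) p1 t1 p2 t2 p0 t0 \<longleftrightarrow>
    convolution_extends (\<lambda>f :: 'a \<Rightarrow> complex. f)
      (wLp p1 t1) (wLp_norm p1 t1) (wLp p2 t2) (wLp_norm p2 t2) (wLp p0 t0) (wLp_norm p0 t0)"

definition convolution_extends_M ::
    "('a::euclidean_space \<Rightarrow> complex) \<Rightarrow> ennreal \<Rightarrow> ennreal \<Rightarrow> real \<Rightarrow> real \<Rightarrow>
     ennreal \<Rightarrow> ennreal \<Rightarrow> real \<Rightarrow> real \<Rightarrow> ennreal \<Rightarrow> ennreal \<Rightarrow> real \<Rightarrow> real \<Rightarrow> bool" where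
  "convolution_extends_M \<phi> p1 q1 s1 t1 p2 q2 s2 t2 p0 q0 s0 t0 \<longleftrightarrow>
    convolution_extends distr_of
      (M_space \<phi> p1 q1 s1 t1) (M_norm \<phi> p1 q1 s1 t1)
      (M_space \<phi> p2 q2 s2 t2) (M_norm \<phi> p2 q2 s2 t2)
      (M_space \<phi> p0 q0 s0 t0) (M_norm \<phi> p0 q0 s0 t0)"

definition convolution_extends_W ::
    "('a::euclidean_space \<Rightarrow> complex) \<Rightarrow> ennreal \<Rightarrow> ennreal \<Rightarrow> real \<Rightarrow> real \<Rightarrow>
     ennreal \<Rightarrow> ennreal \<Rightarrow> real \<Rightarrow> real \<Rightarrow> ennreal \<Rightarrow> ennreal \<Rightarrow> real \<Rightarrow> real \<Rightarrow> bool" where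
  "convolution_extends_W \<phi> p1 q1 s1 t1 p2 q2 s2 t2 p0 q0 s0 t0 \<longleftrightarrow>
    convolution_extends distr_of
      (W_space \<phi> p1 q1 s1 t1) (W_norm \<phi> p1 q1 s1 t1)
      (W_space \<phi> p2 q2 s2 t2) (W_norm \<phi> p2 q2 s2 t2)
      (W_space \<phi> p0 q0 s0 t0) (W_norm \<phi> p0 q0 s0 t0)"

definition R_functional :: "(nat \<Rightarrow> ennreal) \<Rightarrow> real" where
  "R_functional p = 2 - enn2real (1 / p 0) - enn2real (1 / p 1) - enn2real (1 / p 2)"

end

theory Submission
  imports Defs "HOL-Probability.Characteristic_Functions" "HOL-Probability.Sinc_Integral"
    "HOL-Real_Asymp.Real_Asymp"
begin

text \<open>Continuity at zero and homogeneity turn each of the three assumptions into an inequality between norms,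
  \<open>N\<^sub>0 (f * g) \<le> D N\<^sub>1 f N\<^sub>2 g\<close> for Schwartz functions \<open>f\<close> and \<open>g\<close>. It is tested on Gaussians. The
  Gaussian \<open>gauss c a \<rho>\<close> has center \<open>a\<close> and width \<open>1 / \<rho> \<ge> 1\<close>, and the convolution of two Gaussians of
  the same width with centers \<open>a\<close> and \<open>b\<close> is a Gaussian with center \<open>a + b\<close> and a multiple of
  \<open>\<rho> powr - d\<close> as its height, where \<open>d\<close> is the dimension (\<open>convolve_gauss\<close>).

  If \<open>a\<close> is far away compared to the width, then the weight is comparable to \<open>norm a powr t\<close> on the bulk of
  \<open>gauss 1 a \<rho>\<close>, and the norm of this function in the weighted Lebesgue space is comparable to
  \<open>norm a powr t * \<rho> powr (- d / p)\<close>. The same holds in the modulation spaces and in the spaces \<open>W\<close>,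
  whatever \<open>q\<close> and \<open>s\<close> are: since the Gaussians are flat, their short-time Fourier transforms live
  at bounded frequencies and, in \<open>x\<close>, near the Gaussian itself. This is why one argument
  covers all three cases. The upper bound (\<open>stft_gauss_le\<close>) integrates by parts to gain decay in the
  frequency. The lower bound (\<open>stft_gauss_ge\<close>) freezes the Gaussian at \<open>x\<close>, which leaves the Fourier
  transform of the conjugate window; by injectivity of the Fourier transform it is bounded below
  on some ball of frequencies.

  Inserting these norms into the inequality (\<open>gauss_test_inequality\<close>) and moving the centers to infinity gives
  the conditions (\<open>exponent_conditions\<close>). With fixed width, opposite centers \<open>a\<close> and \<open>- a\<close> give
  \<open>0 \<le> t\<^sub>1 + t\<^sub>2\<close>, and centers \<open>a\<close> and \<open>0\<close> give \<open>0 \<le> t\<^sub>0 + t\<^sub>1\<close> and \<open>0 \<le> t\<^sub>0 + t\<^sub>2\<close>. With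
  both centers at \<open>a\<close> and a width that grows almost as fast as \<open>norm a\<close>, the powers of the
  width and of \<open>norm a\<close> combine to the condition with \<open>R(p)\<close>.\<close>

section \<open>Brackets and their decay\<close>

lemma bracket_ge_1: "1 \<le> bracket x"
  by (simp add: bracket_def)

lemma bracket_pos [simp]: "0 < bracket x"
  using bracket_ge_1[of x] by linarith

lemma bracket_nonneg [simp]: "0 \<le> bracket x"
  by (rule less_imp_le) simp

lemma norm_le_bracket: "norm x \<le> bracket x"
  by (simp add: bracket_def real_le_rsqrt)

lemma bracket_le_1_norm: "bracket x \<le> 1 + norm x"
  unfolding bracket_def by (rule real_le_lsqrt) (auto simp: power2_sum)

lemma bracket_add_le: "bracket (x + y) \<le> bracket x + norm y"
proof -
  have "(bracket (x + y))\<^sup>2 \<le> 1 + (norm x + norm y)\<^sup>2"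
    by (simp add: bracket_def power_mono norm_triangle_ineq)
  also have "\<dots> \<le> (bracket x + norm y)\<^sup>2"
    using mult_right_mono[OF norm_le_bracket[of x] norm_ge_zero[of y]]
    by (simp add: power2_sum bracket_def)
  finally show ?thesis
    by (rule power2_le_imp_le) (simp add: add_nonneg_nonneg)
qed

lemma bracket_add_le_mult: "bracket (x + y) \<le> 2 * bracket x * bracket y"
proof -
  have "bracket x + norm y \<le> bracket x * bracket y + bracket x * bracket y"
    using mult_left_mono[OF bracket_ge_1[of y] bracket_nonneg[of x]]
      mult_mono[OF bracket_ge_1[of x] norm_le_bracket[of y]] by (intro add_mono) auto
  with bracket_add_le[of x y] show ?thesis by simp
qed

lemma bracket_uminus [simp]: "bracket (- x) = bracket x"
  by (simp add: bracket_def)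

lemma bracket_0 [simp]: "bracket 0 = 1"
  by (simp add: bracket_def)

lemma bracket_mono: "norm x \<le> norm y \<Longrightarrow> bracket x \<le> bracket y"
  by (simp add: bracket_def power_mono)

lemma continuous_on_bracket [continuous_intros]:
  "continuous_on S f \<Longrightarrow> continuous_on S (\<lambda>x. bracket (f x))"
  unfolding bracket_def by (intro continuous_intros)

definition decay :: "nat \<Rightarrow> 'a::real_normed_vector \<Rightarrow> real" where
  "decay m x = 1 / bracket x ^ m"

lemma decay_pos [simp]: "0 < decay m x"
  by (simp add: decay_def)

lemma decay_nonneg [simp]: "0 \<le> decay m x"
  by (rule less_imp_le) simp

lemma decay_le_1: "decay m x \<le> 1"
  by (simp add: decay_def bracket_ge_1)

lemma decay_add: "decay (m + n) x = decay m x * decay n x"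
  by (simp add: decay_def power_add)

lemma decay_times_bracket: "decay m x * bracket x ^ m = 1"
proof -
  have "bracket x \<noteq> 0" using bracket_pos[of x] by linarith
  then show ?thesis by (simp add: decay_def)
qed

lemma continuous_on_decay [continuous_intros]:
  "continuous_on S f \<Longrightarrow> continuous_on S (\<lambda>x. decay m (f x))"
  unfolding decay_def by (intro continuous_intros) (auto simp: less_imp_neq[OF bracket_pos, symmetric])

lemma borel_measurable_decay [measurable]:
  "(decay m :: 'a::euclidean_space \<Rightarrow> real) \<in> borel_measurable borel"
  by (intro borel_measurable_continuous_onI continuous_intros)

text \<open>Peetre's inequality, which moves decay from one point to another at the price of a power of the
  bracket of their difference.\<close>

lemma decay_add_le: "decay m (x + y) \<le> 2 ^ m * decay m x * bracket y ^ m"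
proof -
  have "bracket x \<le> 2 * bracket (x + y) * bracket y"
    using bracket_add_le_mult[of "x + y" "- y"] by simp
  then have "bracket x ^ m \<le> (2 * bracket (x + y) * bracket y) ^ m"
    by (rule power_mono) simp
  then show ?thesis
    by (simp add: decay_def field_simps power_mult_distrib)
qed

text \<open>The product of the \<open>1 + x\<^sub>b\<^sup>2\<close> over the coordinates is at most
  \<open>bracket x ^ (2 * DIM('a))\<close>, and the integral of its inverse is a product of integrals
  over the line.\<close>

lemma integrable_decay:
  assumes "2 * DIM('a) \<le> m"
  shows "integrable lborel (decay m :: 'a::euclidean_space \<Rightarrow> real)"
proof -
  let ?g = "\<lambda>x::'a. \<Prod>b\<in>Basis. ennreal (inverse (1 + (x \<bullet> b)\<^sup>2))"
  have "integrable lborel (\<lambda>x::real. inverse (1 + x\<^sup>2))"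
    using integrable_inverse_1_plus_square by (simp add: set_integrable_def)
  then have fin: "(\<integral>\<^sup>+ x. ennreal (inverse (1 + x\<^sup>2)) \<partial>lborel) < \<infinity>"
    by (subst (asm) integrable_iff_bounded) simp
  have le: "ennreal (norm (decay m x)) \<le> ?g x" for x :: 'a
  proof -
    have "1 \<le> 1 + (x \<bullet> b)\<^sup>2 \<and> 1 + (x \<bullet> b)\<^sup>2 \<le> (bracket x)\<^sup>2" if "b \<in> Basis" for b
      using Basis_le_norm[OF that, of x] by (auto simp: bracket_def intro: abs_le_square_iff[THEN iffD1] power2_le_iff_abs_le[THEN iffD2])
    then have "(\<Prod>b\<in>Basis. 1 + (x \<bullet> b)\<^sup>2) \<le> (\<Prod>b\<in>(Basis::'a set). (bracket x)\<^sup>2)"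
      by (intro prod_mono) (smt (verit))
    also have "\<dots> = bracket x ^ (2 * DIM('a))"
      by (simp add: power_mult)
    also have "\<dots> \<le> bracket x ^ m"
      by (intro power_increasing assms bracket_ge_1)
    finally have "decay m x \<le> inverse (\<Prod>b\<in>Basis. 1 + (x \<bullet> b)\<^sup>2)"
      unfolding decay_def inverse_eq_divide
      by (intro frac_le) (auto intro!: prod_pos simp: add_pos_nonneg)
    then show ?thesis
      by (simp add: prod_ennreal prod_inversef[symmetric] comp_def ennreal_leI)
  qed
  have "(\<integral>\<^sup>+ x. ennreal (norm (decay m x)) \<partial>(lborel::'a measure)) \<le> (\<integral>\<^sup>+ x. ?g x \<partial>lborel)"
    by (intro nn_integral_mono le)
  also have "\<dots> = (\<Prod>b\<in>(Basis::'a set). \<integral>\<^sup>+ x. ennreal (inverse (1 + x\<^sup>2)) \<partial>lborel)"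
    by (subst nn_integral_lborel_prod[of "\<lambda>b x. ennreal (inverse (1 + x\<^sup>2))"]) auto
  also have "\<dots> < \<infinity>"
    using fin by (simp add: power_less_top_ennreal)
  finally show ?thesis
    by (intro integrableI_bounded) auto
qed

section \<open>Affine changes of variables\<close>

lemma nn_integral_lborel_affine:
  fixes f :: "'a::euclidean_space \<Rightarrow> ennreal"
  assumes [measurable]: "f \<in> borel_measurable borel" and c: "0 < c"
  shows "(\<integral>\<^sup>+ x. f (c *\<^sub>R (x - a)) \<partial>lborel) = ennreal (c powr (- real DIM('a))) * (\<integral>\<^sup>+ x. f x \<partial>lborel)"
proof -
  have "(\<integral>\<^sup>+ x. f x \<partial>lborel) = ennreal (c ^ DIM('a)) * (\<integral>\<^sup>+ x. f (- c *\<^sub>R a + c *\<^sub>R x) \<partial>lborel)"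
    using c by (subst lborel_affine[of c "- c *\<^sub>R a"]) (auto simp: nn_integral_density nn_integral_distr nn_integral_cmult)
  moreover have "ennreal (c powr (- real DIM('a))) * ennreal (c ^ DIM('a)) = 1"
    using c by (simp add: ennreal_mult[symmetric] powr_minus powr_realpow)
  ultimately show ?thesis
    by (simp add: mult.assoc[symmetric] algebra_simps)
qed

lemma lborel_integral_affine:
  fixes f :: "'a::euclidean_space \<Rightarrow> 'b::{banach, second_countable_topology}"
  assumes [measurable]: "f \<in> borel_measurable borel" and c: "0 < c"
  shows "(LINT x|lborel. f (c *\<^sub>R (x - a))) = c powr (- real DIM('a)) *\<^sub>R (LINT x|lborel. f x)"
proof -
  have "(LINT x|lborel. f x) = c ^ DIM('a) *\<^sub>R (LINT x|lborel. f (- c *\<^sub>R a + c *\<^sub>R x))"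
    using c by (subst lborel_affine[of c "- c *\<^sub>R a"]) (auto simp: integral_density integral_distr)
  moreover have "c powr (- real DIM('a)) * c ^ DIM('a) = 1"
    using c by (simp add: powr_minus powr_realpow)
  ultimately show ?thesis
    by (simp add: algebra_simps)
qed

lemma lborel_integrable_affine:
  fixes f :: "'a::euclidean_space \<Rightarrow> 'b::{banach, second_countable_topology}"
  assumes f: "integrable lborel f" and c: "0 < c"
  shows "integrable lborel (\<lambda>x. f (c *\<^sub>R (x - a)))"
proof -
  have [measurable]: "f \<in> borel_measurable borel" using f by simp
  have "(\<integral>\<^sup>+ x. ennreal (norm (f (c *\<^sub>R (x - a)))) \<partial>lborel) < \<infinity>"
    using f c unfolding integrable_iff_bounded
    by (subst nn_integral_lborel_affine[of "\<lambda>x. ennreal (norm (f x))"]) (auto simp: ennreal_mult_less_top)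
  then show ?thesis
    by (intro integrableI_bounded) auto
qed

lemma lborel_integral_translate:
  fixes f :: "'a::euclidean_space \<Rightarrow> 'b::{banach, second_countable_topology}"
  assumes "f \<in> borel_measurable borel"
  shows "(LINT x|lborel. f (x - a)) = (LINT x|lborel. f x)"
  using lborel_integral_affine[OF assms, of 1 a] by simp

lemma lborel_integrable_translate:
  fixes f :: "'a::euclidean_space \<Rightarrow> 'b::{banach, second_countable_topology}"
  assumes "integrable lborel f"
  shows "integrable lborel (\<lambda>x. f (x - a))"
  using lborel_integrable_affine[OF assms, of 1 a] by simp

section \<open>The functional \<open>Lp_enorm\<close>\<close>

lemma epowr_ennreal: "0 \<le> c \<Longrightarrow> epowr (ennreal c) r = ennreal (c powr r)"
  by (simp add: epowr_def)

lemma epowr_mono: "0 < r \<Longrightarrow> x \<le> y \<Longrightarrow> epowr x r \<le> epowr y r"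
  by (auto simp: epowr_def top_unique less_top intro!: ennreal_leI powr_mono2 enn2real_mono)

lemma epowr_mult:
  assumes "0 < r" "c < \<infinity>"
  shows "epowr (c * x) r = epowr c r * epowr x r"
proof (cases "x = \<infinity>")
  case True
  with assms show ?thesis
    by (auto simp: epowr_def ennreal_mult_eq_top_iff top_unique ennreal_mult_top enn2real_eq_0_iff)
next
  case False
  with assms show ?thesis
    by (auto simp: epowr_def ennreal_mult_eq_top_iff enn2real_mult powr_mult ennreal_mult)
qed

lemma epowr_epowr: "0 < r \<Longrightarrow> epowr (epowr x r) (1 / r) = x"
  by (cases x) (auto simp: epowr_def powr_powr)

lemma borel_measurable_epowr [measurable (raw)]:
  assumes [measurable]: "f \<in> borel_measurable M"
  shows "(\<lambda>x. epowr (f x) r) \<in> borel_measurable M"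
  unfolding epowr_def by measurable

lemma exponent_real:
  assumes "1 \<le> p" "p \<noteq> (\<infinity>::ennreal)"
  obtains r where "p = ennreal r" "1 \<le> r" "enn2real (1 / p) = 1 / r"
proof -
  from assms obtain r where r: "p = ennreal r" "0 \<le> r" by (cases p) auto
  with assms have "1 \<le> r" by simp
  with r that show ?thesis by (simp add: divide_ennreal_def inverse_ennreal inverse_eq_divide)
qed

lemma enn2real_inverse_exponent_infinity: "enn2real (1 / (\<infinity>::ennreal)) = 0"
  by (simp add: divide_ennreal_def)

lemma Lp_enorm_top: "Lp_enorm top F = esssup lebesgue F"
  by (simp add: Lp_enorm_def)

lemma Lp_enorm_real:
  "1 \<le> r \<Longrightarrow> Lp_enorm (ennreal r) F = epowr (\<integral>\<^sup>+ x. epowr (F x) r \<partial>lborel) (1 / r)"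
  by (simp add: Lp_enorm_def nn_integral_completion)

text \<open>Only the smaller function has to be measurable: the essential supremum of a function that is
  not measurable is \<open>\<infinity>\<close>.\<close>

lemma Lp_enorm_mono:
  assumes "1 \<le> p" "F \<in> borel_measurable lebesgue" "\<And>x. F x \<le> G x"
  shows "Lp_enorm p F \<le> Lp_enorm p G"
proof (cases "p = \<infinity>")
  case True
  with assms show ?thesis by (simp add: Lp_enorm_top esssup_mono)
next
  case False
  with assms(1) obtain r where "p = ennreal r" "1 \<le> r" by (rule exponent_real)
  with assms show ?thesis
    by (auto simp: Lp_enorm_real intro!: epowr_mono nn_integral_mono)
qed

lemma lebesgue_not_null: "emeasure lebesgue (space (lebesgue :: 'a::euclidean_space measure)) \<noteq> 0"
  by simp

lemma esssup_cmult_ennreal: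
  fixes F :: "'a::euclidean_space \<Rightarrow> ennreal"
  assumes F: "F \<in> borel_measurable lebesgue" and c: "c < \<infinity>"
  shows "esssup lebesgue (\<lambda>x. c * F x) = c * esssup lebesgue F"
proof (cases "c = 0")
  case True
  then show ?thesis
    using esssup_const[OF lebesgue_not_null, of "0::ennreal"] by simp
next
  case False
  have [measurable]: "F \<in> borel_measurable lebesgue" by fact
  obtain r where r: "c = ennreal r" "0 < r"
    using False c by (cases c) (auto simp: less_le)
  define c' where "c' = ennreal (1 / r)"
  have "c' * c = 1" "c * c' = 1"
    using r by (simp_all add: c'_def ennreal_mult[symmetric])
  then have cancel: "c' * (c * y) = y" "c * (c' * y) = y" for y
    by (simp_all add: mult.assoc[symmetric])
  show ?thesis
  proof (rule antisym)
    show "esssup lebesgue (\<lambda>x. c * F x) \<le> c * esssup lebesgue F"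
      using esssup_AE[of F lebesgue] by (intro esssup_I) (auto intro: mult_left_mono elim!: eventually_mono)
    have "esssup lebesgue F \<le> c' * esssup lebesgue (\<lambda>x. c * F x)"
    proof (rule esssup_I)
      show "AE x in lebesgue. F x \<le> c' * esssup lebesgue (\<lambda>x. c * F x)"
        using esssup_AE[of "\<lambda>x. c * F x" lebesgue]
        by eventually_elim (metis cancel(1) mult_left_mono zero_le)
    qed simp
    then show "c * esssup lebesgue F \<le> esssup lebesgue (\<lambda>x. c * F x)"
      by (metis cancel(2) mult_left_mono zero_le)
  qed
qed

lemma Lp_enorm_cmult:
  assumes "1 \<le> p" and F [measurable]: "F \<in> borel_measurable borel" and c: "c < \<infinity>"
  shows "Lp_enorm p (\<lambda>x. c * F x) = c * Lp_enorm p F"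
proof (cases "p = \<infinity>")
  case True
  have "F \<in> borel_measurable lebesgue" using F by (simp add: measurable_completion)
  with True c show ?thesis by (simp add: Lp_enorm_top esssup_cmult_ennreal)
next
  case False
  with assms(1) obtain r where r: "p = ennreal r" "1 \<le> r" by (rule exponent_real)
  have "epowr c r < \<infinity>" using c by (auto simp: epowr_def)
  with r c show ?thesis
    by (simp add: Lp_enorm_real epowr_mult nn_integral_cmult epowr_epowr)
qed

lemma esssup_ge_on_open:
  fixes F :: "'a::euclidean_space \<Rightarrow> ennreal"
  assumes U: "open U" "U \<noteq> {}" and le: "\<And>x. x \<in> U \<Longrightarrow> c \<le> F x"
  shows "c \<le> esssup lebesgue F"
proof (rule ccontr)
  assume less: "\<not> c \<le> esssup lebesgue F"
  have "AE x in lebesgue. x \<notin> U"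
    using esssup_AE[of F lebesgue] by eventually_elim (use less le in force)
  then have "negligible U"
    using U by (auto simp: negligible_iff_null_sets AE_iff_null_sets[of U lebesgue])
  then show False
    using U open_not_negligible by blast
qed

lemma esssup_continuous:
  fixes f :: "'a::euclidean_space \<Rightarrow> real"
  assumes f: "continuous_on UNIV f"
    and dense: "\<And>X :: 'a set. open X \<Longrightarrow> X \<noteq> {} \<Longrightarrow> \<exists>d\<in>D. d \<in> X"
  shows "esssup lebesgue (\<lambda>x. ennreal (f x)) = (SUP x\<in>D. ennreal (f x))"
proof (rule antisym)
  have op: "open {x. c < ennreal (f x)}" for c
  proof -
    have "continuous_on UNIV (\<lambda>x. ennreal (f x))"
      using f by (intro continuous_on_ennreal)
    then show ?thesis
      by (simp add: open_Collect_less continuous_on_const)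
  qed
  have "ennreal (f x) \<le> (SUP x\<in>D. ennreal (f x))" for x
  proof (rule ccontr)
    assume "\<not> ?thesis"
    then obtain d where "d \<in> D" "(SUP x\<in>D. ennreal (f x)) < ennreal (f d)"
      using dense[OF op[of "SUP x\<in>D. ennreal (f x)"]] by (auto simp: not_le)
    then show False
      by (meson SUP_upper linorder_not_less)
  qed
  moreover have "(\<lambda>x. ennreal (f x)) \<in> borel_measurable borel"
    using borel_measurable_continuous_onI[OF f] by measurable
  ultimately show "esssup lebesgue (\<lambda>x. ennreal (f x)) \<le> (SUP x\<in>D. ennreal (f x))"
    by (intro esssup_I) (auto intro: measurable_completion)
  show "(SUP x\<in>D. ennreal (f x)) \<le> esssup lebesgue (\<lambda>x. ennreal (f x))"
  proof (rule SUP_least, rule dense_le)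
    fix d c assume "c < ennreal (f d)"
    then show "c \<le> esssup lebesgue (\<lambda>x. ennreal (f x))"
      using op[of c] by (intro esssup_ge_on_open[of "{x. c < ennreal (f x)}"]) (auto intro: less_imp_le)
  qed
qed

text \<open>Measurability of the inner norm is not automatic when the exponent is infinite; there the essential
  supremum is a supremum over a countable dense set.\<close>

lemma borel_measurable_Lp_enorm_sections:
  fixes F :: "'b::euclidean_space \<Rightarrow> 'a::euclidean_space \<Rightarrow> real"
  assumes p: "1 \<le> p" and F: "continuous_on UNIV (\<lambda>z. F (fst z) (snd z))"
  shows "(\<lambda>y. Lp_enorm p (\<lambda>x. ennreal (F y x))) \<in> borel_measurable borel"
proof (cases "p = \<infinity>")
  case True
  obtain D :: "'a set" where D: "countable D" "\<And>X :: 'a set. open X \<Longrightarrow> X \<noteq> {} \<Longrightarrow> \<exists>d\<in>D. d \<in> X"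
    by (rule countable_dense_setE) blast
  have "continuous_on UNIV (F y)" for y
    using continuous_on_compose2[OF F, of UNIV "\<lambda>x. (y, x)"] by (simp add: continuous_on_Pair)
  then have "Lp_enorm p (\<lambda>x. ennreal (F y x)) = (SUP x\<in>D. ennreal (F y x))" for y
    using True esssup_continuous[OF _ D(2), of "F y"] by (simp add: Lp_enorm_top)
  moreover have "(\<lambda>y. F y x) \<in> borel_measurable borel" for x
    using continuous_on_compose2[OF F, of UNIV "\<lambda>y. (y, x)"]
    by (intro borel_measurable_continuous_onI) (simp add: continuous_on_Pair)
  then have "(\<lambda>y. SUP x\<in>D. ennreal (F y x)) \<in> borel_measurable borel"
    using D(1) by (intro borel_measurable_SUP) auto
  ultimately show ?thesis by simp
next
  case False
  with p obtain r where r: "p = ennreal r" "1 \<le> r" by (rule exponent_real)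
  have "(\<lambda>z. F (fst z) (snd z)) \<in> borel_measurable (borel \<Otimes>\<^sub>M borel)"
    using borel_measurable_continuous_onI[OF F] by (simp add: borel_prod)
  then have "(\<lambda>(y, x). epowr (ennreal (F y x)) r) \<in> borel_measurable (borel \<Otimes>\<^sub>M lborel)"
    by (simp add: case_prod_beta cong: measurable_cong_sets)
  then have "(\<lambda>y. \<integral>\<^sup>+ x. epowr (ennreal (F y x)) r \<partial>lborel) \<in> borel_measurable borel"
    by (rule lborel.borel_measurable_nn_integral)
  with r show ?thesis
    by (simp add: Lp_enorm_real borel_measurable_epowr)
qed

text \<open>The factor \<open>\<rho> powr (- d / p)\<close> is the volume of a ball of radius \<open>1 / \<rho>\<close> to the power \<open>1 / p\<close>,
  with the value 1 for \<open>p = \<infinity>\<close>.\<close>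

lemma Lp_enorm_decay_le:
  assumes p: "1 \<le> p"
  shows "\<exists>C>0. \<forall>(a::'a::euclidean_space) \<rho>. 0 < \<rho> \<longrightarrow>
    Lp_enorm p (\<lambda>x. ennreal (decay (2 * DIM('a)) (\<rho> *\<^sub>R (x - a))))
      \<le> ennreal (C * \<rho> powr (- real DIM('a) * enn2real (1 / p)))"
proof (cases "p = \<infinity>")
  case True
  have "esssup lebesgue (\<lambda>x. ennreal (decay (2 * DIM('a)) (\<rho> *\<^sub>R (x - a)))) \<le> 1" for a :: 'a and \<rho>
    by (intro esssup_I measurable_completion) (auto simp: decay_le_1)
  with True show ?thesis
    by (intro exI[of _ 1]) (simp add: Lp_enorm_top enn2real_inverse_exponent_infinity)
next
  case False
  with p obtain r where r: "p = ennreal r" "1 \<le> r" "enn2real (1 / p) = 1 / r" by (rule exponent_real)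
  let ?m = "2 * DIM('a)"
  define I where "I = (LINT x|lborel. decay ?m (x::'a))"
  have I: "(\<integral>\<^sup>+ x. ennreal (decay ?m (x::'a)) \<partial>lborel) = ennreal I"
    unfolding I_def by (rule nn_integral_eq_integral) (auto intro: integrable_decay)
  have "0 \<le> I" unfolding I_def by simp
  have le: "epowr (ennreal (decay ?m x)) r \<le> ennreal (decay ?m x)" for x :: 'a
  proof -
    have "decay ?m x powr r \<le> decay ?m x powr 1"
      using r by (intro powr_mono' decay_le_1) auto
    then show ?thesis by (simp add: epowr_ennreal ennreal_leI)
  qed
  have "Lp_enorm p (\<lambda>x. ennreal (decay ?m (\<rho> *\<^sub>R (x - a)))) \<le> ennreal ((I + 1) powr (1/r) * \<rho> powr (- real DIM('a) * enn2real (1 / p)))"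
    if "0 < \<rho>" for a :: 'a and \<rho>
  proof -
    have "(\<integral>\<^sup>+ x. epowr (ennreal (decay ?m (\<rho> *\<^sub>R (x - a)))) r \<partial>lborel)
        \<le> (\<integral>\<^sup>+ x. ennreal (decay ?m (\<rho> *\<^sub>R (x - a))) \<partial>lborel)"
      by (intro nn_integral_mono le)
    also have "\<dots> = ennreal (\<rho> powr (- real DIM('a)) * I)"
      using that \<open>0 \<le> I\<close> by (subst nn_integral_lborel_affine[of "\<lambda>x. ennreal (decay ?m x)"]) (auto simp: I ennreal_mult)
    also have "\<dots> \<le> ennreal (\<rho> powr (- real DIM('a)) * (I + 1))"
      by (intro ennreal_leI mult_left_mono) auto
    finally have "Lp_enorm p (\<lambda>x. ennreal (decay ?m (\<rho> *\<^sub>R (x - a))))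
        \<le> epowr (ennreal (\<rho> powr (- real DIM('a)) * (I + 1))) (1 / r)"
      using r by (auto simp: Lp_enorm_real intro: epowr_mono)
    also have "\<dots> = ennreal ((I + 1) powr (1/r) * \<rho> powr (- real DIM('a) * enn2real (1 / p)))"
      using r \<open>0 \<le> I\<close> by (simp add: epowr_ennreal powr_mult powr_powr mult.commute)
    finally show ?thesis .
  qed
  with \<open>0 \<le> I\<close> show ?thesis
    by (intro exI[of _ "(I + 1) powr (1/r)"]) auto
qed

lemma Lp_enorm_ball_ge:
  assumes p: "1 \<le> p"
  shows "\<exists>\<kappa>>0. \<forall>(b::'a::euclidean_space) \<rho>. 0 < \<rho> \<longrightarrow>
    ennreal (\<kappa> * \<rho> powr (- real DIM('a) * enn2real (1 / p)))
      \<le> Lp_enorm p (\<lambda>x. indicator (cball 0 1) (\<rho> *\<^sub>R (x - b)))"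
proof (cases "p = \<infinity>")
  case True
  have "1 \<le> esssup lebesgue (\<lambda>x. indicator (cball 0 1) (\<rho> *\<^sub>R (x - b)) :: ennreal)" if "0 < \<rho>" for b :: 'a and \<rho>
    using that by (intro esssup_ge_on_open[of "ball b (1 / \<rho>)"])
      (auto simp: dist_norm pos_less_divide_eq mult.commute norm_minus_commute indicator_def
        scaleR_diff_right[symmetric] simp del: scaleR_diff_right)
  with True show ?thesis
    by (intro exI[of _ 1]) (simp add: Lp_enorm_top enn2real_inverse_exponent_infinity)
next
  case False
  with p obtain r where r: "p = ennreal r" "1 \<le> r" "enn2real (1 / p) = 1 / r" by (rule exponent_real)
  define v where "v = unit_ball_vol (real DIM('a))"
  have v: "0 < v" "emeasure lborel (cball (0::'a) 1) = ennreal v"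
    by (simp_all add: v_def emeasure_cball unit_ball_vol_pos)
  have ind: "epowr (indicator A x) r = indicator A x" for A and x :: 'a
    using r by (auto simp: epowr_def indicator_def)
  have "Lp_enorm p (\<lambda>x. indicator (cball 0 1) (\<rho> *\<^sub>R (x - b))) = ennreal (v powr (1/r) * \<rho> powr (- real DIM('a) * enn2real (1 / p)))"
    if "0 < \<rho>" for b :: 'a and \<rho>
  proof -
    have "(\<integral>\<^sup>+ x. indicator (cball 0 1) (\<rho> *\<^sub>R (x - b)) \<partial>lborel) = ennreal (\<rho> powr (- real DIM('a)) * v)"
      using that v by (subst nn_integral_lborel_affine[of "indicator (cball 0 1)"])
      (auto simp: ennreal_mult intro!: borel_measurable_indicator)
    with r v show ?thesis
      by (simp add: Lp_enorm_real ind epowr_ennreal powr_mult powr_powr mult.commute)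
  qed
  with v show ?thesis
    by (intro exI[of _ "v powr (1/r)"]) auto
qed

text \<open>A bound by a product of functions of \<open>x\<close> and of \<open>y\<close> makes the order of the two norms irrelevant, so the
  spaces \<open>M\<close> and \<open>W\<close> can be treated alike.\<close>

lemma Lp_enorm_iterated_le:
  fixes F :: "'a::euclidean_space \<Rightarrow> 'b::euclidean_space \<Rightarrow> real"
  assumes "1 \<le> p" "1 \<le> q" and F: "continuous_on UNIV (\<lambda>z. F (fst z) (snd z))"
    and A: "continuous_on UNIV A" "\<And>x. 0 \<le> A x" and B: "continuous_on UNIV B" "\<And>y. 0 \<le> B y" and "0 \<le> K"
    and le: "\<And>x y. F x y \<le> K * (A x * B y)" and fin: "Lp_enorm p (\<lambda>x. ennreal (A x)) < \<infinity>"
  shows "Lp_enorm q (\<lambda>y. Lp_enorm p (\<lambda>x. ennreal (F x y)))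
    \<le> ennreal K * (Lp_enorm p (\<lambda>x. ennreal (A x)) * Lp_enorm q (\<lambda>y. ennreal (B y)))"
proof -
  have [measurable]: "A \<in> borel_measurable borel" "B \<in> borel_measurable borel"
    using A(1) B(1) by (auto intro: borel_measurable_continuous_onI)
  have swap: "continuous_on UNIV (\<lambda>z. F (snd z) (fst z))"
    using continuous_on_compose2[OF F, of UNIV "\<lambda>z. (snd z, fst z)"]
    by (simp add: continuous_on_Pair continuous_on_fst continuous_on_snd)
  have sec: "(\<lambda>x. F x y) \<in> borel_measurable borel" for y
    using continuous_on_compose2[OF F, of UNIV "\<lambda>x. (x, y)"]
    by (intro borel_measurable_continuous_onI) (simp add: continuous_on_Pair)
  have inner: "Lp_enorm p (\<lambda>x. ennreal (F x y)) \<le> (ennreal K * Lp_enorm p (\<lambda>x. ennreal (A x))) * ennreal (B y)" for y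
  proof -
    have "Lp_enorm p (\<lambda>x. ennreal (F x y)) \<le> Lp_enorm p (\<lambda>x. ennreal (K * B y) * ennreal (A x))"
      using sec[of y] B \<open>0 \<le> K\<close> A le[of _ y]
      by (intro Lp_enorm_mono assms measurable_completion) (auto simp: ennreal_mult[symmetric] ac_simps intro!: ennreal_leI)
    also have "\<dots> = ennreal (K * B y) * Lp_enorm p (\<lambda>x. ennreal (A x))"
      by (intro Lp_enorm_cmult assms) auto
    finally show ?thesis
      using \<open>0 \<le> K\<close> B by (simp add: ennreal_mult ac_simps)
  qed
  have "Lp_enorm q (\<lambda>y. Lp_enorm p (\<lambda>x. ennreal (F x y)))
      \<le> Lp_enorm q (\<lambda>y. (ennreal K * Lp_enorm p (\<lambda>x. ennreal (A x))) * ennreal (B y))"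
    using borel_measurable_Lp_enorm_sections[OF assms(1) swap]
    by (intro Lp_enorm_mono assms inner measurable_completion) auto
  also have "\<dots> = (ennreal K * Lp_enorm p (\<lambda>x. ennreal (A x))) * Lp_enorm q (\<lambda>y. ennreal (B y))"
    using fin by (intro Lp_enorm_cmult assms) (auto simp: ennreal_mult_less_top)
  finally show ?thesis by (simp add: ac_simps)
qed

lemma Lp_enorm_iterated_ge:
  fixes F :: "'a::euclidean_space \<Rightarrow> 'b::euclidean_space \<Rightarrow> ennreal"
  assumes "1 \<le> p" "1 \<le> q" and "0 \<le> K"
    and [measurable]: "A \<in> borel_measurable borel" "B \<in> borel_measurable borel"
    and A: "\<And>x. A x < \<infinity>" and B: "\<And>y. B y < \<infinity>" and "L < \<infinity>" "L \<le> Lp_enorm p A"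
    and ge: "\<And>x y. ennreal K * (A x * B y) \<le> F x y"
  shows "ennreal K * (L * Lp_enorm q B) \<le> Lp_enorm q (\<lambda>y. Lp_enorm p (\<lambda>x. F x y))"
proof -
  have inner: "ennreal K * L * B y \<le> Lp_enorm p (\<lambda>x. F x y)" for y
  proof -
    have "ennreal K * L * B y \<le> (ennreal K * B y) * Lp_enorm p A"
      using mult_left_mono[OF \<open>L \<le> Lp_enorm p A\<close>, of "ennreal K * B y"] by (simp add: ac_simps)
    also have "\<dots> = Lp_enorm p (\<lambda>x. (ennreal K * B y) * A x)"
      using B[of y] by (intro Lp_enorm_cmult[symmetric] assms) (auto simp: ennreal_mult_less_top)
    also have "\<dots> \<le> Lp_enorm p (\<lambda>x. F x y)"
      using ge[of _ y] by (intro Lp_enorm_mono assms measurable_completion) (auto simp: ac_simps)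
    finally show ?thesis .
  qed
  have "ennreal K * (L * Lp_enorm q B) = Lp_enorm q (\<lambda>y. (ennreal K * L) * B y)"
    using \<open>L < \<infinity>\<close> by (subst Lp_enorm_cmult) (auto simp: ennreal_mult_less_top ac_simps assms)
  also have "\<dots> \<le> Lp_enorm q (\<lambda>y. Lp_enorm p (\<lambda>x. F x y))"
    by (intro Lp_enorm_mono assms measurable_completion) (auto simp: inner)
  finally show ?thesis .
qed

section \<open>Schwartz functions\<close>

lemma schwartz_decay_uniform:
  fixes f :: "'a::euclidean_space \<Rightarrow> complex"
  assumes f: "schwartz f"
  shows "\<exists>C\<ge>0. \<forall>bs\<in>lists Basis. length bs \<le> N \<longrightarrow> (\<forall>y. cmod (iter_deriv bs f y) \<le> C * decay m y)"
proof -
  define M where "M = max m N"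
  have "schwartz_seminorm M f < \<infinity>" using f by (auto simp: schwartz_def)
  then obtain C where C: "schwartz_seminorm M f = ennreal C" "0 \<le> C"
    by (cases "schwartz_seminorm M f") auto
  have "cmod (iter_deriv bs f y) \<le> C * decay m y" if bs: "bs \<in> lists Basis" "length bs \<le> N" for bs y
  proof -
    have "ennreal (bracket y ^ M * cmod (iter_deriv bs f y)) \<le> schwartz_seminorm M f"
      unfolding schwartz_seminorm_def using bs
      by (intro SUP_upper2[of y] SUP_upper2[of bs]) (auto simp: M_def)
    then have "bracket y ^ M * cmod (iter_deriv bs f y) \<le> C"
      using C by simp
    moreover have "bracket y ^ m * cmod (iter_deriv bs f y) \<le> bracket y ^ M * cmod (iter_deriv bs f y)"
      by (intro mult_right_mono power_increasing bracket_ge_1) (auto simp: M_def)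
    ultimately show ?thesis
      by (simp add: decay_def field_simps)
  qed
  with C show ?thesis by blast
qed

lemma schwartz_decay:
  fixes f :: "'a::euclidean_space \<Rightarrow> complex"
  assumes "schwartz f" "bs \<in> lists Basis"
  shows "\<exists>C\<ge>0. \<forall>y. cmod (iter_deriv bs f y) \<le> C * decay m y"
  using schwartz_decay_uniform[OF assms(1), of "length bs" m] assms(2) by blast

text \<open>Only derivatives of order at most \<open>N\<close> along basis vectors enter the seminorm of index \<open>N\<close>, and
  there are finitely many of them.\<close>

lemma schwartzI:
  fixes f :: "'a::euclidean_space \<Rightarrow> complex"
  assumes diff: "\<And>bs. bs \<in> lists Basis \<Longrightarrow> iter_deriv bs f differentiable_on UNIV"
    and bound: "\<And>bs m. bs \<in> lists Basis \<Longrightarrow> \<exists>C. \<forall>y. cmod (iter_deriv bs f y) \<le> C * decay m y"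
  shows "schwartz f"
  unfolding schwartz_def smooth_def
proof (intro conjI ballI allI diff)
  fix N
  let ?S = "{bs \<in> lists (Basis::'a set). length bs \<le> N}"
  have "?S = {bs. set bs \<subseteq> (Basis::'a set) \<and> length bs \<le> N}"
    by (auto simp: lists_eq_set)
  then have fin: "finite ?S"
    using finite_lists_length_le[OF finite_Basis] by simp
  have "\<forall>bs\<in>?S. \<exists>C. \<forall>y. cmod (iter_deriv bs f y) \<le> C * decay N y"
    using bound by blast
  then obtain C where C: "cmod (iter_deriv bs f y) \<le> C bs * decay N y" if "bs \<in> ?S" for bs y
    by metis
  have "schwartz_seminorm N f \<le> ennreal (\<Sum>bs\<in>?S. \<bar>C bs\<bar>)"
    unfolding schwartz_seminorm_def
  proof (intro SUP_least ennreal_leI)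
    fix x bs assume bs: "bs \<in> ?S"
    have "bracket x ^ N * cmod (iter_deriv bs f x) \<le> bracket x ^ N * (C bs * decay N x)"
      by (intro mult_left_mono C bs) simp
    also have "\<dots> = C bs"
      using decay_times_bracket[of N x] by (simp add: ac_simps)
    also have "\<dots> \<le> (\<Sum>bs\<in>?S. \<bar>C bs\<bar>)"
      using member_le_sum[OF bs, of "\<lambda>bs. \<bar>C bs\<bar>"] fin by simp
    finally show "bracket x ^ N * cmod (iter_deriv bs f x) \<le> (\<Sum>bs\<in>?S. \<bar>C bs\<bar>)" .
  qed
  also have "\<dots> < \<infinity>" by simp
  finally show "schwartz_seminorm N f < \<infinity>" .
qed

lemma schwartz_differentiable:
  "schwartz f \<Longrightarrow> bs \<in> lists Basis \<Longrightarrow> iter_deriv bs f differentiable (at x)"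
  by (auto simp: schwartz_def smooth_def differentiable_on_def)

lemma schwartz_has_derivative:
  assumes "schwartz f" "bs \<in> lists Basis"
  shows "(iter_deriv bs f has_derivative frechet_derivative (iter_deriv bs f) (at x)) (at x)"
  using schwartz_differentiable[OF assms] by (simp add: frechet_derivative_works)

lemma schwartz_continuous_on: "schwartz f \<Longrightarrow> bs \<in> lists Basis \<Longrightarrow> continuous_on UNIV (iter_deriv bs f)"
  by (auto simp: schwartz_def smooth_def intro: differentiable_imp_continuous_on)

lemma schwartz_continuous: "schwartz f \<Longrightarrow> continuous_on UNIV f"
  using schwartz_continuous_on[of f "[]"] by simp

lemma schwartz_borel: "schwartz f \<Longrightarrow> f \<in> borel_measurable borel"
  by (intro borel_measurable_continuous_onI schwartz_continuous)

lemma schwartz_bounded: "schwartz f \<Longrightarrow> \<exists>C\<ge>0. \<forall>y. cmod (f y) \<le> C"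
  using schwartz_decay[of f "[]" 0] by (auto simp: decay_def)

lemma schwartz_integrable:
  assumes f: "schwartz (f :: 'a::euclidean_space \<Rightarrow> complex)"
  shows "integrable lborel f"
proof -
  obtain C where "0 \<le> C" "\<And>y. cmod (f y) \<le> C * decay (2 * DIM('a)) y"
    using schwartz_decay[OF f, of "[]" "2 * DIM('a)"] by auto
  then show ?thesis
    using schwartz_borel[OF f] integrable_decay[of "2 * DIM('a)", where 'a='a]
    by (intro Bochner_Integration.integrable_bound[of _ "\<lambda>y. C * decay (2 * DIM('a)) y" f]) auto
qed

lemma iter_deriv_affine:
  fixes f :: "'a::euclidean_space \<Rightarrow> complex"
  assumes f: "smooth f" and bs: "bs \<in> lists Basis"
  shows "iter_deriv bs (\<lambda>y. c * f (\<rho> *\<^sub>R (y - a))) = (\<lambda>y. c * of_real \<rho> ^ length bs * iter_deriv bs f (\<rho> *\<^sub>R (y - a)))"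
    and "iter_deriv bs (\<lambda>y. c * f (\<rho> *\<^sub>R (y - a))) differentiable_on UNIV"
proof -
  have D: "((\<lambda>y. C * iter_deriv cs f (\<rho> *\<^sub>R (y - a))) has_derivative
      (\<lambda>h. C * frechet_derivative (iter_deriv cs f) (at (\<rho> *\<^sub>R (x - a))) (\<rho> *\<^sub>R h))) (at x)"
    if "cs \<in> lists Basis" for cs C x
  proof -
    have "(iter_deriv cs f has_derivative frechet_derivative (iter_deriv cs f) (at (\<rho> *\<^sub>R (x - a)))) (at (\<rho> *\<^sub>R (x - a)))"
      using f that unfolding smooth_def differentiable_on_def
      by (intro frechet_derivative_works[THEN iffD1]) blast
    then have "(iter_deriv cs f \<circ> (\<lambda>y. \<rho> *\<^sub>R (y - a)) has_derivative
        frechet_derivative (iter_deriv cs f) (at (\<rho> *\<^sub>R (x - a))) \<circ> (\<lambda>h. \<rho> *\<^sub>R h)) (at x)"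
      by (intro diff_chain_at) (auto intro!: derivative_eq_intros)
    then show ?thesis
      by (auto simp: o_def intro!: derivative_eq_intros)
  qed
  show eq: "iter_deriv bs (\<lambda>y. c * f (\<rho> *\<^sub>R (y - a))) = (\<lambda>y. c * of_real \<rho> ^ length bs * iter_deriv bs f (\<rho> *\<^sub>R (y - a)))"
    using bs
  proof (induction bs)
    case (Cons b bs)
    have lin: "linear (frechet_derivative (iter_deriv bs f) (at (\<rho> *\<^sub>R (x - a))))" for x
      using f Cons.hyps unfolding smooth_def differentiable_on_def
      by (intro linear_frechet_derivative) auto
    show ?case
    proof
      fix x
      have "frechet_derivative (\<lambda>y. c * of_real \<rho> ^ length bs * iter_deriv bs f (\<rho> *\<^sub>R (y - a))) (at x)
          = (\<lambda>h. c * of_real \<rho> ^ length bs * frechet_derivative (iter_deriv bs f) (at (\<rho> *\<^sub>R (x - a))) (\<rho> *\<^sub>R h))"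
        using Cons.hyps by (intro frechet_derivative_at[symmetric] D) auto
      then show "iter_deriv (b # bs) (\<lambda>y. c * f (\<rho> *\<^sub>R (y - a))) x =
          c * of_real \<rho> ^ length (b # bs) * iter_deriv (b # bs) f (\<rho> *\<^sub>R (x - a))"
        using Cons by (simp add: linear_cmul[OF lin] scaleR_conv_of_real)
    qed
  qed simp
  show "iter_deriv bs (\<lambda>y. c * f (\<rho> *\<^sub>R (y - a))) differentiable_on UNIV"
    unfolding eq using D[OF bs] by (auto simp: differentiable_on_def differentiable_def)
qed

lemma iter_deriv_cnj:
  fixes f :: "'a::euclidean_space \<Rightarrow> complex"
  assumes f: "smooth f" and bs: "bs \<in> lists Basis"
  shows "iter_deriv bs (\<lambda>y. cnj (f y)) = (\<lambda>y. cnj (iter_deriv bs f y))"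
    and "iter_deriv bs (\<lambda>y. cnj (f y)) differentiable_on UNIV"
proof -
  have D: "((\<lambda>y. cnj (iter_deriv cs f y)) has_derivative (\<lambda>h. cnj (frechet_derivative (iter_deriv cs f) (at x) h))) (at x)"
    if "cs \<in> lists Basis" for cs x
    using f that by (intro has_derivative_cnj) (auto simp: smooth_def differentiable_on_def frechet_derivative_works)
  show eq: "iter_deriv bs (\<lambda>y. cnj (f y)) = (\<lambda>y. cnj (iter_deriv bs f y))"
    using bs
  proof (induction bs)
    case (Cons b bs)
    then have IH: "iter_deriv bs (\<lambda>y. cnj (f y)) = (\<lambda>y. cnj (iter_deriv bs f y))" and bs: "bs \<in> lists Basis"
      by auto
    show ?case
      unfolding iter_deriv.simps IH by (simp add: frechet_derivative_at[OF D[OF bs], symmetric])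
  qed simp
  show "iter_deriv bs (\<lambda>y. cnj (f y)) differentiable_on UNIV"
    unfolding eq using D[OF bs] by (auto simp: differentiable_on_def differentiable_def)
qed

section \<open>Gaussians\<close>

definition gauss :: "real \<Rightarrow> 'a \<Rightarrow> real \<Rightarrow> 'a::euclidean_space \<Rightarrow> complex" where
  "gauss c a \<rho> y = of_real (c * exp (- (norm (\<rho> *\<^sub>R (y - a)))\<^sup>2 / 2))"

lemma real_polynomial_function_has_derivative:
  assumes "real_polynomial_function (p :: 'a::real_normed_vector \<Rightarrow> real)"
  shows "\<exists>p'. (\<forall>x. (p has_derivative p' x) (at x)) \<and> (\<forall>b. real_polynomial_function (\<lambda>x. p' x b))"
  using assms
proof induction
  case (linear f)
  then show ?case
    by (intro exI[of _ "\<lambda>_. f"]) (auto intro: bounded_linear_imp_has_derivative real_polynomial_function.intros(2))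
next
  case (const c)
  then show ?case
    by (intro exI[of _ "\<lambda>_ _. 0"]) (auto intro: real_polynomial_function.intros(2))
next
  case (add f g)
  then obtain f' g' where "\<And>x. (f has_derivative f' x) (at x)" "\<And>b. real_polynomial_function (\<lambda>x. f' x b)"
    "\<And>x. (g has_derivative g' x) (at x)" "\<And>b. real_polynomial_function (\<lambda>x. g' x b)" by blast
  then show ?case
    by (intro exI[of _ "\<lambda>x h. f' x h + g' x h"])
      (auto intro!: has_derivative_add real_polynomial_function.intros(3))
next
  case (mult f g)
  then obtain f' g' where "\<And>x. (f has_derivative f' x) (at x)" "\<And>b. real_polynomial_function (\<lambda>x. f' x b)"
    "\<And>x. (g has_derivative g' x) (at x)" "\<And>b. real_polynomial_function (\<lambda>x. g' x b)" by blast
  with mult show ?case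
    by (intro exI[of _ "\<lambda>x h. f x * g' x h + f' x h * g x"])
      (auto intro!: has_derivative_mult real_polynomial_function.intros(3) real_polynomial_function.intros(4))
qed

lemma real_polynomial_function_growth:
  assumes "real_polynomial_function (p :: 'a::euclidean_space \<Rightarrow> real)"
  shows "\<exists>C n. 0 \<le> C \<and> (\<forall>x. \<bar>p x\<bar> \<le> C * bracket x ^ n)"
  using assms
proof induction
  case (linear f)
  then obtain K where "0 \<le> K" "\<And>x. norm (f x) \<le> norm x * K"
    using bounded_linear.nonneg_bounded by blast
  moreover have "norm x * K \<le> K * bracket x ^ 1" for x :: 'a
    using mult_left_mono[OF norm_le_bracket \<open>0 \<le> K\<close>] by (simp add: mult.commute)
  ultimately show ?case
    by (metis order.trans real_norm_def)
next
  case (const c)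
  show ?case by (intro exI[of _ "\<bar>c\<bar>"] exI[of _ 0]) simp
next
  case (add f g)
  then obtain C n C' n' where *: "0 \<le> C" "\<And>x. \<bar>f x\<bar> \<le> C * bracket x ^ n" "0 \<le> C'" "\<And>x. \<bar>g x\<bar> \<le> C' * bracket x ^ n'"
    by blast
  have "\<bar>f x + g x\<bar> \<le> (C + C') * bracket x ^ (n + n')" for x
  proof -
    have "C * bracket x ^ n \<le> C * bracket x ^ (n + n')" "C' * bracket x ^ n' \<le> C' * bracket x ^ (n + n')"
      using * by (auto intro!: mult_left_mono power_increasing bracket_ge_1)
    with *(2,4)[of x] show ?thesis by (simp add: distrib_right)
  qed
  with * show ?case by (intro exI[of _ "C + C'"] exI[of _ "n + n'"]) auto
next
  case (mult f g)
  then obtain C n C' n' where *: "0 \<le> C" "\<And>x. \<bar>f x\<bar> \<le> C * bracket x ^ n" "0 \<le> C'" "\<And>x. \<bar>g x\<bar> \<le> C' * bracket x ^ n'"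
    by blast
  have "\<bar>f x * g x\<bar> \<le> (C * C') * bracket x ^ (n + n')" for x
    using mult_mono[OF *(2)[of x] *(4)[of x]] * by (simp add: abs_mult power_add ac_simps)
  with * show ?case by (intro exI[of _ "C * C'"] exI[of _ "n + n'"]) auto
qed

lemma exp_neg_square_le_decay: "\<exists>C\<ge>0. \<forall>x::'a::euclidean_space. exp (- (norm x)\<^sup>2 / 2) \<le> C * decay m x"
proof -
  define C where "C = 2 ^ m * fact m * exp (1 / 2 :: real)"
  have "exp (- (norm x)\<^sup>2 / 2) \<le> C * decay m x" for x :: 'a
  proof -
    define s where "s = (1 + (norm x)\<^sup>2) / 2"
    have "0 \<le> s" by (simp add: s_def)
    have s: "(bracket x)\<^sup>2 = 2 * s" by (simp add: bracket_def s_def)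
    have "s ^ m / fact m \<le> exp s"
    proof -
      have "(\<Sum>k\<in>{m}. s ^ k /\<^sub>R fact k) \<le> (\<Sum>k. s ^ k /\<^sub>R fact k)"
        using \<open>0 \<le> s\<close> summable_exp_generic[of s] by (intro sum_le_suminf) auto
      then show ?thesis by (simp add: exp_def field_simps)
    qed
    then have "(2 * s) ^ m \<le> 2 ^ m * fact m * exp s"
      by (simp add: field_simps power_mult_distrib)
    moreover have "bracket x ^ m \<le> bracket x ^ (2 * m)"
      by (intro power_increasing bracket_ge_1) auto
    ultimately have "bracket x ^ m \<le> 2 ^ m * fact m * exp s"
      unfolding power_mult s by linarith
    then have "bracket x ^ m * exp (- (norm x)\<^sup>2 / 2) \<le> 2 ^ m * fact m * exp s * exp (- (norm x)\<^sup>2 / 2)"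
      by (rule mult_right_mono) simp
    also have "\<dots> = 2 ^ m * fact m * exp (s + - (norm x)\<^sup>2 / 2)"
      by (simp only: exp_add mult.assoc)
    also have "\<dots> = C"
      by (simp add: s_def C_def add_divide_distrib)
    finally have "bracket x ^ m * exp (- (norm x)\<^sup>2 / 2) \<le> C" .
    then show ?thesis by (simp add: decay_def field_simps)
  qed
  then show ?thesis by (intro exI[of _ C]) (auto simp: C_def)
qed

lemma iter_deriv_std_gauss:
  fixes bs :: "'a::euclidean_space list"
  shows "\<exists>p. real_polynomial_function p \<and>
    iter_deriv bs (gauss 1 0 1) = (\<lambda>x. of_real (p x * exp (- (norm x)\<^sup>2 / 2)))"
proof (induction bs)
  case Nil
  show ?case by (intro exI[of _ "\<lambda>_. 1"]) (auto simp: gauss_def)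
next
  case (Cons b bs)
  then obtain p where p: "real_polynomial_function p" and
    eq: "iter_deriv bs (gauss 1 0 1) = (\<lambda>x. of_real (p x * exp (- (norm x)\<^sup>2 / 2)))" by blast
  from real_polynomial_function_has_derivative[OF p] obtain p' where
    p': "\<And>x. (p has_derivative p' x) (at x)" "\<And>b. real_polynomial_function (\<lambda>x. p' x b)" by blast
  have "((\<lambda>x. complex_of_real (p x * exp (- (norm x)\<^sup>2 / 2))) has_derivative
      (\<lambda>h. of_real ((p' x h - p x * (x \<bullet> h)) * exp (- (norm x)\<^sup>2 / 2)))) (at x)" for x
  proof -
    have "((\<lambda>x. p x * exp (- (x \<bullet> x) / 2)) has_derivative
      (\<lambda>h. (p' x h - p x * (x \<bullet> h)) * exp (- (x \<bullet> x) / 2))) (at x)"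
      by (auto intro!: derivative_eq_intros p' simp: fun_eq_iff inner_commute field_simps)
    then show ?thesis
      by (intro has_derivative_of_real) (simp add: power2_norm_eq_inner)
  qed
  from frechet_derivative_at[OF this, symmetric]
  have "iter_deriv (b # bs) (gauss 1 0 1) = (\<lambda>x. of_real ((p' x b - p x * (x \<bullet> b)) * exp (- (norm x)\<^sup>2 / 2)))"
    unfolding iter_deriv.simps eq by (simp add: fun_eq_iff)
  moreover have "real_polynomial_function (\<lambda>x. p' x b - p x * (x \<bullet> b))"
    by (intro real_polynomial_function_diff p' real_polynomial_function.intros(4) p real_polynomial_function.intros(1) bounded_linear_inner_left)
  ultimately show ?case by blast
qed

lemma schwartz_std_gauss: "schwartz (gauss 1 0 1 :: 'a::euclidean_space \<Rightarrow> complex)"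
proof (rule schwartzI)
  fix bs :: "'a list" and m
  obtain p where p: "real_polynomial_function p" and
    eq: "iter_deriv bs (gauss 1 0 1) = (\<lambda>x. of_real (p x * exp (- (norm x)\<^sup>2 / 2)))"
    using iter_deriv_std_gauss by blast
  have "(\<lambda>x. complex_of_real (p x * exp (- (x \<bullet> x) / 2))) differentiable at x" for x
    using real_polynomial_function_has_derivative[OF p]
    by (fastforce simp: differentiable_def intro!: derivative_eq_intros)
  then show "iter_deriv bs (gauss 1 0 1) differentiable_on UNIV"
    unfolding eq by (auto simp: differentiable_on_def power2_norm_eq_inner)
  obtain C n where C: "0 \<le> C" "\<And>x. \<bar>p x\<bar> \<le> C * bracket x ^ n"
    using real_polynomial_function_growth[OF p] by blast
  obtain C' where C': "0 \<le> C'" "\<And>x::'a. exp (- (norm x)\<^sup>2 / 2) \<le> C' * decay (n + m) x"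
    using exp_neg_square_le_decay by blast
  have "cmod (iter_deriv bs (gauss 1 0 1) x) \<le> (C * C') * decay m x" for x
  proof -
    have "cmod (iter_deriv bs (gauss 1 0 1) x) = \<bar>p x\<bar> * exp (- (norm x)\<^sup>2 / 2)"
      unfolding eq norm_of_real by (simp add: abs_mult)
    also have "\<dots> \<le> (C * bracket x ^ n) * (C' * decay (n + m) x)"
      using C C' by (intro mult_mono) auto
    also have "\<dots> = (C * C') * decay m x * (decay n x * bracket x ^ n)"
      by (simp only: decay_add ac_simps)
    finally show ?thesis by (simp only: decay_times_bracket mult_1_right)
  qed
  then show "\<exists>C. \<forall>x. cmod (iter_deriv bs (gauss 1 0 1) x) \<le> C * decay m x" by blast
qed

lemma gauss_eq: "gauss c a \<rho> = (\<lambda>y. of_real c * gauss 1 0 1 (\<rho> *\<^sub>R (y - a)))"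
  by (auto simp: gauss_def)

text \<open>The bound is uniform in the width \<open>1 / \<rho> \<ge> 1\<close>: flattening a Gaussian makes its derivatives
  smaller.\<close>

lemma gauss_derivative_bound:
  "\<exists>C\<ge>0. \<forall>bs\<in>lists Basis. length bs \<le> N \<longrightarrow> (\<forall>c\<ge>0. \<forall>(a::'a::euclidean_space) \<rho> y. 0 < \<rho> \<longrightarrow> \<rho> \<le> 1 \<longrightarrow>
    cmod (iter_deriv bs (gauss c a \<rho>) y) \<le> c * (C * decay m (\<rho> *\<^sub>R (y - a))))"
proof -
  obtain C where C: "0 \<le> C" "\<forall>bs\<in>lists Basis. length bs \<le> N \<longrightarrow> (\<forall>y::'a. cmod (iter_deriv bs (gauss 1 0 1) y) \<le> C * decay m y)"
    using schwartz_decay_uniform[OF schwartz_std_gauss] by blast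
  have "cmod (iter_deriv bs (gauss c a \<rho>) y) \<le> c * (C * decay m (\<rho> *\<^sub>R (y - a)))"
    if bs: "bs \<in> lists Basis" "length bs \<le> N" and "0 \<le> c" "0 < \<rho>" "\<rho> \<le> 1" for bs c \<rho> y and a :: 'a
  proof -
    have "cmod (iter_deriv bs (gauss c a \<rho>) y) = c * (\<rho> ^ length bs * cmod (iter_deriv bs (gauss 1 0 1) (\<rho> *\<^sub>R (y - a))))"
      unfolding gauss_eq[of c a \<rho>] using schwartz_std_gauss[where 'a='a] that
      by (subst iter_deriv_affine(1)) (auto simp: schwartz_def norm_mult norm_power)
    also have "\<dots> \<le> c * (1 * (C * decay m (\<rho> *\<^sub>R (y - a))))"
      using C(2) that by (intro mult_left_mono mult_mono power_le_one) auto
    finally show ?thesis by simp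
  qed
  with C(1) show ?thesis by blast
qed

lemma schwartz_affine:
  fixes f :: "'a::euclidean_space \<Rightarrow> complex"
  assumes f: "schwartz f" and \<rho>: "0 < \<rho>"
  shows "schwartz (\<lambda>y. c * f (\<rho> *\<^sub>R (y - a)))"
proof (rule schwartzI)
  fix bs :: "'a list" and m assume bs: "bs \<in> lists Basis"
  have sm: "smooth f" using f by (simp add: schwartz_def)
  show "iter_deriv bs (\<lambda>y. c * f (\<rho> *\<^sub>R (y - a))) differentiable_on UNIV"
    by (rule iter_deriv_affine(2)[OF sm bs])
  obtain C where C: "0 \<le> C" "\<And>y::'a. cmod (iter_deriv bs f y) \<le> C * decay m y"
    using schwartz_decay[OF f bs] by blast
  define K where "K = (2 * bracket (\<rho> *\<^sub>R a) * (1 + 1 / \<rho>)) ^ m"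
  have "decay m (\<rho> *\<^sub>R (y - a)) \<le> K * decay m y" for y
  proof -
    have "bracket y \<le> (1 + 1 / \<rho>) * bracket (\<rho> *\<^sub>R y)"
    proof -
      have "norm y = (1 / \<rho>) * norm (\<rho> *\<^sub>R y)" using \<rho> by simp
      also have "\<dots> \<le> (1 / \<rho>) * bracket (\<rho> *\<^sub>R y)"
        using \<rho> by (intro mult_left_mono norm_le_bracket) auto
      finally show ?thesis
        using bracket_le_1_norm[of y] bracket_ge_1[of "\<rho> *\<^sub>R y"] by (simp add: distrib_right)
    qed
    also have "\<dots> \<le> (1 + 1 / \<rho>) * (2 * bracket (\<rho> *\<^sub>R (y - a)) * bracket (\<rho> *\<^sub>R a))"
      using \<rho> bracket_add_le_mult[of "\<rho> *\<^sub>R (y - a)" "\<rho> *\<^sub>R a"]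
      by (intro mult_left_mono) (auto simp: scaleR_diff_right)
    finally have "bracket y ^ m \<le> ((1 + 1 / \<rho>) * (2 * bracket (\<rho> *\<^sub>R (y - a)) * bracket (\<rho> *\<^sub>R a))) ^ m"
      by (rule power_mono) simp
    then show ?thesis
      by (simp add: K_def decay_def divide_simps power_mult_distrib ac_simps)
  qed
  then have "cmod (iter_deriv bs (\<lambda>y. c * f (\<rho> *\<^sub>R (y - a))) y) \<le> (cmod c * \<rho> ^ length bs * C * K) * decay m y" for y
  proof -
    have "cmod (iter_deriv bs (\<lambda>y. c * f (\<rho> *\<^sub>R (y - a))) y)
        = cmod c * \<rho> ^ length bs * cmod (iter_deriv bs f (\<rho> *\<^sub>R (y - a)))"
      using \<rho> by (subst iter_deriv_affine(1)[OF sm bs]) (simp add: norm_mult norm_power)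
    also have "\<dots> \<le> cmod c * \<rho> ^ length bs * (C * (K * decay m y))"
      using C(2)[of "\<rho> *\<^sub>R (y - a)"] mult_left_mono[OF \<open>\<And>y. decay m (\<rho> *\<^sub>R (y - a)) \<le> K * decay m y\<close>[of y] C(1)] \<rho>
      by (intro mult_left_mono) auto
    finally show ?thesis by (simp only: ac_simps)
  qed
  then show "\<exists>C. \<forall>y. cmod (iter_deriv bs (\<lambda>y. c * f (\<rho> *\<^sub>R (y - a))) y) \<le> C * decay m y" by blast
qed

lemma schwartz_gauss: "0 < \<rho> \<Longrightarrow> schwartz (gauss c a \<rho>)"
  unfolding gauss_eq[of c a \<rho>] by (rule schwartz_affine[OF schwartz_std_gauss])

lemma schwartz_cnj_translate:
  assumes f: "schwartz (f :: 'a::euclidean_space \<Rightarrow> complex)"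
  shows "schwartz (\<lambda>y. cnj (f (y - x)))"
proof -
  have g: "schwartz (\<lambda>y. f (y - x))"
    using schwartz_affine[OF f, of 1 1 x] by simp
  then have sm: "smooth (\<lambda>y. f (y - x))" by (simp add: schwartz_def)
  show ?thesis
  proof (rule schwartzI)
    fix bs :: "'a list" and m assume bs: "bs \<in> lists Basis"
    show "iter_deriv bs (\<lambda>y. cnj (f (y - x))) differentiable_on UNIV"
      by (rule iter_deriv_cnj(2)[OF sm bs])
    show "\<exists>C. \<forall>y. cmod (iter_deriv bs (\<lambda>y. cnj (f (y - x))) y) \<le> C * decay m y"
      using schwartz_decay[OF g bs] unfolding iter_deriv_cnj(1)[OF sm bs] by auto
  qed
qed

section \<open>Fourier integrals\<close>

lemma gauss_borel [measurable]: "gauss c a \<rho> \<in> borel_measurable borel"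
  unfolding gauss_def by measurable

lemma cmod_cis_inner [simp]: "cmod (exp (- (\<i> * of_real r))) = 1"
  by (simp add: norm_exp_eq_Re)

lemma fourier_measurable_kernel [measurable]:
  "(\<lambda>x. exp (- \<i> * of_real (x \<bullet> \<xi>))) \<in> borel_measurable borel"
  by (intro borel_measurable_continuous_onI continuous_intros)

lemma integrable_fourier_integrand:
  assumes "integrable lborel (u :: 'a::euclidean_space \<Rightarrow> complex)"
  shows "integrable lborel (\<lambda>x. u x * exp (- \<i> * of_real (x \<bullet> \<xi>)))"
proof (rule Bochner_Integration.integrable_bound[OF assms])
  show "(\<lambda>x. u x * exp (- \<i> * of_real (x \<bullet> \<xi>))) \<in> borel_measurable lborel"
    using assms by (auto intro: fourier_measurable_kernel)
qed (auto simp: norm_mult)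

lemma fourier_add:
  assumes "integrable lborel u" "integrable lborel v"
  shows "fourier (\<lambda>x. u x + v x) \<xi> = fourier u \<xi> + fourier v \<xi>"
  using integrable_fourier_integrand[OF assms(1), of \<xi>] integrable_fourier_integrand[OF assms(2), of \<xi>]
  by (simp add: fourier_def distrib_right distrib_left)

lemma fourier_cmult: "fourier (\<lambda>x. c * u x) \<xi> = c * fourier u \<xi>"
  unfolding fourier_def mult.assoc integral_mult_right_zero by (simp only: ac_simps)

lemma integrable_dominated:
  fixes u :: "'a::euclidean_space \<Rightarrow> 'b::{banach, second_countable_topology}"
  assumes G: "integrable lborel G" and u: "u \<in> borel_measurable borel" and le: "\<And>x. norm (u x) \<le> G x"
  shows "integrable lborel u"
proof (rule Bochner_Integration.integrable_bound[OF G])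
  have "norm (u x) \<le> norm (G x)" for x
    using le[of x] by simp
  then show "AE x in lborel. norm (u x) \<le> norm (G x)" by simp
qed (use u in simp)

lemma fourier_norm_le:
  fixes u :: "'a::euclidean_space \<Rightarrow> complex"
  assumes G: "integrable lborel G" and le: "\<And>x. cmod (u x) \<le> G x" and [measurable]: "u \<in> borel_measurable borel"
  shows "cmod (fourier u \<xi>) \<le> (2 * pi) powr (- real DIM('a) / 2) * (LINT x|lborel. G x)"
proof -
  have "integrable lborel u"
    by (rule integrable_dominated[OF G _ le]) simp
  from integrable_fourier_integrand[OF this]
  have "cmod (LINT x|lborel. u x * exp (- \<i> * of_real (x \<bullet> \<xi>))) \<le> (LINT x|lborel. cmod (u x * exp (- \<i> * of_real (x \<bullet> \<xi>))))"
    by simp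
  also have "\<dots> \<le> (LINT x|lborel. G x)"
    using integrable_fourier_integrand[OF \<open>integrable lborel u\<close>, of \<xi>] G le
    by (intro integral_mono integrable_norm) (auto simp: norm_mult)
  finally show ?thesis
    by (simp add: fourier_def norm_mult mult_left_mono)
qed

lemma fourier_translate:
  fixes u :: "'a::euclidean_space \<Rightarrow> complex"
  assumes [measurable]: "u \<in> borel_measurable borel"
  shows "fourier (\<lambda>x. u (x - a)) \<xi> = exp (- \<i> * of_real (a \<bullet> \<xi>)) * fourier u \<xi>"
proof -
  have "(LINT x|lborel. u (x - a) * exp (- \<i> * of_real (x \<bullet> \<xi>)))
      = (LINT x|lborel. (\<lambda>z. exp (- \<i> * of_real (a \<bullet> \<xi>)) * (u z * exp (- \<i> * of_real (z \<bullet> \<xi>)))) (x - a))"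
    by (intro Bochner_Integration.integral_cong) (auto simp: inner_diff_left algebra_simps exp_add[symmetric])
  also have "\<dots> = (LINT z|lborel. exp (- \<i> * of_real (a \<bullet> \<xi>)) * (u z * exp (- \<i> * of_real (z \<bullet> \<xi>))))"
    by (rule lborel_integral_translate) measurable
  also have "\<dots> = exp (- \<i> * of_real (a \<bullet> \<xi>)) * (LINT z|lborel. u z * exp (- \<i> * of_real (z \<bullet> \<xi>)))"
    by (rule integral_mult_right_zero)
  finally show ?thesis
    by (simp add: fourier_def)
qed

lemma has_vector_derivative_quotient:
  assumes "(g has_vector_derivative v) (at 0)"
  shows "((\<lambda>s. (g s - g 0) /\<^sub>R s) \<longlongrightarrow> v) (at 0)"
proof -
  have "((\<lambda>h. norm (g (0 + h) - g 0 - h *\<^sub>R v) / norm h) \<longlongrightarrow> 0) (at 0)"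
    using assms unfolding has_vector_derivative_def has_derivative_at by blast
  moreover have "\<forall>\<^sub>F h in at 0. norm (g (0 + h) - g 0 - h *\<^sub>R v) / norm h = norm ((g h - g 0) /\<^sub>R h - v)"
  proof -
    have "norm (g (0 + h) - g 0 - h *\<^sub>R v) / norm h = norm ((g h - g 0) /\<^sub>R h - v)" if "h \<noteq> 0" for h
    proof -
      have "(g h - g 0) /\<^sub>R h - v = (g h - g 0 - h *\<^sub>R v) /\<^sub>R h"
        using that by (simp add: scaleR_diff_right)
      then show ?thesis by (simp add: divide_inverse mult.commute)
    qed
    then show ?thesis by (auto simp: eventually_at_filter)
  qed
  ultimately have "((\<lambda>h. norm ((g h - g 0) /\<^sub>R h - v)) \<longlongrightarrow> 0) (at 0)"
    by (rule Lim_transform_eventually)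
  then show ?thesis
    by (simp add: tendsto_norm_zero_iff LIM_zero_iff)
qed

text \<open>The derivative is the dominated limit of difference quotients, and translation becomes
  multiplication by a character.\<close>

lemma fourier_derivative:
  fixes u :: "'a::euclidean_space \<Rightarrow> complex"
  assumes u: "\<And>x. (u has_derivative u' x) (at x)" and v: "\<And>x. v x = u' x b"
    and u_le: "\<And>y. cmod (u y) \<le> C * decay (2 * DIM('a)) (y - x0)"
    and v_le: "\<And>y. cmod (v y) \<le> C * decay (2 * DIM('a)) (y - x0)"
    and [measurable]: "v \<in> borel_measurable borel"
  shows "fourier v \<xi> = \<i> * of_real (b \<bullet> \<xi>) * fourier u \<xi>"
proof -
  let ?m = "2 * DIM('a)"
  have C: "0 \<le> C"
    using u_le[of x0] by (simp add: decay_def) (meson norm_ge_zero order_trans)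
  have [measurable]: "u \<in> borel_measurable borel"
    using u by (intro borel_measurable_continuous_onI has_derivative_continuous_on) (auto intro: has_derivative_at_withinI)
  have int: "integrable lborel (\<lambda>y::'a. K * decay ?m (y - z))" for K z
    using lborel_integrable_translate[OF integrable_decay[of ?m], of z] by simp
  have int_u: "integrable lborel (\<lambda>y. u (y - z))" for z
  proof -
    have "integrable lborel u"
      by (rule integrable_dominated[OF int[of C x0] _ u_le]) simp
    then show ?thesis by (rule lborel_integrable_translate)
  qed
  define e where "e n = 1 / real (Suc n)" for n
  have e: "0 < e n" "e n \<le> 1" for n by (auto simp: e_def)
  have e0: "e \<longlonglongrightarrow> 0" unfolding e_def by (rule LIMSEQ_Suc[OF lim_1_over_n])
  have u_line: "((\<lambda>s. u (y + s *\<^sub>R b)) has_derivative (\<lambda>h. h *\<^sub>R v (y + s *\<^sub>R b))) (at s)" for y s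
  proof -
    have "((\<lambda>s. y + s *\<^sub>R b) has_derivative (\<lambda>h. h *\<^sub>R b)) (at s)"
      by (auto intro!: derivative_eq_intros)
    from diff_chain_at[OF this u]
    have "((\<lambda>s. u (y + s *\<^sub>R b)) has_derivative (\<lambda>h. u' (y + s *\<^sub>R b) (h *\<^sub>R b))) (at s)"
      by (simp add: o_def)
    moreover have "u' z (h *\<^sub>R b) = h *\<^sub>R v z" for h z
      using has_derivative_linear[OF u[of z]] by (simp add: linear_cmul v)
    ultimately show ?thesis by simp
  qed
  define D where "D n y = (u (y + e n *\<^sub>R b) - u y) / of_real (e n)" for n y
  have D_lim: "(\<lambda>n. D n y) \<longlonglongrightarrow> v y" for y
  proof -
    have "((\<lambda>s. u (y + s *\<^sub>R b)) has_vector_derivative v y) (at 0)"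
      using u_line[of y 0] by (simp add: has_vector_derivative_def)
    from has_vector_derivative_quotient[OF this]
    have "((\<lambda>s. (u (y + s *\<^sub>R b) - u y) /\<^sub>R s) \<longlongrightarrow> v y) (at 0)"
      by simp
    moreover have "filterlim e (at 0) sequentially"
      using e0 e(1) by (auto simp: filterlim_at less_imp_neq[symmetric])
    ultimately have "(\<lambda>n. (u (y + e n *\<^sub>R b) - u y) /\<^sub>R e n) \<longlonglongrightarrow> v y"
      by (rule filterlim_compose)
    then show ?thesis
      by (simp add: D_def scaleR_conv_of_real divide_inverse mult.commute)
  qed
  \<comment> \<open>Peetre's inequality bounds the derivative on the whole segment from \<open>y\<close> to \<open>y + b\<close>.\<close>
  define G where "G y = C * (2 ^ ?m * bracket b ^ ?m) * decay ?m (y - x0)" for y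
  have D_le: "cmod (D n y) \<le> G y" for n y
  proof -
    have "norm (u (y + e n *\<^sub>R b) - u (y + 0 *\<^sub>R b)) \<le> G y * norm (e n - 0)"
    proof (rule differentiable_bound[of "{0..e n}" "\<lambda>s. u (y + s *\<^sub>R b)" "\<lambda>s h. h *\<^sub>R v (y + s *\<^sub>R b)" "G y"])
      fix s assume s: "s \<in> {0..e n}"
      show "((\<lambda>s. u (y + s *\<^sub>R b)) has_derivative (\<lambda>h. h *\<^sub>R v (y + s *\<^sub>R b))) (at s within {0..e n})"
        by (rule has_derivative_at_withinI[OF u_line])
      have "bracket (s *\<^sub>R b) \<le> bracket b"
        using s e(2)[of n] by (intro bracket_mono) (auto intro: mult_left_le_one_le)
      have "cmod (v (y + s *\<^sub>R b)) \<le> C * decay ?m ((y - x0) + s *\<^sub>R b)"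
        using v_le[of "y + s *\<^sub>R b"] by (simp add: algebra_simps)
      also have "\<dots> \<le> C * (2 ^ ?m * decay ?m (y - x0) * bracket (s *\<^sub>R b) ^ ?m)"
        by (intro mult_left_mono decay_add_le C)
      also have "\<dots> \<le> C * (2 ^ ?m * decay ?m (y - x0) * bracket b ^ ?m)"
        by (intro mult_left_mono power_mono C) (auto simp: \<open>bracket (s *\<^sub>R b) \<le> bracket b\<close>)
      finally have "cmod (v (y + s *\<^sub>R b)) \<le> G y" by (simp add: G_def ac_simps)
      then have "norm (h *\<^sub>R v (y + s *\<^sub>R b)) \<le> G y * norm h" for h
        unfolding norm_scaleR real_norm_def mult.commute[of "\<bar>h\<bar>"] by (rule mult_right_mono) simp
      then show "onorm (\<lambda>h. h *\<^sub>R v (y + s *\<^sub>R b)) \<le> G y"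
        by (rule onorm_le)
    qed (use e(1)[of n] in auto)
    then show ?thesis
      using e(1)[of n] by (simp add: D_def norm_divide field_simps)
  qed
  have "(\<lambda>n. LINT y|lborel. D n y * exp (- \<i> * of_real (y \<bullet> \<xi>))) \<longlonglongrightarrow> (LINT y|lborel. v y * exp (- \<i> * of_real (y \<bullet> \<xi>)))"
  proof (rule integral_dominated_convergence[where w = G])
    show "integrable lborel G" unfolding G_def by (rule int)
    show "(\<lambda>y. D n y * exp (- \<i> * of_real (y \<bullet> \<xi>))) \<in> borel_measurable lborel" for n
      unfolding D_def by measurable
    show "AE y in lborel. (\<lambda>n. D n y * exp (- \<i> * of_real (y \<bullet> \<xi>))) \<longlonglongrightarrow> v y * exp (- \<i> * of_real (y \<bullet> \<xi>))"
      by (intro AE_I2 tendsto_intros D_lim)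
  qed (auto simp: norm_mult D_le)
  then have "(\<lambda>n. fourier (D n) \<xi>) \<longlonglongrightarrow> fourier v \<xi>"
    unfolding fourier_def by (intro tendsto_intros)
  moreover have "fourier (D n) \<xi> = (exp (\<i> * of_real (b \<bullet> \<xi>) * of_real (e n)) - 1) / of_real (e n) * fourier u \<xi>" for n
  proof -
    have "D n = (\<lambda>y. 1 / of_real (e n) * u (y - (- e n *\<^sub>R b)) + (- 1 / of_real (e n)) * u (y - 0))"
      by (auto simp: D_def diff_divide_distrib)
    then have "fourier (D n) \<xi> = fourier (\<lambda>y. 1 / of_real (e n) * u (y - (- e n *\<^sub>R b))) \<xi> + fourier (\<lambda>y. (- 1 / of_real (e n)) * u (y - 0)) \<xi>"
      by (simp only:) (intro fourier_add integrable_mult_right int_u)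
    also have "\<dots> = 1 / of_real (e n) * (exp (- \<i> * of_real ((- e n *\<^sub>R b) \<bullet> \<xi>)) * fourier u \<xi>)
        + (- 1 / of_real (e n)) * (exp (- \<i> * of_real (0 \<bullet> \<xi>)) * fourier u \<xi>)"
      by (simp only: fourier_cmult fourier_translate[OF \<open>u \<in> borel_measurable borel\<close>])
    finally show ?thesis
      using e(1)[of n] by (simp add: field_simps)
  qed
  moreover have "(\<lambda>n. (exp (\<i> * of_real (b \<bullet> \<xi>) * of_real (e n)) - 1) / of_real (e n) * fourier u \<xi>)
      \<longlonglongrightarrow> \<i> * of_real (b \<bullet> \<xi>) * fourier u \<xi>"
  proof (intro tendsto_mult tendsto_const)
    have "((\<lambda>s. exp (\<i> * of_real (b \<bullet> \<xi>) * s)) has_field_derivative (\<i> * of_real (b \<bullet> \<xi>))) (at 0)"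
      by (auto intro!: derivative_eq_intros)
    then have "((\<lambda>s. (exp (\<i> * of_real (b \<bullet> \<xi>) * s) - 1) / s) \<longlongrightarrow> \<i> * of_real (b \<bullet> \<xi>)) (at 0)"
      by (simp add: has_field_derivative_iff)
    moreover have "(\<lambda>n. complex_of_real (e n)) \<longlonglongrightarrow> of_real 0"
      by (intro tendsto_of_real e0)
    then have "filterlim (\<lambda>n. complex_of_real (e n)) (at 0) sequentially"
      using e(1) by (auto simp: filterlim_at less_imp_neq[symmetric])
    ultimately show "(\<lambda>n. (exp (\<i> * of_real (b \<bullet> \<xi>) * of_real (e n)) - 1) / of_real (e n)) \<longlonglongrightarrow> \<i> * of_real (b \<bullet> \<xi>)"
      by (rule filterlim_compose)
  qed
  ultimately show ?thesis
    using LIMSEQ_unique by fastforce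
qed

text \<open>The Leibniz rule is built into the induction: each integration by parts replaces one product of two
  functions by two such products.\<close>

lemma fourier_product_coordinate_decay:
  fixes f h :: "nat \<Rightarrow> 'a::euclidean_space \<Rightarrow> complex"
  assumes f: "\<And>i x. (f i has_derivative f' i x) (at x)" "\<And>i x. f (Suc i) x = f' i x b"
    and h: "\<And>i x. (h i has_derivative h' i x) (at x)" "\<And>i x. h (Suc i) x = h' i x b"
    and A: "\<And>i y. i \<le> n \<Longrightarrow> cmod (f i y) \<le> A y" and B: "\<And>i y. i \<le> n \<Longrightarrow> cmod (h i y) \<le> B y"
    and AB: "\<And>y. A y * B y \<le> C * decay (2 * DIM('a)) (y - x0)"
    and [measurable]: "(\<lambda>y. A y * B y) \<in> borel_measurable borel"
  shows "\<bar>b \<bullet> \<xi>\<bar> ^ n * cmod (fourier (\<lambda>y. f 0 y * h 0 y) \<xi>)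
    \<le> 2 ^ n * ((2 * pi) powr (- real DIM('a) / 2) * (LINT y|lborel. A y * B y))"
proof -
  have nonneg: "0 \<le> A y * B y" if "cmod z \<le> A y" "cmod w \<le> B y" for y z w
    using that norm_ge_zero[of z] norm_ge_zero[of w] by (intro mult_nonneg_nonneg; linarith)
  have int: "integrable lborel (\<lambda>y. A y * B y)" if "\<And>y. 0 \<le> A y * B y"
  proof (rule integrable_dominated)
    show "integrable lborel (\<lambda>y. C * decay (2 * DIM('a)) (y - x0))"
      using lborel_integrable_translate[OF integrable_decay[of "2 * DIM('a)"], of x0] by simp
    show "norm (A y * B y) \<le> C * decay (2 * DIM('a)) (y - x0)" for y
      using AB[of y] that[of y] by (simp only: real_norm_def abs_of_nonneg)
  qed simp
  show ?thesis
    using f h A B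
  proof (induction n arbitrary: f f' h h')
    case 0
    have [measurable]: "(\<lambda>y. f 0 y * h 0 y) \<in> borel_measurable borel"
      using 0(1,3) by (intro borel_measurable_times borel_measurable_continuous_onI has_derivative_continuous_on)
        (auto intro: has_derivative_at_withinI)
    have le: "cmod (f 0 y) \<le> A y" "cmod (h 0 y) \<le> B y" for y
      using 0(5,6) by auto
    have "cmod (fourier (\<lambda>y. f 0 y * h 0 y) \<xi>) \<le> (2 * pi) powr (- real DIM('a) / 2) * (LINT y|lborel. A y * B y)"
    proof (rule fourier_norm_le[OF int])
      show "0 \<le> A y * B y" for y by (rule nonneg[OF le])
      show "cmod (f 0 y * h 0 y) \<le> A y * B y" for y
        unfolding norm_mult by (intro mult_mono' le) auto
    qed simp
    then show ?case by simp
  next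
    case (Suc n)
    let ?u = "\<lambda>y. f 0 y * h 0 y" and ?v1 = "\<lambda>y. f (Suc 0) y * h 0 y" and ?v2 = "\<lambda>y. f 0 y * h (Suc 0) y"
    have meas: "(\<lambda>y. f i y * h j y) \<in> borel_measurable borel" for i j
      using Suc.prems(1,3) by (intro borel_measurable_times borel_measurable_continuous_onI has_derivative_continuous_on)
        (auto intro: has_derivative_at_withinI)
    have pos: "0 \<le> A y * B y" for y
      using Suc.prems(5,6)[of 0 y] by (intro nonneg[of "f 0 y" y "h 0 y"]) auto
    have le: "cmod (f i y * h j y) \<le> A y * B y" if "i \<le> Suc n" "j \<le> Suc n" for i j y
      unfolding norm_mult using Suc.prems(5)[OF that(1), of y] Suc.prems(6)[OF that(2), of y]
      by (intro mult_mono') auto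
    have int2: "integrable lborel (\<lambda>y. f i y * h j y)" if "i \<le> Suc n" "j \<le> Suc n" for i j
      by (rule integrable_dominated[OF int[OF pos] meas le[OF that]])
    have der: "((\<lambda>y. f 0 y * h 0 y) has_derivative (\<lambda>k. f 0 x * h' 0 x k + f' 0 x k * h 0 x)) (at x)" for x
      using Suc.prems(1,3) by (intro has_derivative_mult) auto
    have C: "0 \<le> C"
      using order_trans[OF pos[of x0] AB[of x0]] by (simp add: decay_def)
    have "fourier (\<lambda>y. ?v1 y + ?v2 y) \<xi> = \<i> * of_real (b \<bullet> \<xi>) * fourier ?u \<xi>"
    proof (rule fourier_derivative[where C="2 * C" and ?x0.0=x0 and u'="\<lambda>x k. f 0 x * h' 0 x k + f' 0 x k * h 0 x"])
      show "?v1 x + ?v2 x = f 0 x * h' 0 x b + f' 0 x b * h 0 x" for x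
        using Suc.prems(2,4)[of 0 x] by simp
      show "cmod (f 0 y * h 0 y) \<le> 2 * C * decay (2 * DIM('a)) (y - x0)" for y
        using order_trans[OF le[of 0 0 y] AB] mult_nonneg_nonneg[OF C decay_nonneg[of "2 * DIM('a)" "y - x0"]] by simp
      show "cmod (?v1 y + ?v2 y) \<le> 2 * C * decay (2 * DIM('a)) (y - x0)" for y
        using order_trans[OF le[of "Suc 0" 0 y] AB] order_trans[OF le[of 0 "Suc 0" y] AB] norm_triangle_ineq[of "?v1 y" "?v2 y"]
        by simp
      show "(\<lambda>y. ?v1 y + ?v2 y) \<in> borel_measurable borel"
        by (intro borel_measurable_add meas)
    qed (rule der)
    moreover have "fourier (\<lambda>y. ?v1 y + ?v2 y) \<xi> = fourier ?v1 \<xi> + fourier ?v2 \<xi>"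
      by (intro fourier_add int2) auto
    ultimately have "\<bar>b \<bullet> \<xi>\<bar> * cmod (fourier ?u \<xi>) \<le> cmod (fourier ?v1 \<xi>) + cmod (fourier ?v2 \<xi>)"
      by (metis (no_types, lifting) mult_1 norm_ii norm_mult norm_of_real norm_triangle_ineq)
    then have "\<bar>b \<bullet> \<xi>\<bar> ^ Suc n * cmod (fourier ?u \<xi>) \<le> \<bar>b \<bullet> \<xi>\<bar> ^ n * (cmod (fourier ?v1 \<xi>) + cmod (fourier ?v2 \<xi>))"
      unfolding power_Suc2 mult.assoc by (rule mult_left_mono) simp
    also have "\<dots> = \<bar>b \<bullet> \<xi>\<bar> ^ n * cmod (fourier ?v1 \<xi>) + \<bar>b \<bullet> \<xi>\<bar> ^ n * cmod (fourier ?v2 \<xi>)"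
      by (rule distrib_left)
    also have "\<dots> \<le> 2 ^ n * ((2 * pi) powr (- real DIM('a) / 2) * (LINT y|lborel. A y * B y))
        + 2 ^ n * ((2 * pi) powr (- real DIM('a) / 2) * (LINT y|lborel. A y * B y))"
      by (intro add_mono Suc.IH[of "\<lambda>i. f (Suc i)" "\<lambda>i. f' (Suc i)" h h'] Suc.IH[of f f' "\<lambda>i. h (Suc i)" "\<lambda>i. h' (Suc i)"])
        (rule Suc.prems | simp)+
    finally show ?case by (simp only: power_Suc mult_2[symmetric] mult.assoc)
  qed
qed

lemma bracket_power_le: "bracket x ^ n \<le> real (Suc DIM('a)) ^ n * (1 + (\<Sum>b\<in>Basis. \<bar>b \<bullet> x\<bar> ^ n))"
  for x :: "'a::euclidean_space"
proof -
  let ?S = "insert 1 ((\<lambda>b. \<bar>b \<bullet> x\<bar>) ` Basis)"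
  define M where "M = Max ?S"
  have M: "M \<in> ?S" "1 \<le> M" "\<And>b. b \<in> Basis \<Longrightarrow> \<bar>b \<bullet> x\<bar> \<le> M"
    unfolding M_def by (rule Max_in) (auto intro!: Max_ge simp del: Max_insert)
  have "bracket x \<le> 1 + (\<Sum>b\<in>Basis. \<bar>x \<bullet> b\<bar>)"
    using bracket_le_1_norm[of x] norm_le_l1[of x] by linarith
  also have "\<dots> \<le> M + (\<Sum>b\<in>(Basis::'a set). M)"
    using M(2,3) by (intro add_mono sum_mono) (auto simp: inner_commute)
  also have "\<dots> = real (Suc DIM('a)) * M" by (simp add: algebra_simps)
  finally have "bracket x ^ n \<le> (real (Suc DIM('a)) * M) ^ n"
    by (rule power_mono) simp
  also have "\<dots> = real (Suc DIM('a)) ^ n * M ^ n" by (simp add: power_mult_distrib)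
  also have "M ^ n \<le> 1 + (\<Sum>b\<in>Basis. \<bar>b \<bullet> x\<bar> ^ n)"
    using M(1)
  proof
    assume "M = 1" then show ?thesis by (simp add: sum_nonneg)
  next
    assume "M \<in> (\<lambda>b. \<bar>b \<bullet> x\<bar>) ` Basis"
    then obtain b where "b \<in> Basis" "M = \<bar>b \<bullet> x\<bar>" by blast
    then show ?thesis
      using member_le_sum[of b Basis "\<lambda>b. \<bar>b \<bullet> x\<bar> ^ n"] by simp
  qed
  finally show ?thesis by (simp add: mult_left_mono)
qed

text \<open>The bounds of the two factors are functions of \<open>y\<close> and not constants: for the short-time Fourier transform,
  the integral of their product carries the decay in \<open>x\<close>.\<close>

lemma fourier_product_decay:
  "\<exists>c\<ge>0. \<forall>(f::'a::euclidean_space \<Rightarrow> complex) h A B C x0 \<xi>. schwartz f \<longrightarrow> schwartz h \<longrightarrow>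
    (\<forall>bs\<in>lists Basis. length bs \<le> N \<longrightarrow> (\<forall>y. cmod (iter_deriv bs f y) \<le> A y \<and> cmod (iter_deriv bs h y) \<le> B y)) \<longrightarrow>
    (\<forall>y. A y * B y \<le> C * decay (2 * DIM('a)) (y - x0)) \<longrightarrow> (\<lambda>y. A y * B y) \<in> borel_measurable borel \<longrightarrow>
    cmod (fourier (\<lambda>y. f y * h y) \<xi>) \<le> c * (LINT y|lborel. A y * B y) * decay N \<xi>"
proof -
  define K where "K = (2 * pi) powr (- real DIM('a) / 2)"
  define c where "c = real (Suc DIM('a)) ^ N * (1 + real DIM('a) * 2 ^ N) * K"
  have "0 \<le> c" by (simp add: c_def K_def)
  have "cmod (fourier (\<lambda>y. f y * h y) \<xi>) \<le> c * (LINT y|lborel. A y * B y) * decay N \<xi>"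
    if f: "schwartz f" and h: "schwartz h"
      and le: "\<forall>bs\<in>lists Basis. length bs \<le> N \<longrightarrow> (\<forall>y. cmod (iter_deriv bs f y) \<le> A y \<and> cmod (iter_deriv bs h y) \<le> B y)"
      and AB: "\<forall>y. A y * B y \<le> C * decay (2 * DIM('a)) (y - x0)"
      and meas: "(\<lambda>y. A y * B y) \<in> borel_measurable borel"
    for f h :: "'a \<Rightarrow> complex" and A B C x0 \<xi>
  proof -
    let ?I = "LINT y|lborel. A y * B y" and ?F = "cmod (fourier (\<lambda>y. f y * h y) \<xi>)"
    have key: "\<bar>b \<bullet> \<xi>\<bar> ^ n * ?F \<le> 2 ^ n * (K * ?I)" if b: "b \<in> Basis" and "n \<le> N" for b n
    proof -
      have "replicate i b \<in> lists Basis" for i using b by (auto simp: in_lists_conv_set)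
      then show ?thesis
        unfolding K_def
        using fourier_product_coordinate_decay[where
            f="\<lambda>i. iter_deriv (replicate i b) f" and f'="\<lambda>i x. frechet_derivative (iter_deriv (replicate i b) f) (at x)" and
            h="\<lambda>i. iter_deriv (replicate i b) h" and h'="\<lambda>i x. frechet_derivative (iter_deriv (replicate i b) h) (at x)" and
            n=n and A=A and B=B and C=C and ?x0.0=x0 and b=b and \<xi>=\<xi>] le AB meas \<open>n \<le> N\<close>
          schwartz_has_derivative[OF f] schwartz_has_derivative[OF h]
        by auto
    qed
    obtain b0 :: 'a where "b0 \<in> Basis" using nonempty_Basis by blast
    from key[OF this, of 0] have F0: "?F \<le> K * ?I" by simp
    have "bracket \<xi> ^ N * ?F \<le> (real (Suc DIM('a)) ^ N * (1 + (\<Sum>b\<in>Basis. \<bar>b \<bullet> \<xi>\<bar> ^ N))) * ?F"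
      by (intro mult_right_mono bracket_power_le) simp
    also have "\<dots> = real (Suc DIM('a)) ^ N * (?F + (\<Sum>b\<in>Basis. \<bar>b \<bullet> \<xi>\<bar> ^ N * ?F))"
      by (simp add: sum_distrib_right distrib_right)
    also have "\<dots> \<le> real (Suc DIM('a)) ^ N * (K * ?I + (\<Sum>b\<in>(Basis::'a set). 2 ^ N * (K * ?I)))"
      by (intro mult_left_mono add_mono F0 sum_mono key) auto
    also have "\<dots> = c * ?I" by (simp add: c_def algebra_simps)
    finally show ?thesis by (simp add: decay_def field_simps)
  qed
  with \<open>0 \<le> c\<close> show ?thesis by blast
qed

text \<open>An instance of Fubini's theorem, used twice: it identifies the transpose of the Fourier transform on
  distributions with the integral, and for Gaussian \<open>\<psi>\<close> it yields injectivity.\<close>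

lemma fourier_transpose:
  fixes f \<psi> :: "'a::euclidean_space \<Rightarrow> complex"
  assumes f: "integrable lborel f" and \<psi>: "integrable lborel \<psi>"
  shows "(LINT y|lborel. f y * fourier \<psi> y) = (LINT \<xi>|lborel. fourier f \<xi> * \<psi> \<xi>)"
proof -
  define K where "K = complex_of_real ((2 * pi) powr (- real DIM('a) / 2))"
  let ?g = "\<lambda>y \<xi>. f y * (\<psi> \<xi> * exp (- \<i> * of_real (\<xi> \<bullet> y)))"
  have [measurable]: "f \<in> borel_measurable borel" "\<psi> \<in> borel_measurable borel"
    using f \<psi> by auto
  have kernel: "(\<lambda>z::'a \<times> 'a. exp (- \<i> * complex_of_real (snd z \<bullet> fst z))) \<in> borel_measurable (lborel \<Otimes>\<^sub>M lborel)"
  proof -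
    have "(\<lambda>z::'a \<times> 'a. exp (- \<i> * complex_of_real (snd z \<bullet> fst z))) \<in> borel_measurable borel"
      by (intro borel_measurable_continuous_onI continuous_intros)
    then show ?thesis by (simp add: lborel_prod)
  qed
  have int: "integrable (lborel \<Otimes>\<^sub>M lborel) (case_prod ?g)"
  proof (rule lborel_pair.Fubini_integrable)
    have "(\<lambda>z. f (fst z) * (\<psi> (snd z) * exp (- \<i> * complex_of_real (snd z \<bullet> fst z)))) \<in> borel_measurable (lborel \<Otimes>\<^sub>M lborel)"
      by (intro borel_measurable_times kernel) measurable
    then show "case_prod ?g \<in> borel_measurable (lborel \<Otimes>\<^sub>M lborel)"
      by (simp add: case_prod_beta')
    show "integrable lborel (\<lambda>x. LINT y|lborel. norm (case (x, y) of (y, \<xi>) \<Rightarrow> ?g y \<xi>))"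
      using f by (simp add: norm_mult)
    show "AE x in lborel. integrable lborel (\<lambda>y. case (x, y) of (y, \<xi>) \<Rightarrow> ?g y \<xi>)"
      using integrable_fourier_integrand[OF \<psi>] by (intro AE_I2) simp
  qed
  have "f y * fourier \<psi> y = K * (LINT \<xi>|lborel. ?g y \<xi>)" for y
    unfolding integral_mult_right_zero fourier_def K_def by (rule mult.left_commute)
  then have "(LINT y|lborel. f y * fourier \<psi> y) = (LINT y|lborel. K * (LINT \<xi>|lborel. ?g y \<xi>))"
    by (simp only:)
  also have "\<dots> = K * (LINT \<xi>|lborel. LINT y|lborel. ?g y \<xi>)"
    unfolding lborel_pair.Fubini_integral[OF int] by (rule integral_mult_right_zero)
  also have "\<dots> = (LINT \<xi>|lborel. K * (LINT y|lborel. f y * exp (- \<i> * of_real (y \<bullet> \<xi>))) * \<psi> \<xi>)"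
  proof -
    have "(LINT y|lborel. ?g y \<xi>) = (LINT y|lborel. f y * exp (- \<i> * of_real (y \<bullet> \<xi>))) * \<psi> \<xi>" for \<xi>
      by (subst integral_mult_left_zero[symmetric], intro Bochner_Integration.integral_cong) (auto simp: inner_commute)
    then show ?thesis by (simp add: mult.assoc)
  qed
  finally show ?thesis by (simp add: fourier_def K_def)
qed

lemma fourier_scaled:
  fixes u :: "'a::euclidean_space \<Rightarrow> complex"
  assumes [measurable]: "u \<in> borel_measurable borel" and c: "0 < c"
  shows "fourier (\<lambda>x. u (c *\<^sub>R x)) \<xi> = of_real (c powr (- real DIM('a))) * fourier u (\<xi> /\<^sub>R c)"
proof -
  have "(LINT x|lborel. u (c *\<^sub>R x) * exp (- \<i> * of_real (x \<bullet> \<xi>)))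
      = (LINT x|lborel. (\<lambda>z. u z * exp (- \<i> * of_real (z \<bullet> (\<xi> /\<^sub>R c)))) (c *\<^sub>R (x - 0)))"
  proof (intro Bochner_Integration.integral_cong refl)
    fix x
    have "(c *\<^sub>R (x - 0)) \<bullet> (\<xi> /\<^sub>R c) = x \<bullet> \<xi>" using c by simp
    then show "u (c *\<^sub>R x) * exp (- \<i> * of_real (x \<bullet> \<xi>)) = (\<lambda>z. u z * exp (- \<i> * of_real (z \<bullet> (\<xi> /\<^sub>R c)))) (c *\<^sub>R (x - 0))"
      by (simp only: diff_zero)
  qed
  also have "\<dots> = c powr (- real DIM('a)) *\<^sub>R (LINT z|lborel. u z * exp (- \<i> * of_real (z \<bullet> (\<xi> /\<^sub>R c))))"
    by (rule lborel_integral_affine) (use c in measurable)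
  finally show ?thesis
    by (simp add: fourier_def scaleR_conv_of_real)
qed

text \<open>The integrand is a product over the coordinates, so the claim reduces to the characteristic function of the
  standard normal distribution.\<close>

lemma fourier_std_gauss: "fourier (gauss 1 0 1) = (gauss 1 0 1 :: 'a::euclidean_space \<Rightarrow> complex)"
proof
  fix \<xi> :: 'a
  let ?e = "\<lambda>b x. complex_of_real (exp (- x\<^sup>2 / 2)) * exp (- \<i> * of_real (x * (\<xi> \<bullet> b)))"
  have one_dim: "integrable lborel (?e b)" "(LINT x|lborel. ?e b x) = of_real (sqrt (2 * pi)) * of_real (exp (- (\<xi> \<bullet> b)\<^sup>2 / 2))" for b
  proof -
    have "integrable lborel (\<lambda>x::real. sqrt (2 * pi) * std_normal_density x)"
      by simp
    then have i: "integrable lborel (\<lambda>x::real. exp (- x\<^sup>2 / 2))"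
      by (simp add: std_normal_density_def)
    show "integrable lborel (?e b)"
      by (rule integrable_dominated[OF i]) (auto simp: norm_mult)
    have "char std_normal_distribution (- (\<xi> \<bullet> b)) = (LINT x|lborel. std_normal_density x *\<^sub>R iexp (- (\<xi> \<bullet> b) * x))"
      unfolding char_def by (subst integral_density) auto
    also have "\<dots> = (LINT x|lborel. of_real (1 / sqrt (2 * pi)) * ?e b x)"
      by (intro Bochner_Integration.integral_cong) (auto simp: std_normal_density_def scaleR_conv_of_real mult.commute)
    also have "\<dots> = of_real (1 / sqrt (2 * pi)) * (LINT x|lborel. ?e b x)"
      by (rule integral_mult_right_zero)
    finally show "(LINT x|lborel. ?e b x) = of_real (sqrt (2 * pi)) * of_real (exp (- (\<xi> \<bullet> b)\<^sup>2 / 2))"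
      by (simp add: char_std_normal_distribution field_simps)
  qed
  interpret P: product_sigma_finite "\<lambda>b::'a. lborel :: real measure" ..
  have [measurable]: "(\<lambda>x::'a. gauss 1 0 1 x * exp (- \<i> * of_real (x \<bullet> \<xi>))) \<in> borel_measurable borel"
    by measurable
  have "(LINT x|lborel. gauss 1 0 1 x * exp (- \<i> * of_real (x \<bullet> \<xi>)))
    = (LINT f|(\<Pi>\<^sub>M b\<in>Basis. lborel). gauss 1 0 1 (\<Sum>b\<in>Basis. f b *\<^sub>R b) * exp (- \<i> * of_real ((\<Sum>b\<in>Basis. f b *\<^sub>R b) \<bullet> \<xi>)))"
    by (subst lborel_eq, subst integral_distr) auto
  also have "\<dots> = (LINT f|(\<Pi>\<^sub>M b\<in>Basis. lborel). (\<Prod>b\<in>Basis. ?e b (f b)))"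
  proof (intro Bochner_Integration.integral_cong refl)
    fix f :: "'a \<Rightarrow> real"
    have "(norm (\<Sum>b\<in>Basis. f b *\<^sub>R b))\<^sup>2 = (\<Sum>b\<in>Basis. (f b)\<^sup>2)"
      unfolding power2_norm_eq_inner by (subst euclidean_inner) (auto simp: power2_eq_square inner_sum_left_Basis intro!: sum.cong)
    moreover have "(\<Sum>b\<in>Basis. f b *\<^sub>R b) \<bullet> \<xi> = (\<Sum>b\<in>Basis. f b * (\<xi> \<bullet> b))"
      unfolding inner_sum_left by (intro sum.cong) (auto simp: inner_commute)
    ultimately show "gauss 1 0 1 (\<Sum>b\<in>Basis. f b *\<^sub>R b) * exp (- \<i> * of_real ((\<Sum>b\<in>Basis. f b *\<^sub>R b) \<bullet> \<xi>)) = (\<Prod>b\<in>Basis. ?e b (f b))"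
      by (simp add: gauss_def prod.distrib exp_sum[symmetric] of_real_exp sum_negf sum_divide_distrib sum_distrib_left)
  qed
  also have "\<dots> = (\<Prod>b\<in>Basis. of_real (sqrt (2 * pi)) * of_real (exp (- (\<xi> \<bullet> b)\<^sup>2 / 2)))"
    using one_dim by (subst P.product_integral_prod) auto
  also have "\<dots> = of_real (sqrt (2 * pi) ^ DIM('a)) * gauss 1 0 1 \<xi>"
  proof -
    have "(norm \<xi>)\<^sup>2 = (\<Sum>b\<in>Basis. (\<xi> \<bullet> b)\<^sup>2)"
      unfolding power2_norm_eq_inner by (subst euclidean_inner) (simp add: power2_eq_square)
    then show ?thesis
      by (simp add: gauss_def prod.distrib exp_sum[symmetric] of_real_exp sum_negf sum_divide_distrib)
  qed
  also have "sqrt (2 * pi) ^ DIM('a) = (2 * pi) powr (real DIM('a) / 2)"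
    by (simp add: powr_half_sqrt[symmetric] powr_realpow[symmetric] powr_powr)
  finally show "fourier (gauss 1 0 1) \<xi> = gauss 1 0 1 \<xi>"
    by (simp add: fourier_def powr_minus of_real_mult[symmetric] del: of_real_mult)
qed

section \<open>Gaussians separate continuous functions\<close>

text \<open>Gaussians around \<open>z\<close> concentrate at \<open>z\<close>: outside a ball of radius \<open>\<delta>\<close>, \<open>gauss 1 z \<rho>\<close> is
  smaller by a factor \<open>exp (- 3/8 \<rho>\<^sup>2 \<delta>\<^sup>2)\<close> than in the ball of half the radius.\<close>

lemma nonpos_if_gauss_integrals_zero:
  fixes w :: "'a::euclidean_space \<Rightarrow> real"
  assumes cont: "continuous_on UNIV w"
    and int: "\<And>\<rho>. 1 \<le> \<rho> \<Longrightarrow> integrable lborel (\<lambda>y. w y * exp (- (\<rho> * norm (y - z))\<^sup>2 / 2))"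
    and zero: "\<And>\<rho>. 1 \<le> \<rho> \<Longrightarrow> (LINT y|lborel. w y * exp (- (\<rho> * norm (y - z))\<^sup>2 / 2)) = 0"
  shows "w z \<le> 0"
proof (rule ccontr)
  assume "\<not> w z \<le> 0"
  define m where "m = w z / 2"
  have m: "0 < m" using \<open>\<not> w z \<le> 0\<close> by (simp add: m_def)
  obtain \<delta> where \<delta>: "0 < \<delta>" "\<And>y. norm (y - z) < \<delta> \<Longrightarrow> m < w y"
  proof -
    have "isCont w z" using cont by (simp add: continuous_on_eq_continuous_at)
    then obtain \<delta> where "0 < \<delta>" "\<And>y. dist y z < \<delta> \<Longrightarrow> dist (w y) (w z) < m"
      using m unfolding continuous_at_eps_delta by blast
    moreover have "m < w y" if "dist (w y) (w z) < m" for y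
      using that unfolding dist_real_def m_def by linarith
    ultimately show ?thesis
      by (intro that[of \<delta>]) (auto simp: dist_norm)
  qed
  define I where "I = (LINT y|lborel. \<bar>w y * exp (- (1 * norm (y - z))\<^sup>2 / 2)\<bar>)"
  define v where "v = measure lborel (cball z (\<delta> / 2))"
  have v: "0 < v" using \<delta>(1) by (simp add: v_def content_cball_gt_0_iff)
  \<comment> \<open>Compare the contribution of the inner ball with that of the complement of the outer one.\<close>
  have ineq: "m * v * exp (- (\<rho> * \<delta>)\<^sup>2 / 8) \<le> exp (- (\<rho>\<^sup>2 - 1) * \<delta>\<^sup>2 / 2) * I" if \<rho>: "1 \<le> \<rho>" for \<rho>
  proof -
    let ?G = "\<lambda>\<rho> y. exp (- (\<rho> * norm (y - z))\<^sup>2 / 2)"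
    let ?L = "\<lambda>y. m * exp (- (\<rho> * \<delta>)\<^sup>2 / 8) * indicator (cball z (\<delta> / 2)) y
        - exp (- (\<rho>\<^sup>2 - 1) * \<delta>\<^sup>2 / 2) * \<bar>w y * ?G 1 y\<bar>"
    have le: "?L y \<le> w y * ?G \<rho> y" for y
    proof (cases "norm (y - z) < \<delta>")
      case True
      have "m * exp (- (\<rho> * \<delta>)\<^sup>2 / 8) * indicator (cball z (\<delta> / 2)) y \<le> w y * ?G \<rho> y"
      proof (cases "y \<in> cball z (\<delta> / 2)")
        case True
        then have "\<rho> * norm (y - z) \<le> \<rho> * (\<delta> / 2)"
          using \<rho> by (intro mult_left_mono) (auto simp: dist_norm norm_minus_commute)
        then have "(\<rho> * norm (y - z))\<^sup>2 \<le> (\<rho> * (\<delta> / 2))\<^sup>2"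
          using \<rho> by (intro power_mono) auto
        then have "exp (- (\<rho> * \<delta>)\<^sup>2 / 8) \<le> ?G \<rho> y"
          by (simp add: power_mult_distrib power_divide)
        then have "m * exp (- (\<rho> * \<delta>)\<^sup>2 / 8) \<le> w y * ?G \<rho> y"
          using m less_imp_le[OF \<delta>(2)[OF \<open>norm (y - z) < \<delta>\<close>]] by (intro mult_mono) auto
        with True show ?thesis by simp
      next
        case False
        with m \<delta>(2)[OF \<open>norm (y - z) < \<delta>\<close>] show ?thesis by simp
      qed
      then show ?thesis
        by (smt (verit) exp_ge_zero mult_nonneg_nonneg abs_ge_zero)
    next
      case False
      then have "\<delta>\<^sup>2 \<le> (norm (y - z))\<^sup>2"
        using \<delta>(1) by (intro power_mono) auto
      moreover have "0 \<le> \<rho>\<^sup>2 - 1" using \<rho> by simp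
      ultimately have "(\<rho>\<^sup>2 - 1) * \<delta>\<^sup>2 \<le> (\<rho>\<^sup>2 - 1) * (norm (y - z))\<^sup>2"
        by (rule mult_left_mono)
      then have "?G \<rho> y \<le> exp (- (\<rho>\<^sup>2 - 1) * \<delta>\<^sup>2 / 2 + - (1 * norm (y - z))\<^sup>2 / 2)"
        by (simp add: power_mult_distrib algebra_simps)
      then have "?G \<rho> y \<le> exp (- (\<rho>\<^sup>2 - 1) * \<delta>\<^sup>2 / 2) * ?G 1 y"
        by (simp only: exp_add)
      then have "\<bar>w y\<bar> * ?G \<rho> y \<le> \<bar>w y\<bar> * (exp (- (\<rho>\<^sup>2 - 1) * \<delta>\<^sup>2 / 2) * ?G 1 y)"
        by (rule mult_left_mono) simp
      moreover have "- (\<bar>w y\<bar> * ?G \<rho> y) \<le> w y * ?G \<rho> y"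
        using abs_ge_minus_self[of "w y * ?G \<rho> y"] by (simp add: abs_mult)
      moreover have "indicator (cball z (\<delta> / 2)) y = (0::real)"
        using False \<delta>(1) by (auto simp: indicator_def dist_norm norm_minus_commute)
      ultimately show ?thesis
        by (simp add: abs_mult ac_simps)
    qed
    have i1: "integrable lborel (\<lambda>y. indicator (cball z (\<delta> / 2)) y :: real)"
      using emeasure_bounded_finite[OF bounded_cball] by (intro integrable_real_indicator) auto
    have i2: "integrable lborel (\<lambda>y. \<bar>w y * ?G 1 y\<bar>)"
      using int[of 1] by (intro integrable_abs) simp
    have "(LINT y|lborel. ?L y) \<le> (LINT y|lborel. w y * ?G \<rho> y)"
      using i1 i2 int[OF \<rho>] le by (intro integral_mono Bochner_Integration.integrable_diff integrable_mult_right) auto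
    also have "\<dots> = 0" by (rule zero[OF \<rho>])
    also have "(LINT y|lborel. ?L y) = m * exp (- (\<rho> * \<delta>)\<^sup>2 / 8) * v - exp (- (\<rho>\<^sup>2 - 1) * \<delta>\<^sup>2 / 2) * I"
      using i1 i2 by (simp add: v_def I_def)
    finally show ?thesis by (simp add: ac_simps)
  qed
  have "m * v \<le> exp (\<delta>\<^sup>2 / 2) * I * exp (- (3 * \<delta>\<^sup>2 / 8) * \<rho>\<^sup>2)" if "1 \<le> \<rho>" for \<rho>
  proof -
    have "m * v = m * v * exp (- (\<rho> * \<delta>)\<^sup>2 / 8) * exp ((\<rho> * \<delta>)\<^sup>2 / 8)"
      by (simp add: mult.assoc exp_add[symmetric])
    also have "\<dots> \<le> exp (- (\<rho>\<^sup>2 - 1) * \<delta>\<^sup>2 / 2) * I * exp ((\<rho> * \<delta>)\<^sup>2 / 8)"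
      by (intro mult_right_mono ineq that) simp
    also have "\<dots> = I * exp (- (\<rho>\<^sup>2 - 1) * \<delta>\<^sup>2 / 2 + (\<rho> * \<delta>)\<^sup>2 / 8)"
      by (simp only: exp_add ac_simps)
    also have "- (\<rho>\<^sup>2 - 1) * \<delta>\<^sup>2 / 2 + (\<rho> * \<delta>)\<^sup>2 / 8 = \<delta>\<^sup>2 / 2 + - (3 * \<delta>\<^sup>2 / 8) * \<rho>\<^sup>2"
      by (simp add: field_simps power_mult_distrib)
    finally show ?thesis by (simp only: exp_add ac_simps)
  qed
  with eventually_ge_at_top[of "1::real"] have "\<forall>\<^sub>F \<rho> in at_top. m * v \<le> exp (\<delta>\<^sup>2 / 2) * I * exp (- (3 * \<delta>\<^sup>2 / 8) * \<rho>\<^sup>2)"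
    by (rule eventually_mono)
  moreover have "((\<lambda>\<rho>::real. exp (\<delta>\<^sup>2 / 2) * I * exp (- (3 * \<delta>\<^sup>2 / 8) * \<rho>\<^sup>2)) \<longlongrightarrow> exp (\<delta>\<^sup>2 / 2) * I * 0) at_top"
  proof (intro tendsto_mult tendsto_const)
    have "3 * \<delta>\<^sup>2 / 8 > 0" using \<delta>(1) by simp
    then show "((\<lambda>\<rho>::real. exp (- (3 * \<delta>\<^sup>2 / 8) * \<rho>\<^sup>2)) \<longlongrightarrow> 0) at_top"
      by real_asymp
  qed
  ultimately have "m * v \<le> exp (\<delta>\<^sup>2 / 2) * I * 0"
    by (intro tendsto_lowerbound[of _ _ at_top]) auto
  with m v show False
    by (simp add: mult_le_0_iff)
qed

lemma zero_if_gauss_integrals_zero: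
  fixes h :: "'a::euclidean_space \<Rightarrow> complex"
  assumes cont: "continuous_on UNIV h"
    and int: "\<And>\<rho>. 1 \<le> \<rho> \<Longrightarrow> integrable lborel (\<lambda>y. h y * gauss 1 z \<rho> y)"
    and zero: "\<And>\<rho>. 1 \<le> \<rho> \<Longrightarrow> (LINT y|lborel. h y * gauss 1 z \<rho> y) = 0"
  shows "h z = 0"
proof -
  let ?w = "\<lambda>y. Re (cnj (h z) * h y)"
  have eq: "?w y * exp (- (\<rho> * norm (y - z))\<^sup>2 / 2) = Re (cnj (h z) * (h y * gauss 1 z \<rho> y))" if "1 \<le> \<rho>" for y \<rho>
  proof -
    have "norm (\<rho> *\<^sub>R (y - z)) = \<rho> * norm (y - z)" using that by simp
    then show ?thesis unfolding gauss_def by (simp add: algebra_simps del: scaleR_diff_right norm_scaleR)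
  qed
  have "?w z \<le> 0"
  proof (rule nonpos_if_gauss_integrals_zero[where w="?w"])
    show "continuous_on UNIV ?w" by (intro continuous_intros cont)
    fix \<rho> :: real assume \<rho>: "1 \<le> \<rho>"
    have i: "integrable lborel (\<lambda>y. cnj (h z) * (h y * gauss 1 z \<rho> y))"
      by (intro integrable_mult_right int \<rho>)
    show "integrable lborel (\<lambda>y. ?w y * exp (- (\<rho> * norm (y - z))\<^sup>2 / 2))"
      unfolding eq[OF \<rho>] by (rule integrable_Re[OF i])
    show "(LINT y|lborel. ?w y * exp (- (\<rho> * norm (y - z))\<^sup>2 / 2)) = 0"
      unfolding eq[OF \<rho>] integral_Re[OF i] integral_mult_right_zero zero[OF \<rho>] by simp
  qed
  then have "(cmod (h z))\<^sup>2 \<le> 0"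
    unfolding cmod_power2 by (simp add: power2_eq_square)
  then show ?thesis by simp
qed

text \<open>Gaussians are Schwartz functions, and they separate continuous functions.\<close>

lemma point_value_eqI:
  assumes g: "continuous_on UNIV g" "represents g u"
  shows "point_value u = g"
  unfolding point_value_def
proof (rule the_equality)
  fix g' assume g': "continuous_on UNIV g' \<and> represents g' u"
  show "g' = g"
  proof
    fix z
    have "g' z - g z = 0"
    proof (rule zero_if_gauss_integrals_zero[where h="\<lambda>y. g' y - g y"])
      show "continuous_on UNIV (\<lambda>y. g' y - g y)" using g g' by (intro continuous_intros) auto
      fix \<rho> :: real assume "1 \<le> \<rho>"
      then have s: "schwartz (gauss 1 z \<rho>)" by (intro schwartz_gauss) auto
      have i: "integrable lborel (\<lambda>y. g' y * gauss 1 z \<rho> y)" "integrable lborel (\<lambda>y. g y * gauss 1 z \<rho> y)"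
        and eq: "distr_of g' (gauss 1 z \<rho>) = distr_of g (gauss 1 z \<rho>)"
        using g g' s by (auto simp: represents_def)
      show "integrable lborel (\<lambda>y. (g' y - g y) * gauss 1 z \<rho> y)"
        unfolding left_diff_distrib by (intro Bochner_Integration.integrable_diff i)
      show "(LINT y|lborel. (g' y - g y) * gauss 1 z \<rho> y) = 0"
        using eq unfolding left_diff_distrib Bochner_Integration.integral_diff[OF i] by (simp add: distr_of_def)
    qed
    then show "g' z = g z" by simp
  qed
qed (use g in auto)

section \<open>Short-time Fourier transforms of integrable functions\<close>

text \<open>Joint continuity is what makes the iterated norms of the short-time Fourier transform measurable.\<close>

lemma continuous_on_fourier:
  fixes f :: "'a::euclidean_space \<Rightarrow> complex"
  assumes f: "integrable lborel f" and h: "continuous_on UNIV h" "\<And>y. cmod (h y) \<le> C"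
  shows "continuous_on UNIV (\<lambda>z. fourier (\<lambda>y. f y * h (y - fst z)) (snd z))"
proof -
  have "continuous (at z) (\<lambda>z. fourier (\<lambda>y. f y * h (y - fst z)) (snd z))" for z :: "'a \<times> 'a"
    unfolding continuous_at_sequentially
  proof (intro allI impI)
    fix Z assume Z: "Z \<longlonglongrightarrow> z"
    have [measurable]: "f \<in> borel_measurable borel" "h \<in> borel_measurable borel"
      using f h by (auto intro: borel_measurable_continuous_onI)
    have "(\<lambda>n. LINT y|lborel. f y * h (y - fst (Z n)) * exp (- \<i> * of_real (y \<bullet> snd (Z n))))
      \<longlonglongrightarrow> (LINT y|lborel. f y * h (y - fst z) * exp (- \<i> * of_real (y \<bullet> snd z)))"
    proof (rule integral_dominated_convergence[where w="\<lambda>y. C * cmod (f y)"])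
      show "integrable lborel (\<lambda>y. C * cmod (f y))" using f by simp
      have "(\<lambda>n. h (y - fst (Z n))) \<longlonglongrightarrow> h (y - fst z)" for y
        using h(1) Z by (intro isCont_tendsto_compose[of _ h] tendsto_intros)
          (auto simp: continuous_on_eq_continuous_at)
      then show "AE y in lborel. (\<lambda>n. f y * h (y - fst (Z n)) * exp (- \<i> * of_real (y \<bullet> snd (Z n))))
        \<longlonglongrightarrow> f y * h (y - fst z) * exp (- \<i> * of_real (y \<bullet> snd z))"
        using Z by (intro AE_I2 tendsto_intros) auto
      show "AE y in lborel. norm (f y * h (y - fst (Z n)) * exp (- \<i> * of_real (y \<bullet> snd (Z n)))) \<le> C * cmod (f y)" for n
        using mult_right_mono[OF h(2) norm_ge_zero] by (intro AE_I2) (simp add: norm_mult mult.commute)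
    qed measurable
    then show "(\<lambda>n. ((\<lambda>z. fourier (\<lambda>y. f y * h (y - fst z)) (snd z)) \<circ> Z) n) \<longlonglongrightarrow> fourier (\<lambda>y. f y * h (y - fst z)) (snd z)"
      unfolding fourier_def o_def by (intro tendsto_intros)
  qed
  then show ?thesis by (simp add: continuous_on_eq_continuous_at)
qed

lemma integrable_mult_bounded:
  fixes f h :: "'a::euclidean_space \<Rightarrow> complex"
  assumes f: "integrable lborel f" and h: "h \<in> borel_measurable borel" "\<And>y. cmod (h y) \<le> C"
  shows "integrable lborel (\<lambda>y. f y * h y)"
proof (rule integrable_dominated)
  show "integrable lborel (\<lambda>y. C * cmod (f y))" using f by simp
  show "norm (f y * h y) \<le> C * cmod (f y)" for y
    using mult_right_mono[OF h(2)[of y] norm_ge_zero[of "f y"]] by (simp add: norm_mult mult.commute)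
qed (use f h in auto)

text \<open>The distributional definition of the short-time Fourier transform agrees with the integral.\<close>

lemma stft_distr_of:
  fixes f :: "'a::euclidean_space \<Rightarrow> complex"
  assumes f: "integrable lborel f" and \<phi>: "schwartz \<phi>"
  shows "stft \<phi> (distr_of f) x \<xi> = fourier (\<lambda>y. f y * cnj (\<phi> (y - x))) \<xi>"
proof -
  let ?h = "\<lambda>y. f y * cnj (\<phi> (y - x))"
  have cs: "schwartz (\<lambda>y. cnj (\<phi> (y - x)))" by (rule schwartz_cnj_translate[OF \<phi>])
  obtain C where C: "\<And>y. cmod (cnj (\<phi> (y - x))) \<le> C"
    using schwartz_bounded[OF cs] by blast
  have h: "integrable lborel ?h"
    by (rule integrable_mult_bounded[OF f schwartz_borel[OF cs] C])
  have cont: "continuous_on UNIV (fourier ?h)"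
    using continuous_on_compose2[OF continuous_on_fourier[OF h, of "\<lambda>_. 1" 1], of UNIV "\<lambda>\<xi>. (0, \<xi>)"]
    by (simp add: continuous_on_Pair)
  have bound: "cmod (fourier ?h \<xi>) \<le> (2 * pi) powr (- real DIM('a) / 2) * (LINT y|lborel. cmod (?h y))" for \<xi>
    using h by (intro fourier_norm_le integrable_norm) auto
  have "represents (fourier ?h) (fourier_distr (mult_distr (\<lambda>y. cnj (\<phi> (y - x))) (distr_of f)))"
    unfolding represents_def
  proof (intro allI impI conjI)
    fix \<psi> :: "'a \<Rightarrow> complex" assume \<psi>: "schwartz \<psi>"
    have "integrable lborel (\<lambda>y. \<psi> y * fourier ?h y)"
      by (rule integrable_mult_bounded[OF schwartz_integrable[OF \<psi>] borel_measurable_continuous_onI[OF cont] bound])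
    then show "integrable lborel (\<lambda>y. fourier ?h y * \<psi> y)" by (simp add: mult.commute)
    show "fourier_distr (mult_distr (\<lambda>y. cnj (\<phi> (y - x))) (distr_of f)) \<psi> = distr_of (fourier ?h) \<psi>"
      using fourier_transpose[OF h schwartz_integrable[OF \<psi>]]
      by (simp add: fourier_distr_def mult_distr_def distr_of_def mult.assoc)
  qed
  then show ?thesis
    unfolding stft_def by (simp add: point_value_eqI[OF cont])
qed

text \<open>If the Fourier transform of \<open>f\<close> vanishes, then \<open>f\<close> is orthogonal to all Fourier transforms of
  modulated Gaussians, that is, to all translated Gaussians.\<close>

lemma fourier_nonzero:
  fixes f :: "'a::euclidean_space \<Rightarrow> complex"
  assumes f: "integrable lborel f" "continuous_on UNIV f" "f z \<noteq> 0"
  shows "\<exists>\<xi>. fourier f \<xi> \<noteq> 0"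
proof (rule ccontr)
  assume "\<not> (\<exists>\<xi>. fourier f \<xi> \<noteq> 0)"
  then have zero: "fourier f \<xi> = 0" for \<xi> by simp
  have "f z = 0"
  proof (rule zero_if_gauss_integrals_zero[OF f(2)])
    fix \<rho> :: real assume \<rho>: "1 \<le> \<rho>"
    have b: "cmod (gauss 1 z \<rho> y) \<le> 1" for y by (simp add: gauss_def)
    show "integrable lborel (\<lambda>y. f y * gauss 1 z \<rho> y)"
      by (rule integrable_mult_bounded[OF f(1) gauss_borel b])
    define \<psi> where "\<psi> = (\<lambda>\<xi>::'a. gauss 1 0 1 ((1 / \<rho>) *\<^sub>R \<xi>) * exp (- \<i> * of_real (\<xi> \<bullet> (- z))))"
    have g: "integrable lborel (\<lambda>\<xi>::'a. gauss 1 0 1 ((1 / \<rho>) *\<^sub>R \<xi>) :: complex)"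
      using lborel_integrable_affine[OF schwartz_integrable[OF schwartz_std_gauss], of "1 / \<rho>" 0] \<rho> by simp
    have \<psi>: "integrable lborel \<psi>"
      unfolding \<psi>_def by (rule integrable_fourier_integrand[OF g])
    have "fourier \<psi> y = of_real (\<rho> powr real DIM('a)) * gauss 1 z \<rho> y" for y
    proof -
      have "fourier \<psi> y = fourier (\<lambda>\<xi>::'a. gauss 1 0 1 ((1 / \<rho>) *\<^sub>R \<xi>)) (y - z)"
      proof -
        have "exp (- \<i> * of_real (\<xi> \<bullet> (- z))) * exp (- \<i> * of_real (\<xi> \<bullet> y)) = exp (- \<i> * of_real (\<xi> \<bullet> (y - z)))" for \<xi>
          by (simp add: exp_add[symmetric] inner_diff_right algebra_simps)
        then show ?thesis by (simp only: fourier_def \<psi>_def mult.assoc)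
      qed
      also have "\<dots> = of_real (\<rho> powr real DIM('a)) * fourier (gauss 1 0 1) ((y - z) /\<^sub>R (1 / \<rho>))"
        using \<rho> by (subst fourier_scaled) (auto simp: powr_divide powr_minus)
      also have "\<dots> = of_real (\<rho> powr real DIM('a)) * gauss 1 z \<rho> y"
        unfolding fourier_std_gauss by (simp add: gauss_def)
      finally show ?thesis .
    qed
    then have "f y * fourier \<psi> y = of_real (\<rho> powr real DIM('a)) * (f y * gauss 1 z \<rho> y)" for y
      by simp
    then have "of_real (\<rho> powr real DIM('a)) * (LINT y|lborel. f y * gauss 1 z \<rho> y) = (LINT y|lborel. f y * fourier \<psi> y)"
      by (simp only: integral_mult_right_zero)
    also have "\<dots> = 0"
      by (simp add: fourier_transpose[OF f(1) \<psi>] zero)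
    finally show "(LINT y|lborel. f y * gauss 1 z \<rho> y) = 0"
      using \<rho> by simp
  qed
  with f(3) show False by simp
qed

lemma tempered_distribution_distr_of:
  fixes f :: "'a::euclidean_space \<Rightarrow> complex"
  assumes f: "integrable lborel f"
  shows "tempered_distribution (distr_of f)"
proof -
  have i: "integrable lborel (\<lambda>y. f y * \<psi> y)" if "schwartz \<psi>" for \<psi>
    using schwartz_bounded[OF that] integrable_mult_bounded[OF f schwartz_borel[OF that]] by blast
  define I where "I = (LINT y|lborel. cmod (f y))"
  have "0 \<le> I" by (simp add: I_def)
  have cont: "cmod (distr_of f \<eta> - distr_of f \<psi>) < \<epsilon>"
    if \<psi>: "schwartz \<psi>" and \<eta>: "schwartz \<eta>" and \<epsilon>: "0 < \<epsilon>"
      and small: "schwartz_seminorm 0 (\<lambda>x. \<eta> x - \<psi> x) < ennreal (\<epsilon> / (I + 1))" for \<psi> \<eta> \<epsilon>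
  proof -
    have le: "cmod (\<eta> y - \<psi> y) \<le> \<epsilon> / (I + 1)" for y
    proof -
      have "ennreal (bracket y ^ 0 * cmod (iter_deriv [] (\<lambda>x. \<eta> x - \<psi> x) y)) \<le> schwartz_seminorm 0 (\<lambda>x. \<eta> x - \<psi> x)"
        unfolding schwartz_seminorm_def by (intro SUP_upper2[of y] SUP_upper2[of "[]"]) auto
      with small have "ennreal (cmod (\<eta> y - \<psi> y)) < ennreal (\<epsilon> / (I + 1))" by simp
      then show ?thesis
        using \<epsilon> \<open>0 \<le> I\<close> by (subst (asm) ennreal_less_iff) auto
    qed
    have i3: "integrable lborel (\<lambda>y. f y * (\<eta> y - \<psi> y))"
      unfolding right_diff_distrib by (intro Bochner_Integration.integrable_diff i \<psi> \<eta>)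
    have "distr_of f \<eta> - distr_of f \<psi> = (LINT y|lborel. f y * (\<eta> y - \<psi> y))"
      unfolding distr_of_def right_diff_distrib using i[OF \<eta>] i[OF \<psi>] by simp
    also have "cmod \<dots> \<le> (LINT y|lborel. cmod (f y * (\<eta> y - \<psi> y)))"
      by (rule integral_norm_bound)
    also have "\<dots> \<le> (LINT y|lborel. cmod (f y) * (\<epsilon> / (I + 1)))"
    proof (rule integral_mono)
      show "integrable lborel (\<lambda>y. cmod (f y) * (\<epsilon> / (I + 1)))" using f by simp
      show "cmod (f y * (\<eta> y - \<psi> y)) \<le> cmod (f y) * (\<epsilon> / (I + 1))" for y
        unfolding norm_mult by (intro mult_left_mono le) simp
    qed (intro integrable_norm i3)
    also have "\<dots> = I * (\<epsilon> / (I + 1))" by (simp add: I_def)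
    also have "\<dots> < \<epsilon>" using \<open>0 \<le> I\<close> \<epsilon> by (simp add: field_simps)
    finally show ?thesis .
  qed
  show ?thesis
    unfolding tempered_distribution_def
  proof (intro conjI allI impI)
    fix \<psi> :: "'a \<Rightarrow> complex" and \<epsilon> :: real assume "schwartz \<psi>" "0 < \<epsilon>"
    then show "\<exists>N. \<exists>\<delta>>0. \<forall>\<eta>. schwartz \<eta> \<longrightarrow> schwartz_seminorm N (\<lambda>x. \<eta> x - \<psi> x) < ennreal \<delta> \<longrightarrow> cmod (distr_of f \<eta> - distr_of f \<psi>) < \<epsilon>"
      using cont \<open>0 \<le> I\<close> by (intro exI[of _ 0] exI[of _ "\<epsilon> / (I + 1)"]) auto
  qed (simp_all add: distr_of_def distrib_left i mult.left_commute)
qed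

section \<open>Norms of Gaussians\<close>

abbreviation weight_le :: "real \<Rightarrow> real \<Rightarrow> real \<Rightarrow> 'a::real_normed_vector \<Rightarrow> nat \<Rightarrow> bool" where
  "weight_le t W \<rho> a k \<equiv> \<forall>x. bracket x powr t \<le> W * bracket (\<rho> *\<^sub>R (x - a)) ^ k"

abbreviation weight_ge :: "real \<Rightarrow> real \<Rightarrow> real \<Rightarrow> 'a::real_normed_vector \<Rightarrow> real \<Rightarrow> bool" where
  "weight_ge t w \<rho> b r \<equiv> \<forall>x. \<rho> * norm (x - b) \<le> r \<longrightarrow> w \<le> bracket x powr t"

abbreviation weighted_stft ::
    "('a::euclidean_space \<Rightarrow> complex) \<Rightarrow> real \<Rightarrow> real \<Rightarrow> ('a \<Rightarrow> complex) \<Rightarrow> 'a \<Rightarrow> 'a \<Rightarrow> real" where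
  "weighted_stft \<phi> s t f x \<xi> \<equiv> cmod (stft \<phi> (distr_of f) x \<xi>) * bracket x powr t * bracket \<xi> powr s"

text \<open>The weight is controlled through a polynomial bound relative to its size \<open>W\<close> near \<open>a\<close>. The constant may
  depend on the degree \<open>k\<close> but not on \<open>W\<close>, the center or the width.\<close>

definition gauss_upper ::
    "(('a::euclidean_space \<Rightarrow> complex) \<Rightarrow> 'u) \<Rightarrow> 'u set \<Rightarrow> ('u \<Rightarrow> ennreal) \<Rightarrow> ennreal \<Rightarrow> real \<Rightarrow> bool" where
  "gauss_upper \<iota> X N p t \<longleftrightarrow> (\<forall>k. \<exists>C>0. \<forall>c\<ge>0. \<forall>a \<rho> W. 0 < \<rho> \<longrightarrow> \<rho> \<le> 1 \<longrightarrow> 0 < W \<longrightarrow>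
    (weight_le t W \<rho> a k) \<longrightarrow>
    \<iota> (gauss c a \<rho>) \<in> X \<and>
    N (\<iota> (gauss c a \<rho>)) \<le> ennreal (c * (C * W * \<rho> powr (- real DIM('a) * enn2real (1 / p)))))"

text \<open>Here \<open>w\<close> bounds the weight from below only where the Gaussian is at least \<open>exp (- 1 / 2)\<close> times its
  height. Lower bounds are needed for large widths only, whence \<open>\<rho>\<^sub>0\<close>.\<close>

definition gauss_lower ::
    "(('a::euclidean_space \<Rightarrow> complex) \<Rightarrow> 'u) \<Rightarrow> ('u \<Rightarrow> ennreal) \<Rightarrow> ennreal \<Rightarrow> real \<Rightarrow> bool" where
  "gauss_lower \<iota> N p t \<longleftrightarrow> (\<exists>\<kappa>>0. \<exists>\<rho>\<^sub>0. 0 < \<rho>\<^sub>0 \<and> \<rho>\<^sub>0 \<le> 1 \<and> (\<forall>c\<ge>0. \<forall>b \<rho> w. 0 < \<rho> \<longrightarrow> \<rho> \<le> \<rho>\<^sub>0 \<longrightarrow> 0 \<le> w \<longrightarrow>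
    (weight_ge t w \<rho> b 1) \<longrightarrow>
    ennreal (c * (\<kappa> * w * \<rho> powr (- real DIM('a) * enn2real (1 / p)))) \<le> N (\<iota> (gauss c b \<rho>))))"

lemma continuous_on_bracket_powr [continuous_intros]:
  "continuous_on S f \<Longrightarrow> continuous_on S (\<lambda>x. bracket (f x) powr t)"
  by (intro continuous_on_powr continuous_intros) (auto simp: less_imp_neq[OF bracket_pos, symmetric])

lemma continuous_on_gauss: "continuous_on S (gauss c a \<rho>)"
  unfolding gauss_def by (intro continuous_intros) auto

lemma gauss_bound:
  "\<exists>C>0. \<forall>c\<ge>0. \<forall>(a::'a::euclidean_space) \<rho> y. 0 < \<rho> \<longrightarrow> \<rho> \<le> 1 \<longrightarrow>
    cmod (gauss c a \<rho> y) \<le> c * (C * decay m (\<rho> *\<^sub>R (y - a)))"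
proof -
  obtain C where C: "0 \<le> C" "\<And>c a \<rho> (y::'a). 0 \<le> c \<Longrightarrow> 0 < \<rho> \<Longrightarrow> \<rho> \<le> 1 \<Longrightarrow> cmod (gauss c a \<rho> y) \<le> c * (C * decay m (\<rho> *\<^sub>R (y - a)))"
    using gauss_derivative_bound[of 0 m, where 'a='a] by (metis iter_deriv.simps(1) le_numeral_extra(3) list.size(3) lists.Nil)
  have "cmod (gauss c a \<rho> y) \<le> c * ((C + 1) * decay m (\<rho> *\<^sub>R (y - a)))"
    if "0 \<le> c" "0 < \<rho>" "\<rho> \<le> 1" for c a \<rho> and y :: 'a
    using C(2)[OF that, of a y]
      mult_left_mono[OF mult_right_mono[of C "C + 1" "decay m (\<rho> *\<^sub>R (y - a))"] that(1)] by simp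
  with C(1) show ?thesis
    by (intro exI[of _ "C + 1"]) simp
qed

lemma cmod_gauss_ge:
  assumes "0 \<le> c" "0 < \<rho>" "\<rho> * norm (x - b) \<le> 1"
  shows "c * exp (- 1 / 2) \<le> cmod (gauss c b \<rho> x)"
proof -
  have "(norm (\<rho> *\<^sub>R (x - b)))\<^sup>2 \<le> 1\<^sup>2"
    using assms by (intro power_mono) auto
  then have "exp (- 1 / 2) \<le> exp (- (norm (\<rho> *\<^sub>R (x - b)))\<^sup>2 / 2)" by simp
  with assms(1) show ?thesis
    unfolding gauss_def norm_of_real abs_mult by (simp add: mult_left_mono)
qed

lemma gauss_upper_Lp:
  fixes p :: ennreal
  assumes p: "1 \<le> p"
  shows "gauss_upper (\<lambda>f :: 'a::euclidean_space \<Rightarrow> complex. f) (wLp p t) (wLp_norm p t) p t"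
  unfolding gauss_upper_def
proof
  fix k
  let ?m = "2 * DIM('a)" and ?e = "- real DIM('a) * enn2real (1 / p)"
  obtain C where C0: "0 < C" and bound: "\<forall>c\<ge>0. \<forall>(a::'a) \<rho> y. 0 < \<rho> \<longrightarrow> \<rho> \<le> 1 \<longrightarrow>
      cmod (gauss c a \<rho> y) \<le> c * (C * decay (?m + k) (\<rho> *\<^sub>R (y - a)))"
    using gauss_bound[of "?m + k", where 'a='a] by blast
  note C = C0 bound[rule_format]
  obtain D where D: "0 < D" "\<And>(a::'a) \<rho>. 0 < \<rho> \<Longrightarrow>
      Lp_enorm p (\<lambda>x. ennreal (decay ?m (\<rho> *\<^sub>R (x - a)))) \<le> ennreal (D * \<rho> powr ?e)"
    using Lp_enorm_decay_le[OF p, where 'a='a] by blast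
  have main: "gauss c a \<rho> \<in> wLp p t \<and> wLp_norm p t (gauss c a \<rho>) \<le> ennreal (c * ((C * D) * W * \<rho> powr ?e))"
    if c: "0 \<le> c" and \<rho>: "0 < \<rho>" "\<rho> \<le> 1" and W: "0 < W" "\<And>x. bracket x powr t \<le> W * bracket (\<rho> *\<^sub>R (x - a)) ^ k"
    for c \<rho> W and a :: 'a
  proof -
    let ?F = "\<lambda>x. cmod (gauss c a \<rho> x) * bracket x powr t"
    have le: "?F x \<le> (c * C * W) * decay ?m (\<rho> *\<^sub>R (x - a))" for x
    proof -
      have "?F x \<le> (c * (C * decay (?m + k) (\<rho> *\<^sub>R (x - a)))) * (W * bracket (\<rho> *\<^sub>R (x - a)) ^ k)"
        using c C(1) by (intro mult_mono C(2) W c \<rho>) auto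
      also have "\<dots> = (c * C * W) * decay ?m (\<rho> *\<^sub>R (x - a)) * (decay k (\<rho> *\<^sub>R (x - a)) * bracket (\<rho> *\<^sub>R (x - a)) ^ k)"
        by (simp only: decay_add ac_simps)
      finally show ?thesis by (simp only: decay_times_bracket mult_1_right)
    qed
    have "?F \<in> borel_measurable borel"
      by (intro borel_measurable_continuous_onI continuous_intros continuous_on_gauss)
    then have "Lp_enorm p (\<lambda>x. ennreal (?F x)) \<le> Lp_enorm p (\<lambda>x. ennreal (c * C * W) * ennreal (decay ?m (\<rho> *\<^sub>R (x - a))))"
      using le c C(1) W(1)
      by (intro Lp_enorm_mono p measurable_completion) (auto simp: ennreal_mult[symmetric] intro!: ennreal_leI)
    also have "\<dots> = ennreal (c * C * W) * Lp_enorm p (\<lambda>x. ennreal (decay ?m (\<rho> *\<^sub>R (x - a))))"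
      by (intro Lp_enorm_cmult p) auto
    also have "\<dots> \<le> ennreal (c * C * W) * ennreal (D * \<rho> powr ?e)"
      by (intro mult_left_mono D \<rho>) auto
    also have "\<dots> = ennreal (c * ((C * D) * W * \<rho> powr ?e))"
      using c C D W by (simp add: ennreal_mult[symmetric] ac_simps)
    finally have le: "wLp_norm p t (gauss c a \<rho>) \<le> ennreal (c * ((C * D) * W * \<rho> powr ?e))"
      by (simp add: wLp_norm_def)
    moreover have "gauss c a \<rho> \<in> borel_measurable lebesgue"
      by (intro measurable_completion) simp
    ultimately show ?thesis
      by (auto simp: wLp_def intro: le_less_trans)
  qed
  show "\<exists>C>0. \<forall>c\<ge>0. \<forall>(a::'a) \<rho> W. 0 < \<rho> \<longrightarrow> \<rho> \<le> 1 \<longrightarrow> 0 < W \<longrightarrow>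
    (weight_le t W \<rho> a k) \<longrightarrow>
    gauss c a \<rho> \<in> wLp p t \<and> wLp_norm p t (gauss c a \<rho>) \<le> ennreal (c * (C * W * \<rho> powr ?e))"
    using C(1) D(1) main by (intro exI[of _ "C * D"]) auto
qed

lemma borel_measurable_indicator_cball_affine:
  "(\<lambda>x::'a::euclidean_space. indicator (cball 0 1) (\<rho> *\<^sub>R (x - b)) :: ennreal) \<in> borel_measurable borel"
proof (rule measurable_compose[where N=borel and g="indicator (cball 0 1)"])
  show "(\<lambda>x. \<rho> *\<^sub>R (x - b)) \<in> borel_measurable borel" by measurable
  show "(indicator (cball 0 1) :: 'a \<Rightarrow> ennreal) \<in> borel_measurable borel"
    by (intro borel_measurable_indicator) auto
qed

lemma gauss_lower_Lp:
  fixes p :: ennreal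
  assumes p: "1 \<le> p"
  shows "gauss_lower (\<lambda>f :: 'a::euclidean_space \<Rightarrow> complex. f) (wLp_norm p t) p t"
proof -
  let ?e = "- real DIM('a) * enn2real (1 / p)"
  obtain \<kappa> where \<kappa>: "0 < \<kappa>" "\<And>(b::'a) \<rho>. 0 < \<rho> \<Longrightarrow>
      ennreal (\<kappa> * \<rho> powr ?e) \<le> Lp_enorm p (\<lambda>x. indicator (cball 0 1) (\<rho> *\<^sub>R (x - b)))"
    using Lp_enorm_ball_ge[OF p] by blast
  have main: "ennreal (c * ((exp (- 1 / 2) * \<kappa>) * w * \<rho> powr ?e)) \<le> wLp_norm p t (gauss c b \<rho>)"
    if c: "0 \<le> c" and \<rho>: "0 < \<rho>" and w: "0 \<le> w" "\<And>x. \<rho> * norm (x - b) \<le> 1 \<Longrightarrow> w \<le> bracket x powr t" for c \<rho> w and b :: 'a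
  proof -
    note ind = borel_measurable_indicator_cball_affine[of \<rho> b]
    have "ennreal (c * ((exp (- 1 / 2) * \<kappa>) * w * \<rho> powr ?e)) = ennreal (c * exp (- 1 / 2) * w) * ennreal (\<kappa> * \<rho> powr ?e)"
      using c w \<kappa> by (simp add: ennreal_mult[symmetric] ac_simps)
    also have "\<dots> \<le> ennreal (c * exp (- 1 / 2) * w) * Lp_enorm p (\<lambda>x. indicator (cball 0 1) (\<rho> *\<^sub>R (x - b)))"
      by (intro mult_left_mono \<kappa> \<rho>) auto
    also have "\<dots> = Lp_enorm p (\<lambda>x. ennreal (c * exp (- 1 / 2) * w) * indicator (cball 0 1) (\<rho> *\<^sub>R (x - b)))"
      by (intro Lp_enorm_cmult[symmetric] p ind) auto
    also have "\<dots> \<le> wLp_norm p t (gauss c b \<rho>)"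
      unfolding wLp_norm_def
    proof (intro Lp_enorm_mono p)
      show "(\<lambda>x. ennreal (c * exp (- 1 / 2) * w) * indicator (cball 0 1) (\<rho> *\<^sub>R (x - b))) \<in> borel_measurable lebesgue"
        using ind by (intro measurable_completion) simp
      fix x
      show "ennreal (c * exp (- 1 / 2) * w) * indicator (cball 0 1) (\<rho> *\<^sub>R (x - b)) \<le> ennreal (cmod (gauss c b \<rho> x) * bracket x powr t)"
      proof (cases "\<rho> * norm (x - b) \<le> 1")
        case True
        then have "c * exp (- 1 / 2) * w \<le> cmod (gauss c b \<rho> x) * bracket x powr t"
          using w c \<rho> by (intro mult_mono cmod_gauss_ge) auto
        then show ?thesis
          by (auto simp: indicator_def ennreal_leI)
      next
        case False
        then have "\<rho> *\<^sub>R (x - b) \<notin> cball 0 1" using \<rho> by simp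
        then have "indicator (cball 0 1) (\<rho> *\<^sub>R (x - b)) = (0::ennreal)" by (rule indicator_simps(2))
        then show ?thesis by (simp only: mult_zero_right zero_le)
      qed
    qed
    finally show ?thesis .
  qed
  show ?thesis
    unfolding gauss_lower_def using \<kappa>(1) main
    by (intro exI[of _ "exp (- 1 / 2) * \<kappa>"]) (auto intro!: exI[of _ "1::real"])
qed

lemma stft_gauss_continuous:
  assumes \<phi>: "schwartz (\<phi> :: 'a::euclidean_space \<Rightarrow> complex)" and \<rho>: "0 < \<rho>"
  shows "continuous_on UNIV (\<lambda>z. weighted_stft \<phi> s t (gauss c a \<rho>) (fst z) (snd z))"
proof -
  have f: "integrable lborel (gauss c a \<rho>)"
    by (intro schwartz_integrable schwartz_gauss \<rho>)
  obtain C where C: "\<And>y. cmod (cnj (\<phi> y)) \<le> C"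
    using schwartz_bounded[OF \<phi>] by auto
  have "continuous_on UNIV (\<lambda>y. cnj (\<phi> y))"
    by (intro continuous_intros schwartz_continuous \<phi>)
  from continuous_on_fourier[OF f this C] show ?thesis
    unfolding stft_distr_of[OF f \<phi>] by (intro continuous_intros)
qed

text \<open>Derivatives of Gaussians of width \<open>1 / \<rho> \<ge> 1\<close> are uniformly bounded by the decay of the Gaussian, so
  any decay in \<open>\<xi>\<close> is available, and it absorbs the weight \<open>bracket \<xi> powr s\<close>. The decay of the
  window keeps the short-time Fourier transform near the Gaussian.\<close>

lemma stft_gauss_le:
  fixes \<phi> :: "'a::euclidean_space \<Rightarrow> complex"
  assumes \<phi>: "schwartz \<phi>"
  shows "\<exists>C>0. \<forall>c\<ge>0. \<forall>a \<rho> W. 0 < \<rho> \<longrightarrow> \<rho> \<le> 1 \<longrightarrow> 0 < W \<longrightarrow>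
    (weight_le t W \<rho> a k) \<longrightarrow>
    (\<forall>x \<xi>. weighted_stft \<phi> s t (gauss c a \<rho>) x \<xi>
      \<le> (c * C * W) * (decay (2 * DIM('a)) (\<rho> *\<^sub>R (x - a)) * decay (2 * DIM('a)) \<xi>))"
proof -
  let ?d = "2 * DIM('a)"
  define j where "j = nat \<lceil>\<bar>s\<bar>\<rceil>"
  define N where "N = ?d + j"
  \<comment> \<open>The decay of order \<open>m\<close> in \<open>x\<close> pays for the weight, with \<open>?d\<close> left for integrability; likewise \<open>N\<close> in \<open>\<xi>\<close>.\<close>
  define m where "m = ?d + k"
  let ?S = "{bs \<in> lists (Basis::'a set). length bs \<le> N}"
  obtain D1 where D1: "0 \<le> D1" "\<forall>bs\<in>lists Basis. length bs \<le> N \<longrightarrow> (\<forall>c\<ge>0. \<forall>(a::'a) \<rho> y. 0 < \<rho> \<longrightarrow> \<rho> \<le> 1 \<longrightarrow>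
      cmod (iter_deriv bs (gauss c a \<rho>) y) \<le> c * (D1 * decay m (\<rho> *\<^sub>R (y - a))))"
    using gauss_derivative_bound by blast
  obtain D2 where D2: "0 \<le> D2" "\<forall>bs\<in>lists Basis. length bs \<le> N \<longrightarrow> (\<forall>y. cmod (iter_deriv bs \<phi> y) \<le> D2 * decay (m + ?d) y)"
    using schwartz_decay_uniform[OF \<phi>] by blast
  note D = D1(1) D2(1)
  obtain c0 where c0: "0 \<le> c0" and raw: "\<forall>(f::'a \<Rightarrow> complex) h A B C x0 \<xi>. schwartz f \<longrightarrow> schwartz h \<longrightarrow>
    (\<forall>bs\<in>lists Basis. length bs \<le> N \<longrightarrow> (\<forall>y. cmod (iter_deriv bs f y) \<le> A y \<and> cmod (iter_deriv bs h y) \<le> B y)) \<longrightarrow>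
    (\<forall>y. A y * B y \<le> C * decay ?d (y - x0)) \<longrightarrow> (\<lambda>y. A y * B y) \<in> borel_measurable borel \<longrightarrow>
    cmod (fourier (\<lambda>y. f y * h y) \<xi>) \<le> c0 * (LINT y|lborel. A y * B y) * decay N \<xi>"
    using fourier_product_decay[of N, where 'a='a] by blast
  have product: "cmod (fourier (\<lambda>y. f y * h y) \<xi>) \<le> c0 * (LINT y|lborel. A y * B y) * decay N \<xi>"
    if "schwartz f" "schwartz h"
      "\<And>bs y. bs \<in> ?S \<Longrightarrow> cmod (iter_deriv bs f y) \<le> A y \<and> cmod (iter_deriv bs h y) \<le> B y"
      "\<And>y. A y * B y \<le> C * decay ?d (y - x0)" "(\<lambda>y. A y * B y) \<in> borel_measurable borel"
    for f h :: "'a \<Rightarrow> complex" and A B C x0 \<xi>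
    using raw[rule_format, of f h A B C x0 \<xi>] that by auto
  define I where "I = (LINT y|lborel. decay ?d (y::'a))"
  have "0 \<le> I" by (simp add: I_def)
  define E where "E = c0 * (D1 * D2 * 2 ^ m * I)"
  have "0 \<le> E" using c0 D \<open>0 \<le> I\<close> by (simp add: E_def)
  have stft_le: "cmod (stft \<phi> (distr_of (gauss c a \<rho>)) x \<xi>) \<le> c * (E * decay m (\<rho> *\<^sub>R (x - a)) * decay N \<xi>)"
    if c: "0 \<le> c" and \<rho>: "0 < \<rho>" "\<rho> \<le> 1" for c \<rho> x \<xi> and a :: 'a
  proof -
    define A where "A y = c * (D1 * decay m (\<rho> *\<^sub>R (y - a)))" for y
    define B where "B y = D2 * decay (m + ?d) (y - x)" for y
    define K where "K = c * (D1 * D2 * 2 ^ m * decay m (\<rho> *\<^sub>R (x - a)))"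
    have "0 \<le> K" using c D by (simp add: K_def)
    have AB: "A y * B y \<le> K * decay ?d (y - x)" for y
    proof -
      have "decay m (\<rho> *\<^sub>R (y - a)) = decay m (\<rho> *\<^sub>R (x - a) + \<rho> *\<^sub>R (y - x))"
        by (simp add: algebra_simps)
      also have "\<dots> \<le> 2 ^ m * decay m (\<rho> *\<^sub>R (x - a)) * bracket (\<rho> *\<^sub>R (y - x)) ^ m"
        by (rule decay_add_le)
      also have "\<dots> \<le> 2 ^ m * decay m (\<rho> *\<^sub>R (x - a)) * bracket (y - x) ^ m"
        using \<rho> by (intro mult_left_mono power_mono bracket_mono) (auto intro: mult_left_le_one_le)
      finally have "A y * B y \<le> c * (D1 * (2 ^ m * decay m (\<rho> *\<^sub>R (x - a)) * bracket (y - x) ^ m)) * (D2 * decay (m + ?d) (y - x))"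
        unfolding A_def B_def using c D by (intro mult_right_mono mult_left_mono) auto
      also have "\<dots> = K * decay ?d (y - x) * (decay m (y - x) * bracket (y - x) ^ m)"
        by (simp only: K_def decay_add ac_simps)
      finally show ?thesis by (simp only: decay_times_bracket mult_1_right)
    qed
    have meas: "(\<lambda>y. A y * B y) \<in> borel_measurable borel"
      unfolding A_def B_def by (intro borel_measurable_continuous_onI continuous_intros)
    have AB0: "0 \<le> A y * B y" for y using c D by (simp add: A_def B_def)
    have iD: "integrable lborel (\<lambda>y. K * decay ?d (y - x))"
      using lborel_integrable_translate[OF integrable_decay[of ?d], of x] by simp
    have "cmod (fourier (\<lambda>y. gauss c a \<rho> y * cnj (\<phi> (y - x))) \<xi>) \<le> c0 * (LINT y|lborel. A y * B y) * decay N \<xi>"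
    proof (rule product[OF _ _ _ AB meas])
      show "schwartz (gauss c a \<rho>)" by (rule schwartz_gauss[OF \<rho>(1)])
      show "schwartz (\<lambda>y. cnj (\<phi> (y - x)))" by (rule schwartz_cnj_translate[OF \<phi>])
      fix bs y assume bs: "bs \<in> ?S"
      have 1: "cmod (iter_deriv bs (gauss c a \<rho>) y) \<le> A y"
        unfolding A_def using D1(2) bs c \<rho> by blast
      have sm: "smooth \<phi>" "schwartz (\<lambda>y. \<phi> (y - x))" "bs \<in> lists Basis"
        using \<phi> schwartz_affine[OF \<phi>, of 1 1 x] bs by (auto simp: schwartz_def)
      have "cmod (iter_deriv bs (\<lambda>y. cnj (\<phi> (y - x))) y) = cmod (iter_deriv bs (\<lambda>y. \<phi> (y - x)) y)"
        using sm(2) by (subst iter_deriv_cnj(1)[OF _ sm(3)]) (auto simp: schwartz_def)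
      also have "\<dots> = cmod (iter_deriv bs \<phi> (y - x))"
        using iter_deriv_affine(1)[OF sm(1,3), of 1 1 x] by simp
      also have "\<dots> \<le> B y"
        unfolding B_def using D2(2) bs by blast
      finally show "cmod (iter_deriv bs (gauss c a \<rho>) y) \<le> A y \<and> cmod (iter_deriv bs (\<lambda>y. cnj (\<phi> (y - x))) y) \<le> B y"
        using 1 by blast
    qed
    also have "(LINT y|lborel. A y * B y) \<le> (LINT y|lborel. K * decay ?d (y - x))"
    proof (rule integral_mono[OF _ iD AB])
      show "integrable lborel (\<lambda>y. A y * B y)"
        using AB AB0 by (intro integrable_dominated[OF iD meas]) simp
    qed
    also have "\<dots> = K * I"
      using lborel_integral_translate[of "decay ?d" x] by (simp add: I_def)
    finally have "cmod (fourier (\<lambda>y. gauss c a \<rho> y * cnj (\<phi> (y - x))) \<xi>) \<le> c0 * (K * I) * decay N \<xi>"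
      using c0 by (simp add: mult_left_mono mult_right_mono)
    also have "\<dots> = c * (E * decay m (\<rho> *\<^sub>R (x - a)) * decay N \<xi>)"
      by (simp only: K_def E_def ac_simps)
    finally show ?thesis
      by (subst stft_distr_of[OF schwartz_integrable[OF schwartz_gauss[OF \<rho>(1)]] \<phi>])
  qed
  have weight: "bracket \<xi> powr s \<le> bracket \<xi> ^ j" for \<xi> :: 'a
  proof -
    have "bracket \<xi> powr s \<le> bracket \<xi> powr real j"
      using bracket_ge_1[of \<xi>] by (intro powr_mono) (auto simp: j_def intro: order_trans[OF abs_ge_self] of_nat_ceiling)
    then show ?thesis by (simp add: powr_realpow)
  qed
  have "weighted_stft \<phi> s t (gauss c a \<rho>) x \<xi>
      \<le> (c * (E + 1) * W) * (decay ?d (\<rho> *\<^sub>R (x - a)) * decay ?d \<xi>)"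
    if c: "0 \<le> c" and \<rho>: "0 < \<rho>" "\<rho> \<le> 1" and W: "0 < W" "\<And>x. bracket x powr t \<le> W * bracket (\<rho> *\<^sub>R (x - a)) ^ k"
    for c \<rho> W x \<xi> and a :: 'a
  proof -
    have "weighted_stft \<phi> s t (gauss c a \<rho>) x \<xi>
      \<le> (c * (E * decay m (\<rho> *\<^sub>R (x - a)) * decay N \<xi>)) * (W * bracket (\<rho> *\<^sub>R (x - a)) ^ k) * bracket \<xi> ^ j"
      using c \<open>0 \<le> E\<close> W(1) by (intro mult_mono stft_le W weight c \<rho>) auto
    also have "\<dots> = (c * E * W) * (decay ?d (\<rho> *\<^sub>R (x - a)) * decay ?d \<xi>)
        * (decay k (\<rho> *\<^sub>R (x - a)) * bracket (\<rho> *\<^sub>R (x - a)) ^ k) * (decay j \<xi> * bracket \<xi> ^ j)"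
      by (simp only: m_def N_def decay_add ac_simps)
    also have "\<dots> = (c * E * W) * (decay ?d (\<rho> *\<^sub>R (x - a)) * decay ?d \<xi>)"
      by (simp only: decay_times_bracket mult_1_right)
    also have "\<dots> \<le> (c * (E + 1) * W) * (decay ?d (\<rho> *\<^sub>R (x - a)) * decay ?d \<xi>)"
      using c W(1) by (intro mult_right_mono mult_left_mono) auto
    finally show ?thesis .
  qed
  with \<open>0 \<le> E\<close> show ?thesis
    by (intro exI[of _ "E + 1"]) auto
qed

text \<open>The derivative \<open>- u * exp (- u\<^sup>2 / 2)\<close> is at most 1 in absolute value because
  \<open>\<bar>u\<bar> \<le> 1 + u\<^sup>2 / 2 \<le> exp (u\<^sup>2 / 2)\<close>.\<close>

lemma gaussian_lipschitz: "\<bar>exp (- r\<^sup>2 / 2) - exp (- s\<^sup>2 / 2)\<bar> \<le> \<bar>r - s\<bar>" for r s :: real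
proof -
  have "norm (exp (- r\<^sup>2 / 2) - exp (- s\<^sup>2 / 2)) \<le> 1 * norm (r - s)"
  proof (rule field_differentiable_bound[where S=UNIV and f'="\<lambda>u. - u * exp (- u\<^sup>2 / 2)"])
    fix u :: real
    show "((\<lambda>u. exp (- u\<^sup>2 / 2)) has_field_derivative - u * exp (- u\<^sup>2 / 2)) (at u within UNIV)"
      by (auto intro!: derivative_eq_intros)
    have "0 \<le> (\<bar>u\<bar> - 1)\<^sup>2" by simp
    then have "\<bar>u\<bar> \<le> 1 + u\<^sup>2 / 2" by (simp add: power2_diff)
    also have "\<dots> \<le> exp (u\<^sup>2 / 2)" by (rule exp_ge_add_one_self)
    finally show "norm (- u * exp (- u\<^sup>2 / 2)) \<le> 1"
      by (simp add: abs_mult exp_minus field_simps)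
  qed auto
  then show ?thesis by simp
qed

lemma gauss_lipschitz:
  assumes "0 \<le> c" "0 \<le> \<rho>"
  shows "cmod (gauss c b \<rho> (x + z) - gauss c b \<rho> x) \<le> c * (\<rho> * norm z)"
proof -
  have "\<bar>norm (\<rho> *\<^sub>R (x + z - b)) - norm (\<rho> *\<^sub>R (x - b))\<bar> \<le> norm (\<rho> *\<^sub>R (x + z - b) - \<rho> *\<^sub>R (x - b))"
    by (rule norm_triangle_ineq3)
  also have "\<dots> = \<rho> * norm z"
    using assms by (simp add: scaleR_diff_right[symmetric] del: scaleR_diff_right)
  finally have "\<bar>exp (- (norm (\<rho> *\<^sub>R (x + z - b)))\<^sup>2 / 2) - exp (- (norm (\<rho> *\<^sub>R (x - b)))\<^sup>2 / 2)\<bar> \<le> \<rho> * norm z"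
    using gaussian_lipschitz by (rule order_trans[rotated])
  then have "c * \<bar>exp (- (norm (\<rho> *\<^sub>R (x + z - b)))\<^sup>2 / 2) - exp (- (norm (\<rho> *\<^sub>R (x - b)))\<^sup>2 / 2)\<bar> \<le> c * (\<rho> * norm z)"
    using assms by (intro mult_left_mono) auto
  moreover have "cmod (gauss c b \<rho> (x + z) - gauss c b \<rho> x)
      = c * \<bar>exp (- (norm (\<rho> *\<^sub>R (x + z - b)))\<^sup>2 / 2) - exp (- (norm (\<rho> *\<^sub>R (x - b)))\<^sup>2 / 2)\<bar>"
    unfolding gauss_def of_real_diff[symmetric] norm_of_real right_diff_distrib[symmetric] abs_mult using assms by simp
  ultimately show ?thesis by simp
qed

text \<open>A flat Gaussian is almost constant on the essential support of the window, so its short-time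
  Fourier transform at \<open>x\<close> is close to its value at \<open>x\<close> times the Fourier transform of the conjugate
  window; the latter does not vanish identically.\<close>

lemma stft_gauss_ge:
  fixes \<phi> :: "'a::euclidean_space \<Rightarrow> complex"
  assumes \<phi>: "schwartz \<phi>" "\<phi> \<noteq> (\<lambda>x. 0)"
  shows "\<exists>\<kappa>>0. \<exists>\<rho>\<^sub>0 \<xi>\<^sub>0. \<exists>\<sigma>>0. 0 < \<rho>\<^sub>0 \<and> \<rho>\<^sub>0 \<le> 1 \<and> (\<forall>c\<ge>0. \<forall>b \<rho> w. 0 < \<rho> \<longrightarrow> \<rho> \<le> \<rho>\<^sub>0 \<longrightarrow> 0 \<le> w \<longrightarrow>
    (weight_ge t w \<rho> b 1) \<longrightarrow>
    (\<forall>x \<xi>. ennreal (c * \<kappa> * w) * (indicator (cball 0 1) (\<rho> *\<^sub>R (x - b)) * indicator (cball 0 1) (\<sigma> *\<^sub>R (\<xi> - \<xi>\<^sub>0)))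
      \<le> ennreal (weighted_stft \<phi> s t (gauss c b \<rho>) x \<xi>)))"
proof -
  let ?\<Phi> = "fourier (\<lambda>z. cnj (\<phi> z))" and ?d = "2 * DIM('a)" and ?K = "(2 * pi) powr (- real DIM('a) / 2)"
  have cs: "schwartz (\<lambda>z. cnj (\<phi> z))" using schwartz_cnj_translate[OF \<phi>(1), of 0] by simp
  have int: "integrable lborel (\<lambda>z. cnj (\<phi> z))" by (rule schwartz_integrable[OF cs])
  obtain z where "\<phi> z \<noteq> 0" using \<phi>(2) by auto
  then obtain \<xi>\<^sub>0 where \<xi>\<^sub>0: "?\<Phi> \<xi>\<^sub>0 \<noteq> 0"
    using fourier_nonzero[OF int schwartz_continuous[OF cs], of z] by auto
  define m where "m = cmod (?\<Phi> \<xi>\<^sub>0) / 2"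
  have m: "0 < m" using \<xi>\<^sub>0 by (simp add: m_def)
  have "continuous_on UNIV (\<lambda>\<xi>. cmod (?\<Phi> \<xi>))"
    using continuous_on_compose2[OF continuous_on_fourier[OF int, of "\<lambda>_. 1" 1], of UNIV "\<lambda>\<xi>. (0, \<xi>)"]
    by (intro continuous_intros) (simp add: continuous_on_Pair)
  then have "isCont (\<lambda>\<xi>. cmod (?\<Phi> \<xi>)) \<xi>\<^sub>0" by (simp add: continuous_on_eq_continuous_at)
  then obtain r' where r': "0 < r'" "\<And>\<xi>. dist \<xi> \<xi>\<^sub>0 < r' \<Longrightarrow> dist (cmod (?\<Phi> \<xi>)) (cmod (?\<Phi> \<xi>\<^sub>0)) < m"
    using m unfolding continuous_at_eps_delta by blast
  define \<sigma> where "\<sigma> = 2 / r'"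
  have \<sigma>: "0 < \<sigma>" using r'(1) by (simp add: \<sigma>_def)
  have \<Phi>_ge: "m \<le> cmod (?\<Phi> \<xi>)" "norm (\<xi> - \<xi>\<^sub>0) \<le> 1 / \<sigma>" if "\<sigma> * norm (\<xi> - \<xi>\<^sub>0) \<le> 1" for \<xi>
  proof -
    show "norm (\<xi> - \<xi>\<^sub>0) \<le> 1 / \<sigma>" using that \<sigma> by (simp add: field_simps)
    then have "dist \<xi> \<xi>\<^sub>0 < r'" using r'(1) by (simp add: \<sigma>_def dist_norm)
    from r'(2)[OF this] show "m \<le> cmod (?\<Phi> \<xi>)" unfolding dist_real_def m_def by linarith
  qed
  \<comment> \<open>One power more than integrability requires pays for the factor \<open>norm z\<close> in the Lipschitz bound.\<close>
  obtain Cp where Cp: "0 \<le> Cp" "\<And>y. cmod (\<phi> y) \<le> Cp * decay (?d + 1) y"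
    using schwartz_decay[OF \<phi>(1), of "[]" "?d + 1"] by auto
  define J where "J = (LINT z|lborel. Cp * decay ?d (z::'a))"
  have "0 \<le> J" using Cp by (simp add: J_def)
  have iJ: "integrable lborel (\<lambda>z. Cp * decay ?d (z::'a))" using integrable_decay[of ?d, where 'a='a] by simp
  have moment: "norm z * cmod (\<phi> z) \<le> Cp * decay ?d z" for z
  proof -
    have "norm z * cmod (\<phi> z) \<le> bracket z ^ 1 * (Cp * decay (?d + 1) z)"
      using Cp norm_le_bracket[of z] by (intro mult_mono) auto
    also have "\<dots> = Cp * decay ?d z * (decay 1 z * bracket z ^ 1)"
      by (simp only: decay_add ac_simps)
    finally show ?thesis by (simp only: decay_times_bracket mult_1_right)
  qed
  define e where "e = exp (- 1 / 2 :: real)"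
  have e: "0 < e" by (simp add: e_def)
  \<comment> \<open>For \<open>\<rho> \<le> \<rho>\<^sub>0\<close> the error of freezing the Gaussian is at most half of the main term.\<close>
  define \<rho>\<^sub>0 where "\<rho>\<^sub>0 = min 1 (e * m / (2 * (?K * J + 1)))"
  have KJ: "0 < ?K * J + 1" using \<open>0 \<le> J\<close> by (intro add_nonneg_pos mult_nonneg_nonneg) auto
  have \<rho>\<^sub>0: "0 < \<rho>\<^sub>0" "\<rho>\<^sub>0 \<le> 1" using e m KJ by (auto simp: \<rho>\<^sub>0_def)
  have small: "\<rho> * (?K * J) \<le> e * m / 2" if "0 < \<rho>" "\<rho> \<le> \<rho>\<^sub>0" for \<rho>
  proof -
    have "\<rho> * (?K * J) \<le> \<rho> * (?K * J + 1)" using that by (intro mult_left_mono) auto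
    also have "\<dots> \<le> (e * m / (2 * (?K * J + 1))) * (?K * J + 1)"
      using that KJ by (intro mult_right_mono) (auto simp: \<rho>\<^sub>0_def)
    also have "\<dots> = e * m / 2"
    proof -
      have "(e * m / (2 * D)) * D = e * m / 2" if "0 < D" for D
        using that by simp
      then show ?thesis using KJ .
    qed
    finally show ?thesis .
  qed
  have stft_ge: "c * (e * m / 2) \<le> cmod (stft \<phi> (distr_of (gauss c b \<rho>)) x \<xi>)"
    if c: "0 \<le> c" and \<rho>: "0 < \<rho>" "\<rho> \<le> \<rho>\<^sub>0" and x: "\<rho> * norm (x - b) \<le> 1" and \<xi>: "\<sigma> * norm (\<xi> - \<xi>\<^sub>0) \<le> 1" for c b \<rho> x \<xi>
  proof -
    let ?f = "gauss c b \<rho>"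
    let ?D = "\<lambda>z. (?f (x + z) - ?f x) * cnj (\<phi> z)"
    have [measurable]: "(\<lambda>z. cnj (\<phi> z)) \<in> borel_measurable borel" by (rule schwartz_borel[OF cs])
    have iD': "integrable lborel (\<lambda>z. (c * \<rho>) * (Cp * decay ?d (z::'a)))" using iJ by simp
    have D_le: "cmod (?D z) \<le> (c * \<rho>) * (Cp * decay ?d z)" for z
    proof -
      have "cmod (?D z) \<le> (c * (\<rho> * norm z)) * cmod (\<phi> z)"
        unfolding norm_mult complex_mod_cnj using c \<rho> by (intro mult_right_mono gauss_lipschitz) auto
      also have "\<dots> = (c * \<rho>) * (norm z * cmod (\<phi> z))" by (simp only: ac_simps)
      also have "\<dots> \<le> (c * \<rho>) * (Cp * decay ?d z)" using c \<rho> by (intro mult_left_mono moment) auto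
      finally show ?thesis .
    qed
    have D_meas: "?D \<in> borel_measurable borel" by measurable
    have iD: "integrable lborel ?D" by (rule integrable_dominated[OF iD' D_meas D_le])
    have "stft \<phi> (distr_of ?f) x \<xi> = fourier (\<lambda>y. (\<lambda>z. ?f (x + z) * cnj (\<phi> z)) (y - x)) \<xi>"
      by (subst stft_distr_of[OF schwartz_integrable[OF schwartz_gauss[OF \<rho>(1)]] \<phi>(1)]) simp
    also have "\<dots> = exp (- \<i> * of_real (x \<bullet> \<xi>)) * fourier (\<lambda>z. ?f (x + z) * cnj (\<phi> z)) \<xi>"
      by (rule fourier_translate) measurable
    finally have "cmod (stft \<phi> (distr_of ?f) x \<xi>) = cmod (fourier (\<lambda>z. ?f x * cnj (\<phi> z) + ?D z) \<xi>)"
      by (simp add: norm_mult algebra_simps)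
    also have "fourier (\<lambda>z. ?f x * cnj (\<phi> z) + ?D z) \<xi> = ?f x * ?\<Phi> \<xi> + fourier ?D \<xi>"
      using int iD by (subst fourier_add) (auto simp: fourier_cmult)
    finally have "cmod (?f x) * cmod (?\<Phi> \<xi>) - cmod (fourier ?D \<xi>) \<le> cmod (stft \<phi> (distr_of ?f) x \<xi>)"
      using norm_diff_ineq[of "?f x * ?\<Phi> \<xi>" "fourier ?D \<xi>"] by (simp add: norm_mult)
    moreover have "(c * e) * m \<le> cmod (?f x) * cmod (?\<Phi> \<xi>)"
      unfolding e_def using c m by (intro mult_mono cmod_gauss_ge \<Phi>_ge(1)[OF \<xi>] x c \<rho>) auto
    moreover have "cmod (fourier ?D \<xi>) \<le> c * (e * m / 2)"
    proof -
      have "cmod (fourier ?D \<xi>) \<le> ?K * (LINT z|lborel. (c * \<rho>) * (Cp * decay ?d (z::'a)))"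
        by (rule fourier_norm_le[OF iD' D_le D_meas])
      also have "\<dots> = c * (\<rho> * (?K * J))" by (simp add: J_def)
      also have "\<dots> \<le> c * (e * m / 2)" using c by (intro mult_left_mono small \<rho>)
      finally show ?thesis .
    qed
    ultimately show ?thesis by (simp add: field_simps)
  qed
  define R where "R = 1 + norm \<xi>\<^sub>0 + 1 / \<sigma>"
  define \<mu> where "\<mu> = R powr (- \<bar>s\<bar>)"
  have R: "1 \<le> R" using \<sigma> by (simp add: R_def)
  have \<mu>: "0 < \<mu>" using R by (simp add: \<mu>_def)
  have weight: "\<mu> \<le> bracket \<xi> powr s" if "\<sigma> * norm (\<xi> - \<xi>\<^sub>0) \<le> 1" for \<xi>
  proof -
    have "norm \<xi> \<le> norm \<xi>\<^sub>0 + norm (\<xi> - \<xi>\<^sub>0)" using norm_triangle_ineq[of \<xi>\<^sub>0 "\<xi> - \<xi>\<^sub>0"] by simp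
    then have "bracket \<xi> \<le> R"
      using bracket_le_1_norm[of \<xi>] \<Phi>_ge(2)[OF that] by (simp add: R_def)
    then have "\<mu> \<le> bracket \<xi> powr (- \<bar>s\<bar>)"
      unfolding \<mu>_def by (intro powr_mono2') auto
    also have "\<dots> \<le> bracket \<xi> powr s"
      using bracket_ge_1[of \<xi>] by (intro powr_mono) auto
    finally show ?thesis .
  qed
  have main: "ennreal (c * (e * m / 2 * \<mu>) * w) * (indicator (cball 0 1) (\<rho> *\<^sub>R (x - b)) * indicator (cball 0 1) (\<sigma> *\<^sub>R (\<xi> - \<xi>\<^sub>0)))
      \<le> ennreal (weighted_stft \<phi> s t (gauss c b \<rho>) x \<xi>)"
    if c: "0 \<le> c" and \<rho>: "0 < \<rho>" "\<rho> \<le> \<rho>\<^sub>0" and w: "0 \<le> w" "\<And>x. \<rho> * norm (x - b) \<le> 1 \<Longrightarrow> w \<le> bracket x powr t"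
    for c b \<rho> w x \<xi>
  proof (cases "\<rho> * norm (x - b) \<le> 1 \<and> \<sigma> * norm (\<xi> - \<xi>\<^sub>0) \<le> 1")
    case True
    then have "(c * (e * m / 2)) * w * \<mu> \<le> weighted_stft \<phi> s t (gauss c b \<rho>) x \<xi>"
      using c w \<mu> e m by (intro mult_mono stft_ge weight \<rho>) auto
    then have "ennreal (c * (e * m / 2 * \<mu>) * w) \<le> ennreal (weighted_stft \<phi> s t (gauss c b \<rho>) x \<xi>)"
      by (intro ennreal_leI) (simp add: ac_simps)
    then show ?thesis
      by (auto simp: indicator_def)
  next
    case False
    then have "\<rho> *\<^sub>R (x - b) \<notin> cball 0 1 \<or> \<sigma> *\<^sub>R (\<xi> - \<xi>\<^sub>0) \<notin> cball 0 1" using \<rho> \<sigma> by simp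
    then have "indicator (cball 0 1) (\<rho> *\<^sub>R (x - b)) = (0::ennreal) \<or> indicator (cball 0 1) (\<sigma> *\<^sub>R (\<xi> - \<xi>\<^sub>0)) = (0::ennreal)"
      using indicator_simps(2) by metis
    then show ?thesis by (elim disjE) (simp_all only: mult_zero_right mult_zero_left zero_le)
  qed
  have all: "\<forall>c\<ge>0. \<forall>b \<rho> w. 0 < \<rho> \<longrightarrow> \<rho> \<le> \<rho>\<^sub>0 \<longrightarrow> 0 \<le> w \<longrightarrow>
    (weight_ge t w \<rho> b 1) \<longrightarrow>
    (\<forall>x \<xi>. ennreal (c * (e * m / 2 * \<mu>) * w) * (indicator (cball 0 1) (\<rho> *\<^sub>R (x - b)) * indicator (cball 0 1) (\<sigma> *\<^sub>R (\<xi> - \<xi>\<^sub>0)))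
      \<le> ennreal (weighted_stft \<phi> s t (gauss c b \<rho>) x \<xi>))"
    by (intro allI impI, rule main) blast+
  have pos: "0 < e * m / 2 * \<mu>" using e m \<mu> by simp
  show ?thesis
    by (rule exI[of _ "e * m / 2 * \<mu>"], rule conjI[OF pos], rule exI[of _ \<rho>\<^sub>0], rule exI[of _ \<xi>\<^sub>0], rule exI[of _ \<sigma>])
      (intro conjI \<sigma> \<rho>\<^sub>0 all)
qed

lemma M_norm_W_norm_gauss_le:
  fixes \<phi> :: "'a::euclidean_space \<Rightarrow> complex"
  assumes \<phi>: "schwartz \<phi>" and p: "1 \<le> p" and q: "1 \<le> q" and \<rho>: "0 < \<rho>" and "0 \<le> K"
    and le: "\<And>x \<xi>. weighted_stft \<phi> s t (gauss c a \<rho>) x \<xi> \<le> K * (A x * B \<xi>)"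
    and A: "continuous_on UNIV A" "\<And>x. 0 \<le> A x" "Lp_enorm p (\<lambda>x. ennreal (A x)) < \<infinity>"
    and B: "continuous_on UNIV B" "\<And>x. 0 \<le> B x" "Lp_enorm q (\<lambda>x. ennreal (B x)) < \<infinity>"
  shows "M_norm \<phi> p q s t (distr_of (gauss c a \<rho>)) \<le> ennreal K * (Lp_enorm p (\<lambda>x. ennreal (A x)) * Lp_enorm q (\<lambda>x. ennreal (B x)))"
    and "W_norm \<phi> p q s t (distr_of (gauss c a \<rho>)) \<le> ennreal K * (Lp_enorm p (\<lambda>x. ennreal (A x)) * Lp_enorm q (\<lambda>x. ennreal (B x)))"
proof -
  let ?F = "\<lambda>x \<xi>. weighted_stft \<phi> s t (gauss c a \<rho>) x \<xi>"
  have cont: "continuous_on UNIV (\<lambda>z. ?F (fst z) (snd z))"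
    by (rule stft_gauss_continuous[OF \<phi> \<rho>])
  have swap: "continuous_on UNIV (\<lambda>z. ?F (snd z) (fst z))"
    using continuous_on_compose2[OF cont, of UNIV "\<lambda>z. (snd z, fst z)"]
    by (simp add: continuous_on_Pair continuous_on_fst continuous_on_snd)
  show "M_norm \<phi> p q s t (distr_of (gauss c a \<rho>)) \<le> ennreal K * (Lp_enorm p (\<lambda>x. ennreal (A x)) * Lp_enorm q (\<lambda>x. ennreal (B x)))"
    unfolding M_norm_def by (rule Lp_enorm_iterated_le[OF p q cont A(1,2) B(1,2) \<open>0 \<le> K\<close> le A(3)])
  have "?F x \<xi> \<le> K * (B \<xi> * A x)" for x \<xi>
    using le[of x \<xi>] by (simp only: mult.commute[of "B \<xi>"])
  from Lp_enorm_iterated_le[OF q p swap B(1,2) A(1,2) \<open>0 \<le> K\<close> this B(3)]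
  show "W_norm \<phi> p q s t (distr_of (gauss c a \<rho>)) \<le> ennreal K * (Lp_enorm p (\<lambda>x. ennreal (A x)) * Lp_enorm q (\<lambda>x. ennreal (B x)))"
    unfolding W_norm_def by (simp only: mult.commute[of "Lp_enorm q _"])
qed

lemma gauss_upper_M_W:
  fixes \<phi> :: "'a::euclidean_space \<Rightarrow> complex"
  assumes \<phi>: "schwartz \<phi>" and p: "1 \<le> p" and q: "1 \<le> q"
  shows "gauss_upper distr_of (M_space \<phi> p q s t) (M_norm \<phi> p q s t) p t"
    and "gauss_upper distr_of (W_space \<phi> p q s t) (W_norm \<phi> p q s t) p t"
proof -
  let ?d = "2 * DIM('a)" and ?e = "- real DIM('a) * enn2real (1 / p)"
  let ?P = "\<lambda>X N k C. \<forall>c\<ge>0. \<forall>(a::'a) \<rho> W. 0 < \<rho> \<longrightarrow> \<rho> \<le> 1 \<longrightarrow> 0 < W \<longrightarrow>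
    (weight_le t W \<rho> a k) \<longrightarrow>
    distr_of (gauss c a \<rho>) \<in> X \<and> N (distr_of (gauss c a \<rho>)) \<le> ennreal (c * (C * W * \<rho> powr ?e))"
  have key: "\<exists>C>0. ?P (M_space \<phi> p q s t) (M_norm \<phi> p q s t) k C \<and> ?P (W_space \<phi> p q s t) (W_norm \<phi> p q s t) k C" for k
  proof -
    obtain C where C: "0 < C" and le: "\<forall>c\<ge>0. \<forall>a \<rho> W. 0 < \<rho> \<longrightarrow> \<rho> \<le> 1 \<longrightarrow> 0 < W \<longrightarrow>
      (weight_le t W \<rho> a k) \<longrightarrow>
      (\<forall>x \<xi>. weighted_stft \<phi> s t (gauss c a \<rho>) x \<xi>
      \<le> (c * C * W) * (decay ?d (\<rho> *\<^sub>R (x - a)) * decay ?d \<xi>))"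
      using stft_gauss_le[OF \<phi>, of t k s] by blast
    obtain D1 where D1: "0 < D1" "\<And>(a::'a) \<rho>. 0 < \<rho> \<Longrightarrow>
      Lp_enorm p (\<lambda>x. ennreal (decay ?d (\<rho> *\<^sub>R (x - a)))) \<le> ennreal (D1 * \<rho> powr ?e)"
      using Lp_enorm_decay_le[OF p, where 'a='a] by blast
    obtain D2 where D2: "0 < D2" and D2': "\<And>(a::'a) \<rho>. 0 < \<rho> \<Longrightarrow>
      Lp_enorm q (\<lambda>x. ennreal (decay ?d (\<rho> *\<^sub>R (x - a)))) \<le> ennreal (D2 * \<rho> powr (- real DIM('a) * enn2real (1 / q)))"
      using Lp_enorm_decay_le[OF q, where 'a='a] by blast
    have q_le: "Lp_enorm q (\<lambda>x::'a. ennreal (decay ?d x)) \<le> ennreal D2"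
      using D2'[of 1 0] by simp
    have le2: "M_norm \<phi> p q s t (distr_of (gauss c a \<rho>)) \<le> ennreal (c * ((C * D1 * D2) * W * \<rho> powr ?e)) \<and>
      W_norm \<phi> p q s t (distr_of (gauss c a \<rho>)) \<le> ennreal (c * ((C * D1 * D2) * W * \<rho> powr ?e))"
      if c: "0 \<le> c" and \<rho>: "0 < \<rho>" "\<rho> \<le> 1" and W: "0 < W" "weight_le t W \<rho> a k"
      for c \<rho> W and a :: 'a
    proof -
      let ?A = "\<lambda>x. decay ?d (\<rho> *\<^sub>R (x - a))"
      have K: "0 \<le> c * C * W" using c C W(1) by simp
      have bound: "weighted_stft \<phi> s t (gauss c a \<rho>) x \<xi>
          \<le> (c * C * W) * (?A x * decay ?d \<xi>)" for x \<xi>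
        using le c \<rho> W by blast
      have A: "continuous_on UNIV ?A" "\<And>x. 0 \<le> ?A x" "Lp_enorm p (\<lambda>x. ennreal (?A x)) < \<infinity>"
        using D1(2)[OF \<rho>(1), of a] by (auto intro!: continuous_intros intro: le_less_trans)
      have B: "continuous_on UNIV (decay ?d :: 'a \<Rightarrow> real)" "\<And>x::'a. 0 \<le> decay ?d x" "Lp_enorm q (\<lambda>x::'a. ennreal (decay ?d x)) < \<infinity>"
        using q_le by (auto intro!: continuous_intros intro: le_less_trans)
      have "ennreal (c * C * W) * (Lp_enorm p (\<lambda>x. ennreal (?A x)) * Lp_enorm q (\<lambda>x::'a. ennreal (decay ?d x)))
          \<le> ennreal (c * C * W) * (ennreal (D1 * \<rho> powr ?e) * ennreal D2)"
        by (intro mult_mono q_le D1(2) \<rho>) auto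
      also have "\<dots> = ennreal (c * ((C * D1 * D2) * W * \<rho> powr ?e))"
        using K D1(1) D2 by (simp add: ennreal_mult[symmetric] ac_simps)
      finally show ?thesis
        using M_norm_W_norm_gauss_le[OF \<phi> p q \<rho>(1) K bound A B] by (intro conjI) (erule order_trans[rotated], assumption)+
    qed
    have temp: "tempered_distribution (distr_of (gauss c a \<rho> :: 'a \<Rightarrow> complex))" if "0 < \<rho>" for c a \<rho>
      by (intro tempered_distribution_distr_of schwartz_integrable schwartz_gauss that)
    have fin: "N < \<infinity>" if "N \<le> ennreal r" for N r
      by (rule le_less_trans[OF that]) simp
    have "?P (M_space \<phi> p q s t) (M_norm \<phi> p q s t) k (C * D1 * D2)"
      using le2 temp fin unfolding M_space_def mem_Collect_eq by blast
    moreover have "?P (W_space \<phi> p q s t) (W_norm \<phi> p q s t) k (C * D1 * D2)"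
      using le2 temp fin unfolding W_space_def mem_Collect_eq by blast
    moreover have "0 < C * D1 * D2" using C D1(1) D2 by simp
    ultimately show ?thesis by blast
  qed
  show "gauss_upper distr_of (M_space \<phi> p q s t) (M_norm \<phi> p q s t) p t"
    unfolding gauss_upper_def
  proof
    fix k
    show "\<exists>C>0. ?P (M_space \<phi> p q s t) (M_norm \<phi> p q s t) k C"
      using key[of k] by (elim exE conjE) (intro exI conjI; assumption)
  qed
  show "gauss_upper distr_of (W_space \<phi> p q s t) (W_norm \<phi> p q s t) p t"
    unfolding gauss_upper_def
  proof
    fix k
    show "\<exists>C>0. ?P (W_space \<phi> p q s t) (W_norm \<phi> p q s t) k C"
      using key[of k] by (elim exE conjE) (intro exI conjI; assumption)
  qed
qed

lemma gauss_lower_M_W: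
  fixes \<phi> :: "'a::euclidean_space \<Rightarrow> complex"
  assumes \<phi>: "schwartz \<phi>" "\<phi> \<noteq> (\<lambda>x. 0)" and p: "1 \<le> p" and q: "1 \<le> q"
  shows "gauss_lower distr_of (M_norm \<phi> p q s t) p t"
    and "gauss_lower distr_of (W_norm \<phi> p q s t) p t"
proof -
  let ?e = "- real DIM('a) * enn2real (1 / p)"
  obtain \<kappa> \<rho>\<^sub>0 \<xi>\<^sub>0 \<sigma> where \<kappa>: "0 < \<kappa>" and \<sigma>: "0 < \<sigma>" and \<rho>\<^sub>0: "0 < \<rho>\<^sub>0" "\<rho>\<^sub>0 \<le> 1"
    and ge: "\<forall>c\<ge>0. \<forall>b \<rho> w. 0 < \<rho> \<longrightarrow> \<rho> \<le> \<rho>\<^sub>0 \<longrightarrow> 0 \<le> w \<longrightarrow>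
    (weight_ge t w \<rho> b 1) \<longrightarrow>
    (\<forall>x \<xi>. ennreal (c * \<kappa> * w) * (indicator (cball 0 1) (\<rho> *\<^sub>R (x - b)) * indicator (cball 0 1) (\<sigma> *\<^sub>R (\<xi> - \<xi>\<^sub>0)))
      \<le> ennreal (weighted_stft \<phi> s t (gauss c b \<rho>) x \<xi>))"
    using stft_gauss_ge[OF \<phi>, of t s] by (elim exE conjE) (rule that; assumption)
  obtain k1 where k1: "0 < k1" "\<And>(b::'a) \<rho>. 0 < \<rho> \<Longrightarrow>
      ennreal (k1 * \<rho> powr ?e) \<le> Lp_enorm p (\<lambda>x. indicator (cball 0 1) (\<rho> *\<^sub>R (x - b)))"
    using Lp_enorm_ball_ge[OF p, where 'a='a] by blast
  obtain k2' where k2': "0 < k2'" "\<And>(b::'a) \<rho>. 0 < \<rho> \<Longrightarrow>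
      ennreal (k2' * \<rho> powr (- real DIM('a) * enn2real (1 / q))) \<le> Lp_enorm q (\<lambda>x. indicator (cball 0 1) (\<rho> *\<^sub>R (x - b)))"
    using Lp_enorm_ball_ge[OF q, where 'a='a] by blast
  define k2 where "k2 = k2' * \<sigma> powr (- real DIM('a) * enn2real (1 / q))"
  have k2: "0 < k2" "ennreal k2 \<le> Lp_enorm q (\<lambda>\<xi>. indicator (cball 0 1) (\<sigma> *\<^sub>R (\<xi> - \<xi>\<^sub>0)))"
    using k2'(1) k2'(2)[OF \<sigma>, of \<xi>\<^sub>0] \<sigma> by (auto simp: k2_def)
  have main: "ennreal (c * ((\<kappa> * k1 * k2) * w * \<rho> powr ?e)) \<le> M_norm \<phi> p q s t (distr_of (gauss c b \<rho>)) \<and>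
      ennreal (c * ((\<kappa> * k1 * k2) * w * \<rho> powr ?e)) \<le> W_norm \<phi> p q s t (distr_of (gauss c b \<rho>))"
    if c: "0 \<le> c" and \<rho>: "0 < \<rho>" "\<rho> \<le> \<rho>\<^sub>0" and w: "0 \<le> w" "weight_ge t w \<rho> b 1"
    for c \<rho> w and b :: 'a
  proof -
    let ?A = "\<lambda>x. indicator (cball 0 1) (\<rho> *\<^sub>R (x - b)) :: ennreal" and ?B = "\<lambda>\<xi>. indicator (cball 0 1) (\<sigma> *\<^sub>R (\<xi> - \<xi>\<^sub>0)) :: ennreal"
    let ?F = "\<lambda>x \<xi>. ennreal (weighted_stft \<phi> s t (gauss c b \<rho>) x \<xi>)"
    have K: "0 \<le> c * \<kappa> * w" using c \<kappa> w(1) by simp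
    have bound: "ennreal (c * \<kappa> * w) * (?A x * ?B \<xi>) \<le> ?F x \<xi>" for x \<xi>
      using ge c \<rho> w by blast
    then have bound': "ennreal (c * \<kappa> * w) * (?B \<xi> * ?A x) \<le> ?F x \<xi>" for x \<xi>
      by (simp only: mult.commute[of "?B \<xi>"])
    have fin: "?A x < \<infinity>" "?B \<xi> < \<infinity>" for x \<xi>
      by (auto simp: indicator_def)
    have eq: "ennreal (c * ((\<kappa> * k1 * k2) * w * \<rho> powr ?e)) = ennreal (c * \<kappa> * w) * (ennreal (k1 * \<rho> powr ?e) * ennreal k2)"
      using K k1(1) k2(1) by (simp add: ennreal_mult[symmetric] ac_simps)
    also have "\<dots> \<le> ennreal (c * \<kappa> * w) * (ennreal (k1 * \<rho> powr ?e) * Lp_enorm q ?B)"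
      by (intro mult_left_mono k2(2)) auto
    also have "\<dots> \<le> M_norm \<phi> p q s t (distr_of (gauss c b \<rho>))"
      unfolding M_norm_def
      by (rule Lp_enorm_iterated_ge[OF p q K borel_measurable_indicator_cball_affine borel_measurable_indicator_cball_affine
            fin _ k1(2)[OF \<rho>(1)] bound]) simp
    finally have M: "ennreal (c * ((\<kappa> * k1 * k2) * w * \<rho> powr ?e)) \<le> M_norm \<phi> p q s t (distr_of (gauss c b \<rho>))" .
    have "ennreal (c * ((\<kappa> * k1 * k2) * w * \<rho> powr ?e)) = ennreal (c * \<kappa> * w) * (ennreal k2 * ennreal (k1 * \<rho> powr ?e))"
      unfolding eq by (simp only: mult.commute[of "ennreal k2"])
    also have "\<dots> \<le> ennreal (c * \<kappa> * w) * (ennreal k2 * Lp_enorm p ?A)"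
      by (intro mult_left_mono k1(2) \<rho>) auto
    also have "\<dots> \<le> W_norm \<phi> p q s t (distr_of (gauss c b \<rho>))"
      unfolding W_norm_def
      by (rule Lp_enorm_iterated_ge[OF q p K borel_measurable_indicator_cball_affine borel_measurable_indicator_cball_affine
            fin(2,1) _ k2(2) bound']) simp
    finally show ?thesis using M by blast
  qed
  have pos: "0 < \<kappa> * k1 * k2" using \<kappa> k1(1) k2(1) by simp
  show "gauss_lower distr_of (M_norm \<phi> p q s t) p t"
    unfolding gauss_lower_def
    by (rule exI[of _ "\<kappa> * k1 * k2"], rule conjI[OF pos], rule exI[of _ \<rho>\<^sub>0]) (use main \<rho>\<^sub>0 in blast)
  show "gauss_lower distr_of (W_norm \<phi> p q s t) p t"
    unfolding gauss_lower_def
    by (rule exI[of _ "\<kappa> * k1 * k2"], rule conjI[OF pos], rule exI[of _ \<rho>\<^sub>0]) (use main \<rho>\<^sub>0 in blast)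
qed

section \<open>Continuity tested on Gaussians\<close>

text \<open>This is \<open>pi powr (d / 2)\<close>, the integral of \<open>exp (- (norm x)\<^sup>2)\<close>.\<close>

definition gauss_conv_const :: "'a::euclidean_space itself \<Rightarrow> real" where
  "gauss_conv_const _ = sqrt 2 powr (- real DIM('a)) * (2 * pi) powr (real DIM('a) / 2)"

lemma integral_std_gauss: "(LINT x|lborel. gauss 1 0 1 (x::'a::euclidean_space)) = of_real ((2 * pi) powr (real DIM('a) / 2))"
proof -
  have "of_real ((2 * pi) powr (- real DIM('a) / 2)) * (LINT x|lborel. gauss 1 0 1 (x::'a)) = 1"
    using fun_cong[OF fourier_std_gauss, of "0::'a"] by (simp add: fourier_def) (simp add: gauss_def)
  moreover have "complex_of_real ((2 * pi) powr (real DIM('a) / 2)) * of_real ((2 * pi) powr (- real DIM('a) / 2)) = 1"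
    by (simp add: of_real_mult[symmetric] powr_add[symmetric] del: of_real_mult)
  ultimately show ?thesis
    by (metis mult.assoc mult.left_neutral mult.right_neutral)
qed

text \<open>By the parallelogram identity, the product of the two Gaussians is, as a function of the integration
  variable, a Gaussian around the midpoint \<open>m\<close> of \<open>b\<close> and \<open>x - a\<close>.\<close>

lemma convolve_gauss:
  fixes a b :: "'a::euclidean_space"
  assumes \<rho>: "0 < \<rho>"
  shows "convolve (gauss c1 a \<rho>) (gauss c2 b \<rho>)
    = gauss (c1 * c2 * (gauss_conv_const TYPE('a) * \<rho> powr (- real DIM('a)))) (a + b) (\<rho> / sqrt 2)"
proof
  fix x
  define h where "h = (1 / 2) *\<^sub>R (x - (a + b))"
  define m where "m = b + h"
  have norms: "(norm (\<rho> *\<^sub>R (x - y - a)))\<^sup>2 + (norm (\<rho> *\<^sub>R (y - b)))\<^sup>2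
      = (norm ((\<rho> / sqrt 2) *\<^sub>R (x - (a + b))))\<^sup>2 + (norm ((sqrt 2 * \<rho>) *\<^sub>R (y - m)))\<^sup>2" for y
  proof -
    define u where "u = y - m"
    have "h + h = x - (a + b)" by (simp add: h_def scaleR_add_left[symmetric])
    then have e: "x - y - a = h - u" "y - b = h + u" "x - (a + b) = 2 *\<^sub>R h"
      by (auto simp: u_def m_def algebra_simps scaleR_2)
    have n: "(norm (c *\<^sub>R z))\<^sup>2 = c\<^sup>2 * (z \<bullet> z)" for c and z :: 'a
      by (simp add: power_mult_distrib power2_norm_eq_inner)
    show ?thesis
      unfolding e u_def[symmetric] scaleR_scaleR n
      by (simp add: power_mult_distrib power_divide inner_add_left inner_add_right inner_diff_left inner_diff_right inner_commute algebra_simps)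
  qed
  have "gauss c1 a \<rho> (x - y) * gauss c2 b \<rho> y
      = of_real (c1 * c2 * exp (- (norm ((\<rho> / sqrt 2) *\<^sub>R (x - (a + b))))\<^sup>2 / 2)) * gauss 1 0 1 ((sqrt 2 * \<rho>) *\<^sub>R (y - m))" for y
  proof -
    have "exp (- (norm (\<rho> *\<^sub>R (x - y - a)))\<^sup>2 / 2) * exp (- (norm (\<rho> *\<^sub>R (y - b)))\<^sup>2 / 2)
      = exp (- ((norm (\<rho> *\<^sub>R (x - y - a)))\<^sup>2 + (norm (\<rho> *\<^sub>R (y - b)))\<^sup>2) / 2)"
      by (simp add: exp_add[symmetric] add_divide_distrib)
    also have "\<dots> = exp (- (norm ((\<rho> / sqrt 2) *\<^sub>R (x - (a + b))))\<^sup>2 / 2) * exp (- (norm ((sqrt 2 * \<rho>) *\<^sub>R (y - m)))\<^sup>2 / 2)"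
      unfolding norms by (simp add: exp_add[symmetric] add_divide_distrib)
    finally have "(c1 * exp (- (norm (\<rho> *\<^sub>R (x - y - a)))\<^sup>2 / 2)) * (c2 * exp (- (norm (\<rho> *\<^sub>R (y - b)))\<^sup>2 / 2))
      = (c1 * c2 * exp (- (norm ((\<rho> / sqrt 2) *\<^sub>R (x - (a + b))))\<^sup>2 / 2)) * (1 * exp (- (norm (1 *\<^sub>R ((sqrt 2 * \<rho>) *\<^sub>R (y - m) - 0)))\<^sup>2 / 2))"
      by (simp only: ac_simps scaleR_one diff_zero mult_1)
    then show ?thesis
      unfolding gauss_def of_real_mult[symmetric] by (rule arg_cong)
  qed
  then have "convolve (gauss c1 a \<rho>) (gauss c2 b \<rho>) x
      = of_real (c1 * c2 * exp (- (norm ((\<rho> / sqrt 2) *\<^sub>R (x - (a + b))))\<^sup>2 / 2)) * (LINT y|lborel. gauss 1 0 1 ((sqrt 2 * \<rho>) *\<^sub>R (y - m)))"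
    unfolding convolve_def by (simp only: integral_mult_right_zero)
  also have "(LINT y|lborel. gauss 1 0 1 ((sqrt 2 * \<rho>) *\<^sub>R (y - m))) = of_real (gauss_conv_const TYPE('a) * \<rho> powr (- real DIM('a)))"
    using \<rho> by (subst lborel_integral_affine) (auto simp: integral_std_gauss gauss_conv_const_def powr_mult scaleR_conv_of_real)
  finally show "convolve (gauss c1 a \<rho>) (gauss c2 b \<rho>) x
    = gauss (c1 * c2 * (gauss_conv_const TYPE('a) * \<rho> powr (- real DIM('a)))) (a + b) (\<rho> / sqrt 2) x"
    unfolding gauss_def of_real_mult[symmetric] by (simp add: ac_simps)
qed

lemma bracket_powr_le_scaled:
  assumes \<rho>: "0 < \<rho>" "\<rho> \<le> 1"
  shows "\<exists>W>0. \<forall>x::'a::real_normed_vector. bracket x powr t \<le> W * bracket (\<rho> *\<^sub>R x) ^ nat \<lceil>\<bar>t\<bar>\<rceil>"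
proof -
  have le: "bracket x \<le> (1 / \<rho>) * bracket (\<rho> *\<^sub>R x)" for x :: 'a
  proof -
    have "\<rho>\<^sup>2 \<le> 1" using \<rho> by (simp add: power_le_one)
    then have "(\<rho> * bracket x)\<^sup>2 \<le> (bracket (\<rho> *\<^sub>R x))\<^sup>2"
      by (simp add: bracket_def power_mult_distrib distrib_left)
    then have "\<rho> * bracket x \<le> bracket (\<rho> *\<^sub>R x)"
      by (rule power2_le_imp_le) simp
    then show ?thesis using \<rho> by (simp add: field_simps)
  qed
  have "bracket x powr t \<le> (1 / \<rho>) powr \<bar>t\<bar> * bracket (\<rho> *\<^sub>R x) ^ nat \<lceil>\<bar>t\<bar>\<rceil>" for x :: 'a
  proof -
    have "bracket x powr t \<le> bracket x powr \<bar>t\<bar>"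
      using bracket_ge_1[of x] by (intro powr_mono) auto
    also have "\<dots> \<le> ((1 / \<rho>) * bracket (\<rho> *\<^sub>R x)) powr \<bar>t\<bar>"
      by (intro powr_mono2 le) auto
    also have "\<dots> = (1 / \<rho>) powr \<bar>t\<bar> * bracket (\<rho> *\<^sub>R x) powr \<bar>t\<bar>"
      by (rule powr_mult)
    also have "\<dots> \<le> (1 / \<rho>) powr \<bar>t\<bar> * bracket (\<rho> *\<^sub>R x) powr real (nat \<lceil>\<bar>t\<bar>\<rceil>)"
      using bracket_ge_1[of "\<rho> *\<^sub>R x"] by (intro mult_left_mono powr_mono) (auto simp: of_nat_ceiling)
    finally show ?thesis by (simp only: powr_realpow[OF bracket_pos])
  qed
  then show ?thesis using \<rho> by (intro exI[of _ "(1 / \<rho>) powr \<bar>t\<bar>"]) auto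
qed

text \<open>All three spaces enter through this inequality only. It is the homogeneous form of continuity at
  zero, for Gaussians: scale the two factors so that their norms are just below the radius that
  continuity provides.\<close>

lemma gauss_test_inequality:
  fixes \<iota> :: "('a::euclidean_space \<Rightarrow> complex) \<Rightarrow> 'u::minus"
  assumes ext: "convolution_extends \<iota> X1 N1 X2 N2 X0 N0"
    and diff: "\<And>f. \<iota> f - \<iota> (\<lambda>x. 0) = \<iota> f"
    and upper1: "gauss_upper \<iota> X1 N1 p1 t1" and upper2: "gauss_upper \<iota> X2 N2 p2 t2"
    and lower: "gauss_lower \<iota> N0 p0 t0"
  shows "\<exists>D>0. \<exists>\<rho>\<^sub>0. 0 < \<rho>\<^sub>0 \<and> \<rho>\<^sub>0 \<le> 1 \<and> (\<forall>(a::'a) b \<rho> W1 W2 w. 0 < \<rho> \<longrightarrow> \<rho> \<le> \<rho>\<^sub>0 \<longrightarrow> 0 < W1 \<longrightarrow> 0 < W2 \<longrightarrow> 0 \<le> w \<longrightarrow>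
    (weight_le t1 W1 \<rho> a k1) \<longrightarrow>
    (weight_le t2 W2 \<rho> b k2) \<longrightarrow>
    (weight_ge t0 w \<rho> (a + b) 2) \<longrightarrow>
    w * \<rho> powr (- real DIM('a) * (1 + enn2real (1 / p0)))
      \<le> D * W1 * W2 * \<rho> powr (- real DIM('a) * (enn2real (1 / p1) + enn2real (1 / p2))))"
proof -
  define d where "d = real DIM('a)"
  define e0 e1 e2 where e_defs: "e0 = enn2real (1 / p0)" "e1 = enn2real (1 / p1)" "e2 = enn2real (1 / p2)"
  have e0_nonneg: "0 \<le> e0" by (simp add: e_defs)
  have gauss_0: "gauss 0 a \<rho> = (\<lambda>x. 0)" for a :: 'a and \<rho> by (auto simp: gauss_def)
  have zero_in: "\<iota> (\<lambda>x. 0) \<in> X" if "gauss_upper \<iota> X N p t" for X N p t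
  proof -
    obtain W where W: "0 < W" "\<forall>x::'a. bracket x powr t \<le> W * bracket (1 *\<^sub>R x) ^ nat \<lceil>\<bar>t\<bar>\<rceil>"
      using bracket_powr_le_scaled[of 1 t] by auto
    have "\<forall>x::'a. bracket x powr t \<le> W * bracket (1 *\<^sub>R (x - 0)) ^ nat \<lceil>\<bar>t\<bar>\<rceil>"
      using W(2) by simp
    then have "\<iota> (gauss 0 0 1) \<in> X"
      using that[unfolded gauss_upper_def, rule_format, of "nat \<lceil>\<bar>t\<bar>\<rceil>"] W(1)
      by (metis order_refl zero_less_one)
    then show ?thesis by (simp only: gauss_0)
  qed
  obtain T where T: "continuous_map2 X1 N1 X2 N2 X0 N0 T"
    "\<And>f g. schwartz f \<Longrightarrow> schwartz g \<Longrightarrow> T (\<iota> f) (\<iota> g) = \<iota> (convolve f g)"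
    using ext unfolding convolution_extends_def by blast
  have schwartz_0: "schwartz (\<lambda>x::'a. 0::complex)"
    using schwartz_gauss[of 1 0 "0::'a"] unfolding gauss_0 by simp
  have "convolve (\<lambda>x. 0) (\<lambda>x. 0) = (\<lambda>x::'a. 0)"
    by (simp add: convolve_def fun_eq_iff)
  then have T0: "T (\<iota> (\<lambda>x. 0)) (\<iota> (\<lambda>x. 0)) = \<iota> (\<lambda>x. 0)"
    using T(2)[OF schwartz_0 schwartz_0] by simp
  obtain \<delta> where \<delta>: "0 < \<delta>" and cont: "\<And>u v. u \<in> X1 \<Longrightarrow> v \<in> X2 \<Longrightarrow> N1 (u - \<iota> (\<lambda>x. 0)) < ennreal \<delta> \<Longrightarrow>
      N2 (v - \<iota> (\<lambda>x. 0)) < ennreal \<delta> \<Longrightarrow> N0 (T u v - T (\<iota> (\<lambda>x. 0)) (\<iota> (\<lambda>x. 0))) < ennreal 1"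
    using T(1) zero_in[OF upper1] zero_in[OF upper2] unfolding continuous_map2_def
    by (meson zero_less_one)
  obtain C1 where C1: "0 < C1" and u1: "\<forall>c\<ge>0. \<forall>a \<rho> W. 0 < \<rho> \<longrightarrow> \<rho> \<le> 1 \<longrightarrow> 0 < W \<longrightarrow>
    (weight_le t1 W \<rho> a k1) \<longrightarrow>
    \<iota> (gauss c a \<rho>) \<in> X1 \<and> N1 (\<iota> (gauss c a \<rho>)) \<le> ennreal (c * (C1 * W * \<rho> powr (- d * e1)))"
    using upper1[unfolded gauss_upper_def, THEN spec, of k1, folded d_def e_defs]
    by (elim exE conjE) (rule that; assumption)
  obtain C2 where C2: "0 < C2" and u2: "\<forall>c\<ge>0. \<forall>a \<rho> W. 0 < \<rho> \<longrightarrow> \<rho> \<le> 1 \<longrightarrow> 0 < W \<longrightarrow>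
    (weight_le t2 W \<rho> a k2) \<longrightarrow>
    \<iota> (gauss c a \<rho>) \<in> X2 \<and> N2 (\<iota> (gauss c a \<rho>)) \<le> ennreal (c * (C2 * W * \<rho> powr (- d * e2)))"
    using upper2[unfolded gauss_upper_def, THEN spec, of k2, folded d_def e_defs]
    by (elim exE conjE) (rule that; assumption)
  obtain \<kappa> \<rho>\<^sub>0 where \<kappa>: "0 < \<kappa>" and \<rho>\<^sub>0: "0 < \<rho>\<^sub>0" "\<rho>\<^sub>0 \<le> 1" and low: "\<forall>c\<ge>0. \<forall>b \<rho> w. 0 < \<rho> \<longrightarrow> \<rho> \<le> \<rho>\<^sub>0 \<longrightarrow> 0 \<le> w \<longrightarrow>
    (weight_ge t0 w \<rho> b 1) \<longrightarrow>
    ennreal (c * (\<kappa> * w * \<rho> powr (- d * e0))) \<le> N0 (\<iota> (gauss c b \<rho>))"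
    using lower[unfolded gauss_lower_def, folded d_def e_defs]
    by (elim exE conjE) (rule that; assumption)
  define G where "G = gauss_conv_const TYPE('a)"
  have G: "0 < G" by (simp add: G_def gauss_conv_const_def)
  define D where "D = 4 * C1 * C2 / (\<delta>\<^sup>2 * G * \<kappa>)"
  have D: "0 < D" using C1 C2 \<delta> G \<kappa> by (simp add: D_def)
  have main: "w * \<rho> powr (- d * (1 + e0)) \<le> D * W1 * W2 * \<rho> powr (- d * (e1 + e2))"
    if \<rho>: "0 < \<rho>" "\<rho> \<le> \<rho>\<^sub>0" and W: "0 < W1" "0 < W2" and w: "0 \<le> w"
      and le1: "weight_le t1 W1 \<rho> a k1"
      and le2: "weight_le t2 W2 \<rho> b k2"
      and ge: "weight_ge t0 w \<rho> (a + b) 2" for a b :: 'a and \<rho> W1 W2 w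
  proof -
    have \<rho>1: "\<rho> \<le> 1" using \<rho> \<rho>\<^sub>0 by linarith
    define U1 where "U1 = C1 * W1 * \<rho> powr (- d * e1)"
    define U2 where "U2 = C2 * W2 * \<rho> powr (- d * e2)"
    have U: "0 < U1" "0 < U2" using C1 C2 W \<rho> by (auto simp: U1_def U2_def)
    \<comment> \<open>Scaling by \<open>c1\<close> and \<open>c2\<close> brings both norms down to \<open>\<delta> / 2\<close>.\<close>
    define c1 c2 where c_defs: "c1 = \<delta> / (2 * U1)" "c2 = \<delta> / (2 * U2)"
    have c: "0 < c1" "0 < c2" "c1 * U1 = \<delta> / 2" "c2 * U2 = \<delta> / 2" using U \<delta> by (auto simp: c_defs)
    have small: "ennreal (\<delta> / 2) < ennreal \<delta>" using \<delta> by (simp add: ennreal_less_iff)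
    have in1: "\<iota> (gauss c1 a \<rho>) \<in> X1" "N1 (\<iota> (gauss c1 a \<rho>)) < ennreal \<delta>"
      using u1[rule_format, of c1 \<rho> W1 a] c \<rho> \<rho>1 W le1 le_less_trans[OF _ small] unfolding U1_def[symmetric] by auto
    have in2: "\<iota> (gauss c2 b \<rho>) \<in> X2" "N2 (\<iota> (gauss c2 b \<rho>)) < ennreal \<delta>"
      using u2[rule_format, of c2 \<rho> W2 b] c \<rho> \<rho>1 W le2 le_less_trans[OF _ small] unfolding U2_def[symmetric] by auto
    define \<sigma> where "\<sigma> = \<rho> / sqrt 2"
    have "\<rho> * 1 \<le> \<rho> * sqrt 2" using \<rho> by (intro mult_left_mono) auto
    then have \<sigma>: "0 < \<sigma>" "\<sigma> \<le> \<rho>" using \<rho> by (auto simp: \<sigma>_def field_simps)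
    have "N0 (T (\<iota> (gauss c1 a \<rho>)) (\<iota> (gauss c2 b \<rho>)) - T (\<iota> (\<lambda>x. 0)) (\<iota> (\<lambda>x. 0))) < ennreal 1"
      using in1 in2 by (intro cont) (simp_all only: diff)
    then have less: "N0 (\<iota> (gauss (c1 * c2 * (G * \<rho> powr (- d))) (a + b) \<sigma>)) < 1"
      unfolding T0 T(2)[OF schwartz_gauss[OF \<rho>(1)] schwartz_gauss[OF \<rho>(1)]] convolve_gauss[OF \<rho>(1)] diff
      by (simp add: G_def d_def \<sigma>_def)
    have cond: "w \<le> bracket x powr t0" if "\<sigma> * norm (x - (a + b)) \<le> 1" for x
    proof -
      have "\<rho> * norm (x - (a + b)) = sqrt 2 * (\<sigma> * norm (x - (a + b)))" by (simp add: \<sigma>_def)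
      also have "\<dots> \<le> sqrt 2 * 1" using that by (intro mult_left_mono) auto
      also have "\<dots> \<le> 2" using sqrt2_less_2 by simp
      finally show ?thesis using ge by blast
    qed
    have "0 \<le> c1 * c2 * (G * \<rho> powr (- d))" using c G by simp
    then have "ennreal (c1 * c2 * (G * \<rho> powr (- d)) * (\<kappa> * w * \<sigma> powr (- d * e0)))
        \<le> N0 (\<iota> (gauss (c1 * c2 * (G * \<rho> powr (- d))) (a + b) \<sigma>))"
      using low \<sigma> \<rho>(2) w cond order_trans[OF \<sigma>(2) \<rho>(2)] by blast
    with less have "ennreal (c1 * c2 * (G * \<rho> powr (- d)) * (\<kappa> * w * \<sigma> powr (- d * e0))) < ennreal 1"
      by (simp only: ennreal_1 le_less_trans)
    then have lt1: "c1 * c2 * (G * \<rho> powr (- d)) * (\<kappa> * w * \<sigma> powr (- d * e0)) < 1"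
      using c G \<kappa> w by (subst (asm) ennreal_less_iff) auto
    have "\<rho> powr (- d * e0) \<le> \<sigma> powr (- d * e0)"
      using \<sigma> e0_nonneg by (intro powr_mono2') (auto simp: d_def)
    then have "c1 * c2 * (G * \<rho> powr (- d)) * (\<kappa> * w * \<rho> powr (- d * e0)) \<le> c1 * c2 * (G * \<rho> powr (- d)) * (\<kappa> * w * \<sigma> powr (- d * e0))"
      using c G \<kappa> w by (intro mult_left_mono) auto
    with lt1 have "c1 * c2 * (G * \<rho> powr (- d)) * (\<kappa> * w * \<rho> powr (- d * e0)) \<le> 1" by linarith
    moreover have "\<rho> powr (- d) * \<rho> powr (- d * e0) = \<rho> powr (- d * (1 + e0))"
      by (simp add: powr_add[symmetric] algebra_simps)
    ultimately have "(c1 * c2) * (G * \<kappa> * (w * \<rho> powr (- d * (1 + e0)))) \<le> 1"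
      by (simp add: ac_simps)
    then have "(c1 * U1) * (c2 * U2) * (G * \<kappa> * (w * \<rho> powr (- d * (1 + e0)))) \<le> U1 * U2"
      using mult_left_mono[of _ 1 "U1 * U2"] U by (simp add: ac_simps)
    then have "\<delta>\<^sup>2 * G * \<kappa> * (w * \<rho> powr (- d * (1 + e0))) \<le> 4 * (U1 * U2)"
      unfolding c by (simp add: power2_eq_square field_simps)
    then have "w * \<rho> powr (- d * (1 + e0)) \<le> 4 * (U1 * U2) / (\<delta>\<^sup>2 * G * \<kappa>)"
      using \<delta> G \<kappa> by (subst pos_le_divide_eq) (auto simp: ac_simps)
    also have "\<dots> = D * W1 * W2 * (\<rho> powr (- d * e1) * \<rho> powr (- d * e2))"
      by (simp add: D_def U1_def U2_def ac_simps)
    also have "\<rho> powr (- d * e1) * \<rho> powr (- d * e2) = \<rho> powr (- d * (e1 + e2))"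
      by (simp add: powr_add[symmetric] algebra_simps)
    finally show ?thesis .
  qed
  show ?thesis
    unfolding d_def[symmetric] e_defs[symmetric]
    by (rule exI[of _ D], rule conjI[OF D], rule exI[of _ \<rho>\<^sub>0]) (rule conjI[OF \<rho>\<^sub>0(1)], rule conjI[OF \<rho>\<^sub>0(2)], (rule allI impI)+, rule main; assumption)
qed

section \<open>Moving the centers\<close>

text \<open>When \<open>a\<close> and \<open>\<rho> *\<^sub>R a\<close> are both large, the weight is of size \<open>norm a powr t\<close> on the bulk
  of a Gaussian of width \<open>1 / \<rho>\<close> around \<open>a\<close>. The condition with \<open>K\<close> makes the tails harmless also for
  negative \<open>t\<close>: at the origin, where the weight is larger by a factor \<open>norm a powr \<bar>t\<bar>\<close>, the Gaussian
  decays in the variable \<open>norm (\<rho> *\<^sub>R a) \<ge> norm a powr (1 / K)\<close>.\<close>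

lemma bracket_powr_le_moving:
  assumes K: "1 \<le> (K::nat)"
  shows "\<exists>C>0. \<forall>(a::'a::real_normed_vector) \<rho>. 1 \<le> norm a \<longrightarrow> 0 < \<rho> \<longrightarrow> \<rho> \<le> 1 \<longrightarrow> norm a \<le> (\<rho> * norm a) ^ K \<longrightarrow>
    (\<forall>x. bracket x powr t \<le> (C * norm a powr t) * bracket (\<rho> *\<^sub>R (x - a)) ^ nat \<lceil>real K * \<bar>t\<bar>\<rceil>)"
proof -
  define c where "c = 3 * 2 ^ K * (1::real)"
  have c: "1 \<le> c" "3 \<le> c" "2 ^ K \<le> c" 
  proof -
    have "1 \<le> (2::real) ^ K" by simp
    then show "1 \<le> c" "3 \<le> c" "2 ^ K \<le> c" unfolding c_def by linarith+
  qed
  have "bracket x powr t \<le> (c powr \<bar>t\<bar> * norm a powr t) * bracket (\<rho> *\<^sub>R (x - a)) ^ nat \<lceil>real K * \<bar>t\<bar>\<rceil>"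
    if a: "1 \<le> norm a" and \<rho>: "0 < \<rho>" "\<rho> \<le> 1" and le: "norm a \<le> (\<rho> * norm a) ^ K" for a x :: 'a and \<rho>
  proof -
    let ?y = "\<rho> *\<^sub>R (x - a)"
    define B where "B = bracket ?y ^ K"
    have y: "bracket ?y \<le> B" "1 \<le> B"
      unfolding B_def using power_increasing[OF K bracket_ge_1[of ?y]] one_le_power[OF bracket_ge_1[of ?y], of K] by auto
    have \<rho>a: "1 \<le> \<rho> * norm a"
    proof (rule ccontr)
      assume "\<not> 1 \<le> \<rho> * norm a"
      then have "(\<rho> * norm a) ^ K < 1"
        using K \<rho> by (intro power_less_one_iff[THEN iffD2]) auto
      with a le show False by linarith
    qed
    have "norm (x - a) = (1 / \<rho>) * norm ?y" using \<rho> by simp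
    also have "\<dots> \<le> norm a * bracket ?y"
      using \<rho>a \<rho> by (intro mult_mono norm_le_bracket) (auto simp: field_simps)
    finally have xa: "norm (x - a) \<le> norm a * bracket ?y" .
    have upper: "bracket x \<le> (c * B) * norm a"
    proof -
      have "bracket x \<le> 1 + norm a + norm (x - a)"
        using bracket_le_1_norm[of x] norm_triangle_ineq[of a "x - a"] by simp
      also have "\<dots> \<le> norm a * bracket ?y + norm a * bracket ?y + norm a * bracket ?y"
        using a xa mult_left_mono[OF bracket_ge_1[of ?y], of "norm a"] by (intro add_mono) auto
      also have "\<dots> = 3 * bracket ?y * norm a" by simp
      also have "\<dots> \<le> (c * B) * norm a" using c y by (intro mult_right_mono mult_mono) auto
      finally show ?thesis .
    qed
    have lower: "norm a \<le> (c * B) * bracket x"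
    proof (cases "norm a \<le> 2 * norm x")
      case True
      have "norm a \<le> 2 * bracket x" using True norm_le_bracket[of x] by linarith
      also have "\<dots> \<le> (c * B) * bracket x"
        using c y mult_mono[of 2 c 1 B] by (intro mult_right_mono) auto
      finally show ?thesis .
    next
      case False
      have "norm a \<le> norm x + norm (x - a)"
        using norm_triangle_ineq[of x "a - x"] by (simp add: norm_minus_commute)
      with False have "norm a \<le> 2 * norm (x - a)" by linarith
      then have "\<rho> * norm a \<le> 2 * norm ?y" using \<rho> by simp
      also have "\<dots> \<le> 2 * bracket ?y" using norm_le_bracket[of ?y] by simp
      finally have "(\<rho> * norm a) ^ K \<le> (2 * bracket ?y) ^ K"
        using \<rho> by (intro power_mono) auto
      with le have "norm a \<le> 2 ^ K * B" by (simp add: power_mult_distrib B_def)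
      also have "\<dots> \<le> (c * B) * 1" using c y by simp
      also have "\<dots> \<le> (c * B) * bracket x" using c y by (intro mult_left_mono bracket_ge_1) auto
      finally show ?thesis .
    qed
    have cB: "0 < c * B" using c y by (intro mult_pos_pos) auto
    have "bracket x powr t \<le> (c * B) powr \<bar>t\<bar> * norm a powr t"
    proof (cases "0 \<le> t")
      case True
      have "bracket x powr t \<le> ((c * B) * norm a) powr t"
        using True by (intro powr_mono2 upper) auto
      also have "\<dots> = (c * B) powr t * norm a powr t" by (rule powr_mult)
      finally show ?thesis using True by simp
    next
      case False
      have "norm a / (c * B) \<le> bracket x" using lower cB by (simp add: pos_divide_le_eq mult.commute)
      moreover have "0 < norm a / (c * B)" using a cB by (intro divide_pos_pos) auto
      ultimately have "bracket x powr t \<le> (norm a / (c * B)) powr t"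
        using False by (intro powr_mono2') auto
      also have "\<dots> = (c * B) powr (- t) * norm a powr t"
        by (simp only: powr_divide powr_minus) (simp only: divide_inverse ac_simps)
      finally show ?thesis using False by simp
    qed
    also have "(c * B) powr \<bar>t\<bar> = c powr \<bar>t\<bar> * B powr \<bar>t\<bar>" by (rule powr_mult)
    also have "B powr \<bar>t\<bar> = bracket ?y powr (real K * \<bar>t\<bar>)"
      by (simp add: B_def powr_realpow[symmetric] powr_powr)
    also have "(c powr \<bar>t\<bar> * bracket ?y powr (real K * \<bar>t\<bar>)) * norm a powr t
        \<le> (c powr \<bar>t\<bar> * bracket ?y powr real (nat \<lceil>real K * \<bar>t\<bar>\<rceil>)) * norm a powr t"
      using bracket_ge_1[of ?y] by (intro mult_right_mono mult_left_mono powr_mono) (auto simp: of_nat_ceiling)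
    also have "\<dots> = (c powr \<bar>t\<bar> * norm a powr t) * bracket ?y ^ nat \<lceil>real K * \<bar>t\<bar>\<rceil>"
      by (simp only: powr_realpow[OF bracket_pos] ac_simps)
    finally show ?thesis .
  qed
  moreover have "0 < c powr \<bar>t\<bar>" using c by simp
  ultimately show ?thesis by blast
qed

lemma bracket_powr_ge_moving:
  "\<exists>c>0. \<forall>(b::'a::real_normed_vector) \<rho> x. 1 \<le> norm b \<longrightarrow> 0 < \<rho> \<longrightarrow> 4 \<le> \<rho> * norm b \<longrightarrow> \<rho> * norm (x - b) \<le> 2 \<longrightarrow>
    c * norm b powr t \<le> bracket x powr t"
proof -
  have "3 powr (- \<bar>t\<bar>) * norm b powr t \<le> bracket x powr t"
    if b: "1 \<le> norm b" and \<rho>: "0 < \<rho>" "4 \<le> \<rho> * norm b" "\<rho> * norm (x - b) \<le> 2" for b x :: 'a and \<rho>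
  proof -
    have "\<rho> * (2 * norm (x - b)) \<le> \<rho> * norm b" using \<rho> by linarith
    then have near: "2 * norm (x - b) \<le> norm b" using \<rho>(1) by simp
    have "norm x \<le> norm b + norm (x - b)" "norm b \<le> norm x + norm (x - b)"
      using norm_triangle_ineq[of b "x - b"] norm_triangle_ineq[of x "b - x"] by (auto simp: norm_minus_commute)
    then have bds: "bracket x \<le> 3 * norm b" "norm b / 3 \<le> bracket x"
      using near b bracket_le_1_norm[of x] norm_le_bracket[of x] by linarith+
    show ?thesis
    proof (cases "0 \<le> t")
      case True
      have "3 powr (- \<bar>t\<bar>) * norm b powr t = norm b powr t / 3 powr t"
        using True by (simp add: powr_minus field_simps)
      also have "\<dots> = (norm b / 3) powr t" by (simp add: powr_divide)
      also have "\<dots> \<le> bracket x powr t" using True by (intro powr_mono2 bds) auto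
      finally show ?thesis .
    next
      case False
      have "3 powr (- \<bar>t\<bar>) * norm b powr t = (3 * norm b) powr t"
        using False by (simp add: powr_mult)
      also have "\<dots> \<le> bracket x powr t" using False by (intro powr_mono2' bds) auto
      finally show ?thesis .
    qed
  qed
  then show ?thesis by (intro exI[of _ "3 powr (- \<bar>t\<bar>)"]) auto
qed

lemma bracket_powr_ge_fixed:
  assumes \<rho>: "0 < \<rho>"
  shows "\<exists>w>0. \<forall>x::'a::real_normed_vector. \<rho> * norm x \<le> 2 \<longrightarrow> w \<le> bracket x powr t"
proof -
  define R where "R = 1 + 2 / \<rho>"
  have R: "0 < R" using \<rho> by (simp add: R_def add_pos_pos)
  have "R powr (- \<bar>t\<bar>) \<le> bracket x powr t" if "\<rho> * norm x \<le> 2" for x :: 'a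
  proof -
    have "norm x \<le> 2 / \<rho>" using that \<rho> by (simp add: field_simps)
    then have "bracket x \<le> R" using bracket_le_1_norm[of x] by (simp add: R_def)
    then have "R powr (- \<bar>t\<bar>) \<le> bracket x powr (- \<bar>t\<bar>)" by (intro powr_mono2') auto
    also have "\<dots> \<le> bracket x powr t" using bracket_ge_1[of x] by (intro powr_mono) auto
    finally show ?thesis .
  qed
  then show ?thesis using R by (intro exI[of _ "R powr (- \<bar>t\<bar>)"]) auto
qed

lemma powr_at_top_at_top: "0 < a \<Longrightarrow> filterlim (\<lambda>x::real. x powr a) at_top at_top"
  by real_asymp

lemma powr_le_at_top_imp_exponent_le:
  assumes c: "0 < c" and le: "\<forall>\<^sub>F x::real in at_top. c * x powr \<alpha> \<le> D * x powr \<beta>"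
  shows "\<alpha> \<le> \<beta>"
proof (rule ccontr)
  assume "\<not> \<alpha> \<le> \<beta>"
  then have "filterlim (\<lambda>x::real. c * x powr (\<alpha> - \<beta>)) at_top at_top"
    using c by (intro filterlim_tendsto_pos_mult_at_top[OF tendsto_const] powr_at_top_at_top) auto
  then have "\<forall>\<^sub>F x::real in at_top. D < c * x powr (\<alpha> - \<beta>)"
    by (simp add: filterlim_at_top_dense)
  with le eventually_gt_at_top[of 0] have "\<forall>\<^sub>F x::real in at_top. False"
  proof eventually_elim
    case (elim x)
    have "D * x powr \<beta> < (c * x powr (\<alpha> - \<beta>)) * x powr \<beta>"
      using elim by (intro mult_strict_right_mono) auto
    also have "\<dots> = c * x powr \<alpha>" by (simp add: mult.assoc powr_add[symmetric])
    finally show False using elim by simp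
  qed
  then show False by simp
qed

lemma eventually_far:
  assumes "0 < \<rho>"
  shows "\<forall>\<^sub>F x::real in at_top. 1 \<le> x \<and> x \<le> (\<rho> * x) ^ 2 \<and> 4 \<le> \<rho> * x"
  using eventually_ge_at_top[of 1] eventually_ge_at_top[of "4 / \<rho>"] eventually_ge_at_top[of "1 / \<rho>\<^sup>2"]
proof eventually_elim
  case (elim x)
  have "1 \<le> \<rho>\<^sup>2 * x" "4 \<le> \<rho> * x" using elim assms by (auto simp: field_simps)
  moreover have "1 * x \<le> (\<rho>\<^sup>2 * x) * x" using \<open>1 \<le> \<rho>\<^sup>2 * x\<close> elim by (intro mult_right_mono) auto
  ultimately show ?case using elim by (simp add: power_mult_distrib power2_eq_square mult.assoc)
qed

text \<open>The hypothesis is the test inequality with the width and one of the two Gaussians fixed.\<close>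

lemma one_center_far:
  assumes \<rho>: "0 < \<rho>" "\<rho> \<le> 1" and E: "0 < E"
    and test: "\<And>(a::'a::euclidean_space) V w. 0 < V \<Longrightarrow> 0 \<le> w \<Longrightarrow>
      weight_le t1 V \<rho> a (nat \<lceil>real 2 * \<bar>t1\<bar>\<rceil>) \<Longrightarrow> weight_ge t0 w \<rho> a 2 \<Longrightarrow> w * E \<le> D * V"
  shows "t0 \<le> t1"
proof -
  obtain e :: 'a where "e \<in> Basis" using nonempty_Basis by blast
  then have ne: "norm e = 1" by simp
  obtain C where C: "0 < C" "\<And>(a::'a) \<rho> x. 1 \<le> norm a \<Longrightarrow> 0 < \<rho> \<Longrightarrow> \<rho> \<le> 1 \<Longrightarrow> norm a \<le> (\<rho> * norm a) ^ 2 \<Longrightarrow>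
      bracket x powr t1 \<le> (C * norm a powr t1) * bracket (\<rho> *\<^sub>R (x - a)) ^ nat \<lceil>real 2 * \<bar>t1\<bar>\<rceil>"
    using bracket_powr_le_moving[of 2 t1, where 'a='a] by auto
  obtain c where c: "0 < c" "\<And>(b::'a) \<rho> x. 1 \<le> norm b \<Longrightarrow> 0 < \<rho> \<Longrightarrow> 4 \<le> \<rho> * norm b \<Longrightarrow> \<rho> * norm (x - b) \<le> 2 \<Longrightarrow>
      c * norm b powr t0 \<le> bracket x powr t0"
    using bracket_powr_ge_moving[of t0, where 'a='a] by auto
  have "\<forall>\<^sub>F x::real in at_top. (c * E) * x powr t0 \<le> (D * C) * x powr t1"
    using eventually_far[OF \<rho>(1)]
  proof eventually_elim
    case (elim x)
    have "(c * norm (x *\<^sub>R e) powr t0) * E \<le> D * (C * norm (x *\<^sub>R e) powr t1)"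
      using elim C(1) c(1) \<rho> ne by (intro test[of _ _ "x *\<^sub>R e"] allI impI C(2) c(2)) auto
    then show ?case using elim ne by (simp add: ac_simps)
  qed
  then show ?thesis
    using c(1) E by (intro powr_le_at_top_imp_exponent_le[of "c * E"]) auto
qed

text \<open>The choices of centers are two opposite points, so that the convolution stays at the origin, for the first
  claim; the origin and one point far away for the next two; and twice the same point \<open>a\<close>, with
  width \<open>norm a powr (1 - 1 / K)\<close>, for the last one. The width has to be of smaller order than
  \<open>norm a\<close>, which costs a factor \<open>1 - 1 / K\<close> that disappears in the limit.\<close>

lemma exponent_conditions:
  assumes test: "\<And>k1 k2. \<exists>D>0. \<exists>\<rho>\<^sub>0. 0 < \<rho>\<^sub>0 \<and> \<rho>\<^sub>0 \<le> 1 \<and> (\<forall>(a::'a::euclidean_space) b \<rho> W1 W2 w. 0 < \<rho> \<longrightarrow> \<rho> \<le> \<rho>\<^sub>0 \<longrightarrow> 0 < W1 \<longrightarrow> 0 < W2 \<longrightarrow> 0 \<le> w \<longrightarrow>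
    (weight_le t1 W1 \<rho> a k1) \<longrightarrow>
    (weight_le t2 W2 \<rho> b k2) \<longrightarrow>
    (weight_ge t0 w \<rho> (a + b) 2) \<longrightarrow>
    w * \<rho> powr (- d * (1 + e0)) \<le> D * W1 * W2 * \<rho> powr (- d * (e1 + e2)))" (is "\<And>k1 k2. \<exists>D>0. \<exists>\<rho>\<^sub>0. 0 < \<rho>\<^sub>0 \<and> \<rho>\<^sub>0 \<le> 1 \<and> ?Q k1 k2 D \<rho>\<^sub>0")
  shows "0 \<le> t1 + t2" "t0 \<le> t1" "t0 \<le> t2" "d * (1 + e0 - e1 - e2) \<le> t1 + t2 - t0"
proof -
  obtain e :: 'a where "e \<in> Basis" using nonempty_Basis by blast
  then have ne: "norm e = 1" by simp
  note far = eventually_far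
  obtain C1 where C1: "0 < C1" "\<And>(a::'a) \<rho> x. 1 \<le> norm a \<Longrightarrow> 0 < \<rho> \<Longrightarrow> \<rho> \<le> 1 \<Longrightarrow> norm a \<le> (\<rho> * norm a) ^ 2 \<Longrightarrow>
      bracket x powr t1 \<le> (C1 * norm a powr t1) * bracket (\<rho> *\<^sub>R (x - a)) ^ nat \<lceil>real 2 * \<bar>t1\<bar>\<rceil>"
    using bracket_powr_le_moving[of 2 t1, where 'a='a] by auto
  obtain C2 where C2: "0 < C2" "\<And>(a::'a) \<rho> x. 1 \<le> norm a \<Longrightarrow> 0 < \<rho> \<Longrightarrow> \<rho> \<le> 1 \<Longrightarrow> norm a \<le> (\<rho> * norm a) ^ 2 \<Longrightarrow>
      bracket x powr t2 \<le> (C2 * norm a powr t2) * bracket (\<rho> *\<^sub>R (x - a)) ^ nat \<lceil>real 2 * \<bar>t2\<bar>\<rceil>"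
    using bracket_powr_le_moving[of 2 t2, where 'a='a] by auto
  obtain c0 where c0: "0 < c0" "\<And>(b::'a) \<rho> x. 1 \<le> norm b \<Longrightarrow> 0 < \<rho> \<Longrightarrow> 4 \<le> \<rho> * norm b \<Longrightarrow> \<rho> * norm (x - b) \<le> 2 \<Longrightarrow>
      c0 * norm b powr t0 \<le> bracket x powr t0"
    using bracket_powr_ge_moving[of t0, where 'a='a] by auto
  show "0 \<le> t1 + t2"
  proof -
    obtain D \<rho> where D: "0 < D" and \<rho>: "0 < \<rho>" "\<rho> \<le> 1" and Q: "?Q (nat \<lceil>real 2 * \<bar>t1\<bar>\<rceil>) (nat \<lceil>real 2 * \<bar>t2\<bar>\<rceil>) D \<rho>"
      using test[of "nat \<lceil>real 2 * \<bar>t1\<bar>\<rceil>" "nat \<lceil>real 2 * \<bar>t2\<bar>\<rceil>"] by (elim exE conjE) (rule that; assumption)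
    note T = Q[rule_format, OF \<rho>(1) order_refl]
    obtain w where w: "0 < w" "\<And>x::'a. \<rho> * norm x \<le> 2 \<Longrightarrow> w \<le> bracket x powr t0"
      using bracket_powr_ge_fixed[OF \<rho>(1), of t0] by blast
    have "\<forall>\<^sub>F x::real in at_top. (w * \<rho> powr (- d * (1 + e0))) * x powr 0 \<le> (D * C1 * C2 * \<rho> powr (- d * (e1 + e2))) * x powr (t1 + t2)"
      using far[OF \<rho>(1)]
    proof eventually_elim
      case (elim x)
      have "w * \<rho> powr (- d * (1 + e0)) \<le> D * (C1 * norm (x *\<^sub>R e) powr t1) * (C2 * norm (- (x *\<^sub>R e)) powr t2) * \<rho> powr (- d * (e1 + e2))"
        using elim C1(1) C2(1) w \<rho> ne by (intro T[of _ _ w "x *\<^sub>R e" "- (x *\<^sub>R e)"] C1(2) C2(2)) auto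
      then show ?case using elim ne by (simp add: powr_add ac_simps)
    qed
    then show ?thesis
      using w(1) \<rho>(1) by (intro powr_le_at_top_imp_exponent_le[of "w * \<rho> powr (- d * (1 + e0))"]) auto
  qed
  show "t0 \<le> t1"
  proof -
    obtain D \<rho> where D: "0 < D" and \<rho>: "0 < \<rho>" "\<rho> \<le> 1" and Q: "?Q (nat \<lceil>real 2 * \<bar>t1\<bar>\<rceil>) (nat \<lceil>\<bar>t2\<bar>\<rceil>) D \<rho>"
      using test[of "nat \<lceil>real 2 * \<bar>t1\<bar>\<rceil>" "nat \<lceil>\<bar>t2\<bar>\<rceil>"] by (elim exE conjE) (rule that; assumption)
    obtain W where W: "0 < W" "\<And>x::'a. bracket x powr t2 \<le> W * bracket (\<rho> *\<^sub>R x) ^ nat \<lceil>\<bar>t2\<bar>\<rceil>"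
      using bracket_powr_le_scaled[OF \<rho>, of t2] by blast
    show ?thesis
    proof (rule one_center_far)
      fix a :: 'a and V w assume "0 < V" "0 \<le> w" "weight_le t1 V \<rho> a (nat \<lceil>real 2 * \<bar>t1\<bar>\<rceil>)" "weight_ge t0 w \<rho> a 2"
      then show "w * \<rho> powr (- d * (1 + e0)) \<le> (D * W * \<rho> powr (- d * (e1 + e2))) * V"
        using Q[rule_format, OF \<rho>(1) order_refl, of V W w a 0] W by (simp add: ac_simps)
    qed (use \<rho> in auto)
  qed
  show "t0 \<le> t2"
  proof -
    obtain D \<rho> where D: "0 < D" and \<rho>: "0 < \<rho>" "\<rho> \<le> 1" and Q: "?Q (nat \<lceil>\<bar>t1\<bar>\<rceil>) (nat \<lceil>real 2 * \<bar>t2\<bar>\<rceil>) D \<rho>"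
      using test[of "nat \<lceil>\<bar>t1\<bar>\<rceil>" "nat \<lceil>real 2 * \<bar>t2\<bar>\<rceil>"] by (elim exE conjE) (rule that; assumption)
    obtain W where W: "0 < W" "\<And>x::'a. bracket x powr t1 \<le> W * bracket (\<rho> *\<^sub>R x) ^ nat \<lceil>\<bar>t1\<bar>\<rceil>"
      using bracket_powr_le_scaled[OF \<rho>, of t1] by blast
    show ?thesis
    proof (rule one_center_far)
      fix a :: 'a and V w assume "0 < V" "0 \<le> w" "weight_le t2 V \<rho> a (nat \<lceil>real 2 * \<bar>t2\<bar>\<rceil>)" "weight_ge t0 w \<rho> a 2"
      then show "w * \<rho> powr (- d * (1 + e0)) \<le> (D * W * \<rho> powr (- d * (e1 + e2))) * V"
        using Q[rule_format, OF \<rho>(1) order_refl, of W V w 0 a] W by (simp add: ac_simps)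
    qed (use \<rho> in auto)
  qed
  have scaled: "(1 - 1 / real K) * (d * (1 + e0 - e1 - e2)) \<le> t1 + t2 - t0" if K: "2 \<le> K" for K :: nat
  proof -
    let ?\<theta> = "1 - 1 / real K"
    have \<theta>: "0 < ?\<theta>" using K by simp
    obtain B1 where B1: "0 < B1" "\<And>(a::'a) \<rho> x. 1 \<le> norm a \<Longrightarrow> 0 < \<rho> \<Longrightarrow> \<rho> \<le> 1 \<Longrightarrow> norm a \<le> (\<rho> * norm a) ^ K \<Longrightarrow>
        bracket x powr t1 \<le> (B1 * norm a powr t1) * bracket (\<rho> *\<^sub>R (x - a)) ^ nat \<lceil>real K * \<bar>t1\<bar>\<rceil>"
      using bracket_powr_le_moving[of K t1, where 'a='a] K by auto
    obtain B2 where B2: "0 < B2" "\<And>(a::'a) \<rho> x. 1 \<le> norm a \<Longrightarrow> 0 < \<rho> \<Longrightarrow> \<rho> \<le> 1 \<Longrightarrow> norm a \<le> (\<rho> * norm a) ^ K \<Longrightarrow>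
        bracket x powr t2 \<le> (B2 * norm a powr t2) * bracket (\<rho> *\<^sub>R (x - a)) ^ nat \<lceil>real K * \<bar>t2\<bar>\<rceil>"
      using bracket_powr_le_moving[of K t2, where 'a='a] K by auto
    obtain D \<rho>\<^sub>0 where D: "0 < D" and \<rho>\<^sub>0: "0 < \<rho>\<^sub>0" "\<rho>\<^sub>0 \<le> 1" and Q: "?Q (nat \<lceil>real K * \<bar>t1\<bar>\<rceil>) (nat \<lceil>real K * \<bar>t2\<bar>\<rceil>) D \<rho>\<^sub>0"
      using test[of "nat \<lceil>real K * \<bar>t1\<bar>\<rceil>" "nat \<lceil>real K * \<bar>t2\<bar>\<rceil>"] by (elim exE conjE) (rule that; assumption)
    note T = Q[rule_format]
    have lim: "((\<lambda>x::real. x powr (- ?\<theta>)) \<longlongrightarrow> 0) at_top"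
      using \<theta> by (intro tendsto_neg_powr filterlim_ident) auto
    have lim2: "filterlim (\<lambda>x::real. x powr (1 / real K)) at_top at_top"
      using K by (intro powr_at_top_at_top) auto
    have "\<forall>\<^sub>F x::real in at_top. (c0 * 2 powr t0) * x powr (t0 + ?\<theta> * d * (1 + e0))
        \<le> (D * B1 * B2) * x powr (t1 + t2 + ?\<theta> * d * (e1 + e2))"
      using eventually_ge_at_top[of 1] order_tendstoD(2)[OF lim \<rho>\<^sub>0(1)]
        lim2[unfolded filterlim_at_top, THEN spec, of 2]
    proof eventually_elim
      case (elim x)
      \<comment> \<open>This is the smallest \<open>\<rho>\<close> for which the weight bounds apply: \<open>(\<rho> * x) ^ K = x\<close>.\<close>
      let ?\<rho> = "x powr (- ?\<theta>)"
      have \<rho>x: "?\<rho> * x = x powr (1 / real K)"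
        using elim(1) powr_add[of x "- ?\<theta>" 1] by simp
      have pow: "(?\<rho> * x) ^ K = x"
        unfolding \<rho>x using elim(1) K by (simp add: powr_realpow[symmetric] powr_powr)
      have \<rho>: "0 < ?\<rho>" "?\<rho> \<le> \<rho>\<^sub>0" "?\<rho> \<le> 1" using elim \<rho>\<^sub>0 by auto
      have na: "norm (x *\<^sub>R e) = x" "norm (x *\<^sub>R e + x *\<^sub>R e) = 2 * x"
        using elim(1) ne by (auto simp: scaleR_add_left[symmetric])
      have "4 \<le> 2 * (?\<rho> * x)" unfolding \<rho>x using elim(3) by simp
      then have four: "4 \<le> ?\<rho> * (2 * x)" by (simp only: mult.left_commute)
      have "(c0 * norm (x *\<^sub>R e + x *\<^sub>R e) powr t0) * ?\<rho> powr (- d * (1 + e0))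
          \<le> D * (B1 * norm (x *\<^sub>R e) powr t1) * (B2 * norm (x *\<^sub>R e) powr t2) * ?\<rho> powr (- d * (e1 + e2))"
      proof (rule T[OF \<rho>(1,2)])
        show "bracket y powr t1 \<le> B1 * norm (x *\<^sub>R e) powr t1 * bracket (?\<rho> *\<^sub>R (y - x *\<^sub>R e)) ^ nat \<lceil>real K * \<bar>t1\<bar>\<rceil>" for y
          by (rule B1(2)) (use elim(1) \<rho> na pow in auto)
        show "bracket y powr t2 \<le> B2 * norm (x *\<^sub>R e) powr t2 * bracket (?\<rho> *\<^sub>R (y - x *\<^sub>R e)) ^ nat \<lceil>real K * \<bar>t2\<bar>\<rceil>" for y
          by (rule B2(2)) (use elim(1) \<rho> na pow in auto)
        show "c0 * norm (x *\<^sub>R e + x *\<^sub>R e) powr t0 \<le> bracket y powr t0" if "?\<rho> * norm (y - (x *\<^sub>R e + x *\<^sub>R e)) \<le> 2" for y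
          by (rule c0(2)[OF _ \<rho>(1) _ that]) (use elim(1) na four in auto)
      qed (use B1(1) B2(1) c0(1) elim(1) ne in auto)
      moreover have ex: "- ?\<theta> * (- d * E) = ?\<theta> * d * E" for E
        by (simp only: mult_minus_left mult_minus_right minus_minus mult.assoc)
      ultimately have "(c0 * 2 powr t0) * (x powr t0 * x powr (?\<theta> * d * (1 + e0)))
          \<le> (D * B1 * B2) * (x powr t1 * x powr t2 * x powr (?\<theta> * d * (e1 + e2)))"
        unfolding na powr_powr powr_mult ex by (simp only: ac_simps)
      then show ?case by (simp only: powr_add)
    qed
    then have "t0 + ?\<theta> * d * (1 + e0) \<le> t1 + t2 + ?\<theta> * d * (e1 + e2)"
      using c0(1) by (intro powr_le_at_top_imp_exponent_le[of "c0 * 2 powr t0"]) auto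
    then show ?thesis by (simp add: algebra_simps add_divide_distrib)
  qed
  have "(\<lambda>K. (1 - 1 / real K) * (d * (1 + e0 - e1 - e2))) \<longlonglongrightarrow> (1 - 0) * (d * (1 + e0 - e1 - e2))"
    by (intro tendsto_intros lim_1_over_n)
  then have "(1 - 0) * (d * (1 + e0 - e1 - e2)) \<le> t1 + t2 - t0"
    by (rule tendsto_upperbound) (use scaled in \<open>auto simp: eventually_sequentially\<close>)
  then show "d * (1 + e0 - e1 - e2) \<le> t1 + t2 - t0" by simp
qed

lemma enn2real_conj_exponent:
  assumes "1 \<le> p"
  shows "enn2real (1 / conj_exponent p) = 1 - enn2real (1 / p)"
proof -
  have eq: "1 / p + 1 / conj_exponent p = 1" by (rule conj_exponent_conjugate[OF assms])
  then have "1 / p \<noteq> top" "1 / conj_exponent p \<noteq> top"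
    by (auto simp: ennreal_add_eq_top)
  then have "enn2real (1 / p + 1 / conj_exponent p) = enn2real (1 / p) + enn2real (1 / conj_exponent p)"
    by (intro enn2real_plus) (auto simp: less_top)
  then show ?thesis unfolding eq by simp
qed

theorem proposition3p6:
  fixes \<phi> :: "real ^ 'n \<Rightarrow> complex"
    and p q :: "nat \<Rightarrow> ennreal"
    and s t :: "nat \<Rightarrow> real"
  assumes window: "schwartz \<phi>" "\<phi> \<noteq> (\<lambda>x. 0)"
    and exponents: "\<forall>j\<in>{0, 1, 2}. 1 \<le> p j \<and> 1 \<le> q j"
    and extendable:
      "convolution_extends_L TYPE(real ^ 'n)
         (p 1) (t 1) (p 2) (t 2) (conj_exponent (p 0)) (- t 0)
       \<or> convolution_extends_M \<phi>
         (p 1) (q 1) (s 1) (t 1) (p 2) (q 2) (s 2) (t 2)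
         (conj_exponent (p 0)) (conj_exponent (q 0)) (- s 0) (- t 0)
       \<or> convolution_extends_W \<phi>
         (p 1) (q 1) (s 1) (t 1) (p 2) (q 2) (s 2) (t 2)
         (conj_exponent (p 0)) (conj_exponent (q 0)) (- s 0) (- t 0)"
  shows "(\<forall>j\<in>{0, 1, 2}. \<forall>k\<in>{0, 1, 2}. j \<noteq> k \<longrightarrow> 0 \<le> t j + t k)
    \<and> 0 \<le> t 0 + t 1 + t 2 - real CARD('n) * R_functional p"
proof -
  let ?p0 = "conj_exponent (p 0)" and ?q0 = "conj_exponent (q 0)"
  have pq: "1 \<le> p 1" "1 \<le> p 2" "1 \<le> q 1" "1 \<le> q 2" "1 \<le> p 0"
    using exponents by auto
  have diff: "distr_of f - distr_of (\<lambda>x. 0) = distr_of f" for f :: "real ^ 'n \<Rightarrow> complex"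
    by (simp add: distr_of_def fun_eq_iff)
  have diff_fun: "f - (\<lambda>x. 0) = f" for f :: "real ^ 'n \<Rightarrow> complex"
    by (simp add: fun_eq_iff)
  have conds: "0 \<le> t 1 + t 2 \<and> - t 0 \<le> t 1 \<and> - t 0 \<le> t 2 \<and>
    real DIM(real ^ 'n) * (1 + enn2real (1 / ?p0) - enn2real (1 / p 1) - enn2real (1 / p 2)) \<le> t 1 + t 2 - (- t 0)" (is ?conds)
    using extendable
  proof (elim disjE)
    assume "convolution_extends_L TYPE(real ^ 'n) (p 1) (t 1) (p 2) (t 2) ?p0 (- t 0)"
    note test = gauss_test_inequality[OF this[unfolded convolution_extends_L_def] diff_fun
      gauss_upper_Lp[OF pq(1)] gauss_upper_Lp[OF pq(2)] gauss_lower_Lp[OF one_le_conj_exponent]]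
    show ?conds
      by (intro conjI exponent_conditions[OF test])
  next
    assume "convolution_extends_M \<phi> (p 1) (q 1) (s 1) (t 1) (p 2) (q 2) (s 2) (t 2) ?p0 ?q0 (- s 0) (- t 0)"
    note test = gauss_test_inequality[OF this[unfolded convolution_extends_M_def] diff
      gauss_upper_M_W(1)[OF window(1) pq(1,3)] gauss_upper_M_W(1)[OF window(1) pq(2,4)]
      gauss_lower_M_W(1)[OF window one_le_conj_exponent one_le_conj_exponent]]
    show ?conds
      by (intro conjI exponent_conditions[OF test])
  next
    assume "convolution_extends_W \<phi> (p 1) (q 1) (s 1) (t 1) (p 2) (q 2) (s 2) (t 2) ?p0 ?q0 (- s 0) (- t 0)"
    note test = gauss_test_inequality[OF this[unfolded convolution_extends_W_def] diff
      gauss_upper_M_W(2)[OF window(1) pq(1,3)] gauss_upper_M_W(2)[OF window(1) pq(2,4)]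
      gauss_lower_M_W(2)[OF window one_le_conj_exponent one_le_conj_exponent]]
    show ?conds
      by (intro conjI exponent_conditions[OF test])
  qed
  have "R_functional p = 1 + enn2real (1 / ?p0) - enn2real (1 / p 1) - enn2real (1 / p 2)"
    by (simp add: R_functional_def enn2real_conj_exponent[OF pq(5)])
  then have "0 \<le> t 0 + t 1 + t 2 - real CARD('n) * R_functional p"
    using conds by simp
  moreover have "\<forall>j\<in>{0, 1, 2}. \<forall>k\<in>{0, 1, 2}. j \<noteq> k \<longrightarrow> 0 \<le> t j + t k"
    using conds by auto
  ultimately show ?thesis by blast
qed

end
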